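(* Let $\alpha_*\in(0,1/2)$ and let $\{\theta_i,X_i\}$ be the controlled Markov chain on $\mathbb{R}\times\mathbb{R}$ defined by either the standard coerced acceptance probability algorithm (Algorithm S) or the fast coerced acceptance probability algorithm (Algorithm F) described in the context. Assume that $\pi$ and $q$ satisfy (A7) of the context and that the (positive) stepsize sequence $\{\gamma_i\}$ is such that $$\Big(\limsup_{i\to\infty}(\gamma_{i+1}^{-1}-\gamma_i^{-1})\Big)+\limsup_{i\to\infty}\gamma_i<\alpha_*\wedge\left(\tfrac12-\alpha_*\right).$$ Let $w(\theta)=\exp(|\theta|)$ for Algorithm S and $w(\theta)=1+|\theta|^2$ for Algorithm F, and $\mathcal{W}_M:=\{\theta\in\Theta:w(\theta)\le M\}$. Then there exist $M,R>0$ such that for any $(\theta,x)\in\Theta\times\mathsf{X}$, $$\mathbb{P}_{\theta,x}\left(\bigcap_{k=0}^\infty\bigcup_{i\ge k}\{(\theta_i,X_i)\in\mathcal{W}_M\times B(0,R)\}\right)=1,$$ that is, $\mathbb{P}_{\theta,x}$-a.s. $\{\theta_i,X_i\}$ visits $\mathcal{W}_M\times B(0,R)$ infinitely often.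
   Context: Setting: $\mathsf{X}=\mathbb{R}$, $\Theta=\mathbb{R}$, $q$ is a symmetric probability density, $q_\theta(z):=\exp(-\theta)q(\exp(-\theta)z)$, and $\alpha(x,y):=\min\{1,\pi(y)/\pi(x)\}$. $a\wedge b:=\min\{a,b\}$. Both algorithms start from $(\theta_0,X_0)=(\theta,x)$ and at iteration $i+1$ ($i\ge0$), conditionally on the past, draw $Z_{i+1}\sim q_{\theta_i}(\cdot)$, set $Y_{i+1}=X_i+Z_{i+1}$, and set $X_{i+1}=Y_{i+1}$ with probability $\alpha(X_i,Y_{i+1})$, $X_{i+1}=X_i$ otherwise. Then: Algorithm S: $\theta_{i+1}=\theta_i+\gamma_{i+1}(\alpha(X_i,Y_{i+1})-\alpha_* )$. Algorithm F: $\theta_{i+1}=\theta_i+\gamma_{i+1}(|\theta_i|+1)(\alpha(X_i,Y_{i+1})-\alpha_* )$. $\mathbb{P}_{\theta,x}$ is the law of the process; $B(0,R)$ is the ball of radius $R$ centered at $0$ and $B^c(0,R)$ its complement. (A7) (with $\ell:=\log\pi$): (1) $\pi$ is a probability density with respect to Lebesgue measure on $\mathbb{R}$, bounded away from $0$ on any compact set of $\mathbb{R}$, $\ell$ is twice differentiable, and for any $M>0$, with $\epsilon_x:=M/|\ell'(x)|$, $$\lim_{R\to\infty}\sup_{x\in B^c(0,R)}\sup_{|t|\le\epsilon_x}\frac{|\ell''(x+t)|}{|\ell'(x+t)|^2}=0,\quad\lim_{R\to\infty}\sup_{x\in B^c(0,R)}\sup_{|t|\le\epsilon_x}\frac{|\ell''(x+t)|}{|\ell'(x)|^2}=0,$$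 $$\lim_{R\to\infty}\sup_{x\in B^c(0,R)}\sup_{0\le t\le\epsilon_x}\left|\frac{|\ell'(x-t)|}{|\ell'(x+t)|}-1\right|=0;$$ (2) there exists $p\in(0,1)$ such that, with $\mathrm{sgn}(x)=x/|x|$, $$\lim_{R\to\infty}\sup_{x\in B^c(0,R)}\frac{\mathrm{sgn}(x)\ell'(x)}{|x|^{p-1}}<0\quad\text{and}\quad\forall\gamma\in(0,1)\ \lim_{R\to\infty}\inf_{x\in B^c(0,R)}\frac{\pi^{-\gamma}(x)}{|\ell'(x)|}>0;$$ (3) with $\sigma=\exp(\theta)$ the increment density has the form $\frac1\sigma q(z/\sigma)$ for a symmetric probability density $q$ with $\mathrm{supp}(q)=[-1,1]$ and $q:[-1,1]\to[\underline q,\bar q]$ for some $\underline q,\bar q\in(0,\infty)$. *)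

theory Defs
  imports "HOL-Probability.Probability"
begin

section \<open>Assumptions on the target density and on the increment density\<close>

definition prob_density :: "(real \<Rightarrow> real) \<Rightarrow> bool" where
  "prob_density f \<longleftrightarrow>
     f \<in> borel_measurable borel \<and> (\<forall>x. 0 \<le> f x) \<and> (\<integral>\<^sup>+x. ennreal (f x) \<partial>lborel) = 1"

abbreviation log_density :: "(real \<Rightarrow> real) \<Rightarrow> real \<Rightarrow> real" where
  "log_density \<pi> \<equiv> \<lambda>x. ln (\<pi> x)"

definition score :: "(real \<Rightarrow> real) \<Rightarrow> real \<Rightarrow> real" where
  "score \<pi> = deriv (log_density \<pi>)"

definition dscore :: "(real \<Rightarrow> real) \<Rightarrow> real \<Rightarrow> real" where
  "dscore \<pi> = deriv (score \<pi>)"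

definition radius :: "(real \<Rightarrow> real) \<Rightarrow> real \<Rightarrow> real \<Rightarrow> real" where
  "radius \<pi> M x = M / \<bar>score \<pi> x\<bar>"

text \<open>
  The suprema and infima over the complement of a ball may be infinite, so they are taken in
  the extended reals. Divisions by zero do not matter: under the first limit of
  \<open>tail_decay\<close>, \<open>score \<pi>\<close> has no zero outside some ball and \<open>radius \<pi> M x = O(\<bar>x\<bar> powr (1 - p))\<close>,
  so that for large \<open>R\<close> no denominator below vanishes. The limits in \<open>tail_decay\<close> are limits of
  monotone functions of \<open>R\<close>, hence always exist, and may be infinite.
\<close>

definition smooth_target :: "(real \<Rightarrow> real) \<Rightarrow> bool" where
  "smooth_target \<pi> \<longleftrightarrow>
     prob_density \<pi> \<and>
     (\<forall>K. compact K \<longrightarrow> (\<exists>c>0. \<forall>x\<in>K. c \<le> \<pi> x)) \<and>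
     (\<forall>x. log_density \<pi> differentiable (at x)) \<and>
     (\<forall>x. score \<pi> differentiable (at x)) \<and>
     (\<forall>M>0.
        ((\<lambda>R. SUP x\<in>- ball 0 R. SUP t\<in>{t. \<bar>t\<bar> \<le> radius \<pi> M x}.
            ereal (\<bar>dscore \<pi> (x + t)\<bar> / \<bar>score \<pi> (x + t)\<bar>\<^sup>2)) \<longlongrightarrow> 0) at_top \<and>
        ((\<lambda>R. SUP x\<in>- ball 0 R. SUP t\<in>{t. \<bar>t\<bar> \<le> radius \<pi> M x}.
            ereal (\<bar>dscore \<pi> (x + t)\<bar> / \<bar>score \<pi> x\<bar>\<^sup>2)) \<longlongrightarrow> 0) at_top \<and>
        ((\<lambda>R. SUP x\<in>- ball 0 R. SUP t\<in>{0..radius \<pi> M x}.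
            ereal \<bar>\<bar>score \<pi> (x - t)\<bar> / \<bar>score \<pi> (x + t)\<bar> - 1\<bar>) \<longlongrightarrow> 0) at_top)"

definition tail_decay :: "(real \<Rightarrow> real) \<Rightarrow> bool" where
  "tail_decay \<pi> \<longleftrightarrow>
     (\<exists>p\<in>{0<..<1}.
        (\<exists>L::ereal. L < 0 \<and>
           ((\<lambda>R. SUP x\<in>- ball 0 R. ereal (sgn x * score \<pi> x / \<bar>x\<bar> powr (p - 1))) \<longlongrightarrow> L) at_top) \<and>
        (\<forall>g\<in>{0<..<1}. \<exists>L::ereal. 0 < L \<and>
           ((\<lambda>R. INF x\<in>- ball 0 R. ereal (\<pi> x powr (- g) / \<bar>score \<pi> x\<bar>)) \<longlongrightarrow> L) at_top))"

definition compact_increment :: "(real \<Rightarrow> real) \<Rightarrow> bool" where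
  "compact_increment q \<longleftrightarrow>
     prob_density q \<and> (\<forall>z. q (- z) = q z) \<and>
     closure {z. q z \<noteq> 0} = {-1..1} \<and>
     (\<exists>ql qu. 0 < ql \<and> (\<forall>z\<in>{-1..1}. ql \<le> q z \<and> q z \<le> qu))"

definition regularity_assms :: "(real \<Rightarrow> real) \<Rightarrow> (real \<Rightarrow> real) \<Rightarrow> bool" where
  "regularity_assms \<pi> q \<longleftrightarrow> smooth_target \<pi> \<and> tail_decay \<pi> \<and> compact_increment q"


section \<open>The coerced acceptance probability algorithms\<close>

datatype coerced_alg = Standard | Fast

definition scaled :: "(real \<Rightarrow> real) \<Rightarrow> real \<Rightarrow> real \<Rightarrow> real" where
  "scaled q \<theta> z = exp (- \<theta>) * q (exp (- \<theta>) * z)"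

definition acc :: "(real \<Rightarrow> real) \<Rightarrow> real \<Rightarrow> real \<Rightarrow> real" where
  "acc \<pi> x y = min 1 (\<pi> y / \<pi> x)"

fun gain :: "coerced_alg \<Rightarrow> real \<Rightarrow> real" where
  "gain Standard \<theta> = 1"
| "gain Fast \<theta> = \<bar>\<theta>\<bar> + 1"

fun weight :: "coerced_alg \<Rightarrow> real \<Rightarrow> real" where
  "weight Standard \<theta> = exp \<bar>\<theta>\<bar>"
| "weight Fast \<theta> = 1 + \<bar>\<theta>\<bar>\<^sup>2"

definition level_set :: "coerced_alg \<Rightarrow> real \<Rightarrow> real set" where
  "level_set alg M = {\<theta>. weight alg \<theta> \<le> M}"

text \<open>
  One iteration from the state \<open>(\<theta>, x)\<close> with stepsize \<open>g\<close>: draw the increment \<open>z\<close> with density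
  \<open>scaled q \<theta>\<close>, accept \<open>x + z\<close> with probability \<open>acc \<pi> x (x + z)\<close>, and update \<open>\<theta>\<close>.
\<close>

definition coerced_step ::
  "coerced_alg \<Rightarrow> (real \<Rightarrow> real) \<Rightarrow> (real \<Rightarrow> real) \<Rightarrow> real \<Rightarrow> real \<Rightarrow> real \<times> real \<Rightarrow> (real \<times> real) measure"
where
  "coerced_step alg \<pi> q astar g = (\<lambda>(\<theta>, x).
     density lborel (\<lambda>z. ennreal (scaled q \<theta> z)) \<bind> (\<lambda>z.
       distr (measure_pmf (bernoulli_pmf (acc \<pi> x (x + z)))) borel
         (\<lambda>accepted. (\<theta> + g * gain alg \<theta> * (acc \<pi> x (x + z) - astar),
                      if accepted then x + z else x))))"

text \<open>
  The law of time \<open>i\<close> given the past \<open>\<omega> 0, \<dots>, \<omega> (i - 1)\<close>, where \<open>\<omega> i = (\<theta>\<^sub>i, X\<^sub>i)\<close>. The move from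
  \<open>\<omega> i\<close> to \<open>\<omega> (i + 1)\<close> uses \<open>\<gamma> (i + 1)\<close>, so \<open>\<gamma> 0\<close> is never used.
\<close>

fun coerced_kernel ::
  "coerced_alg \<Rightarrow> (real \<Rightarrow> real) \<Rightarrow> (real \<Rightarrow> real) \<Rightarrow> real \<Rightarrow> (nat \<Rightarrow> real) \<Rightarrow> real \<times> real \<Rightarrow>
    nat \<Rightarrow> (nat \<Rightarrow> real \<times> real) \<Rightarrow> (real \<times> real) measure"
where
  "coerced_kernel alg \<pi> q astar \<gamma> s 0 \<omega> = return borel s"
| "coerced_kernel alg \<pi> q astar \<gamma> s (Suc i) \<omega> = coerced_step alg \<pi> q astar (\<gamma> (Suc i)) (\<omega> i)"

text \<open>
  The law of the trajectory \<open>(\<theta>\<^sub>i, X\<^sub>i)\<close>, \<open>i \<ge> 0\<close>, started at \<open>s\<close>: the Ionescu-Tulcea extension of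
  the kernels above. The facts below show that the extension theorem applies and that its
  finite-dimensional marginals are the iterated kernels.
\<close>

definition chain_law ::
  "coerced_alg \<Rightarrow> (real \<Rightarrow> real) \<Rightarrow> (real \<Rightarrow> real) \<Rightarrow> real \<Rightarrow> (nat \<Rightarrow> real) \<Rightarrow> real \<times> real \<Rightarrow>
    (nat \<Rightarrow> real \<times> real) measure"
where
  "chain_law alg \<pi> q astar \<gamma> s =
     projective_family.lim UNIV
       (Ionescu_Tulcea.CI (coerced_kernel alg \<pi> q astar \<gamma> s) (\<lambda>_. borel)) (\<lambda>_. borel)"


section \<open>Well-definedness of the law\<close>

lemma scaled_density_measurable:
  assumes "prob_density q"
  shows "(\<lambda>\<theta>. density lborel (\<lambda>z. ennreal (scaled q \<theta> z))) \<in> borel \<rightarrow>\<^sub>M prob_algebra borel"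
proof (rule measurable_prob_algebraI)
  have [measurable]: "q \<in> borel_measurable borel" using assms by (simp add: prob_density_def)
  have q0: "0 \<le> q z" for z using assms by (simp add: prob_density_def)
  show ps: "prob_space (density lborel (\<lambda>z. ennreal (scaled q \<theta> z)))" for \<theta>
  proof
    have "(\<integral>\<^sup>+z. ennreal (q z) \<partial>lborel) =
        ennreal \<bar>exp (- \<theta>)\<bar> * (\<integral>\<^sup>+z. ennreal (q (0 + exp (- \<theta>) * z)) \<partial>lborel)"
      by (rule nn_integral_real_affine) auto
    also have "\<dots> = (\<integral>\<^sup>+z. ennreal (scaled q \<theta> z) \<partial>lborel)"
      by (subst nn_integral_cmult[symmetric]) (auto simp: scaled_def ennreal_mult q0)
    finally show "emeasure (density lborel (\<lambda>z. ennreal (scaled q \<theta> z)))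
        (space (density lborel (\<lambda>z. ennreal (scaled q \<theta> z)))) = 1"
      using assms by (simp add: prob_density_def emeasure_density scaled_def)
  qed
  show "(\<lambda>\<theta>. density lborel (\<lambda>z. ennreal (scaled q \<theta> z))) \<in> borel \<rightarrow>\<^sub>M subprob_algebra borel"
  proof (rule measurable_subprob_algebra)
    show "subprob_space (density lborel (\<lambda>z. ennreal (scaled q \<theta> z)))" for \<theta>
      by (rule prob_space_imp_subprob_space[OF ps])
    fix A :: "real set" assume [measurable]: "A \<in> sets borel"
    show "(\<lambda>\<theta>. emeasure (density lborel (\<lambda>z. ennreal (scaled q \<theta> z))) A) \<in> borel_measurable borel"
      unfolding scaled_def by (subst emeasure_density) measurable
  qed simp
qed

lemma bernoulli_distr_measurable:
  fixes f :: "bool \<Rightarrow> 'a \<Rightarrow> 'b"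
  assumes [measurable]: "a \<in> borel_measurable M" "\<And>b. f b \<in> M \<rightarrow>\<^sub>M N"
    and a: "\<And>x. x \<in> space M \<Longrightarrow> 0 \<le> a x \<and> a x \<le> 1"
  shows "(\<lambda>x. distr (measure_pmf (bernoulli_pmf (a x))) N (\<lambda>b. f b x)) \<in> M \<rightarrow>\<^sub>M prob_algebra N"
proof (rule measurable_prob_algebraI)
  fix x assume x: "x \<in> space M"
  have fx: "(\<lambda>b. f b x) \<in> measure_pmf (bernoulli_pmf (a x)) \<rightarrow>\<^sub>M N"
    using measurable_space[OF assms(2) x] by (auto simp: measurable_def)
  show "prob_space (distr (measure_pmf (bernoulli_pmf (a x))) N (\<lambda>b. f b x))"
    by (rule prob_space.prob_space_distr[OF prob_space_measure_pmf fx])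
next
  show "(\<lambda>x. distr (measure_pmf (bernoulli_pmf (a x))) N (\<lambda>b. f b x)) \<in> M \<rightarrow>\<^sub>M subprob_algebra N"
  proof (rule measurable_subprob_algebra)
    fix x assume x: "x \<in> space M"
    have fx: "(\<lambda>b. f b x) \<in> measure_pmf (bernoulli_pmf (a x)) \<rightarrow>\<^sub>M N"
      using measurable_space[OF assms(2) x] by (auto simp: measurable_def)
    show "subprob_space (distr (measure_pmf (bernoulli_pmf (a x))) N (\<lambda>b. f b x))"
      by (intro prob_space_imp_subprob_space prob_space.prob_space_distr[OF prob_space_measure_pmf fx])
  next
    fix A assume [measurable]: "A \<in> sets N"
    have "emeasure (distr (measure_pmf (bernoulli_pmf (a x))) N (\<lambda>b. f b x)) A =
        indicator A (f True x) * ennreal (a x) + indicator A (f False x) * ennreal (1 - a x)"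
      if x: "x \<in> space M" for x
    proof -
      have fx: "(\<lambda>b. f b x) \<in> measure_pmf (bernoulli_pmf (a x)) \<rightarrow>\<^sub>M N"
        using measurable_space[OF assms(2) x] by (auto simp: measurable_def)
      have "emeasure (distr (measure_pmf (bernoulli_pmf (a x))) N (\<lambda>b. f b x)) A =
          (\<integral>\<^sup>+b. indicator A (f b x) \<partial>measure_pmf (bernoulli_pmf (a x)))"
        using nn_integral_distr[OF fx, of "indicator A"] by simp
      also have "\<dots> = indicator A (f True x) * ennreal (a x) + indicator A (f False x) * ennreal (1 - a x)"
        using a[OF x] by (subst nn_integral_bernoulli_pmf) (auto split: split_indicator)
      finally show ?thesis .
    qed
    then show "(\<lambda>x. emeasure (distr (measure_pmf (bernoulli_pmf (a x))) N (\<lambda>b. f b x)) A)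
        \<in> borel_measurable M"
      by (subst measurable_cong) (assumption, measurable)
  qed simp
qed

lemma gain_measurable[measurable]: "gain alg \<in> borel_measurable borel"
proof (cases alg)
  case Standard
  then have "gain alg = (\<lambda>_. 1)" by (simp add: fun_eq_iff)
  then show ?thesis by simp
next
  case Fast
  then have "gain alg = (\<lambda>\<theta>. \<bar>\<theta>\<bar> + 1)" by (simp add: fun_eq_iff)
  then show ?thesis by simp
qed

lemma coerced_step_measurable:
  assumes "prob_density \<pi>" "prob_density q"
  shows "coerced_step alg \<pi> q astar g \<in> borel \<rightarrow>\<^sub>M prob_algebra borel"
proof -
  have [measurable]: "\<pi> \<in> borel_measurable borel" and p0: "0 \<le> \<pi> x" for x
    using assms(1) by (auto simp: prob_density_def)
  note [measurable] = scaled_density_measurable[OF assms(2)]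
  have "(\<lambda>s. density lborel (\<lambda>z. ennreal (scaled q (fst s) z)) \<bind> (\<lambda>z.
       distr (measure_pmf (bernoulli_pmf (acc \<pi> (snd s) (snd s + z)))) borel
         (\<lambda>b. (fst s + g * gain alg (fst s) * (acc \<pi> (snd s) (snd s + z) - astar),
                      if b then snd s + z else snd s)))) \<in> (borel \<Otimes>\<^sub>M borel) \<rightarrow>\<^sub>M prob_algebra borel"
  proof (rule measurable_bind_prob_space2[where N = borel])
    show "(\<lambda>s. density lborel (\<lambda>z. ennreal (scaled q (fst s) z))) \<in>
        (borel \<Otimes>\<^sub>M borel) \<rightarrow>\<^sub>M prob_algebra borel"
      by measurable
    have "(\<lambda>u. distr (measure_pmf (bernoulli_pmf (acc \<pi> (snd (fst u)) (snd (fst u) + snd u)))) borel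
         (\<lambda>b. (fst (fst u) + g * gain alg (fst (fst u)) * (acc \<pi> (snd (fst u)) (snd (fst u) + snd u) - astar),
                      if b then snd (fst u) + snd u else snd (fst u))))
        \<in> ((borel \<Otimes>\<^sub>M borel) \<Otimes>\<^sub>M borel) \<rightarrow>\<^sub>M prob_algebra (borel \<Otimes>\<^sub>M borel)"
      unfolding borel_prod
      by (rule bernoulli_distr_measurable)
         (simp_all add: acc_def p0 borel_prod[symmetric])
    then show "(\<lambda>(s, z). distr (measure_pmf (bernoulli_pmf (acc \<pi> (snd s) (snd s + z)))) borel
         (\<lambda>b. (fst s + g * gain alg (fst s) * (acc \<pi> (snd s) (snd s + z) - astar),
                      if b then snd s + z else snd s)))
        \<in> (borel \<Otimes>\<^sub>M borel) \<Otimes>\<^sub>M borel \<rightarrow>\<^sub>M prob_algebra borel"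
      by (simp add: case_prod_beta' borel_prod)
  qed
  then show ?thesis
    by (simp add: coerced_step_def case_prod_beta' borel_prod)
qed

lemma coerced_Ionescu_Tulcea:
  assumes "prob_density \<pi>" "prob_density q"
  shows "Ionescu_Tulcea (coerced_kernel alg \<pi> q astar \<gamma> s) (\<lambda>_. borel)"
proof -
  have K: "coerced_kernel alg \<pi> q astar \<gamma> s i \<in> PiM {0..<i} (\<lambda>_. borel) \<rightarrow>\<^sub>M prob_algebra borel" for i
  proof (cases i)
    case 0
    have "coerced_kernel alg \<pi> q astar \<gamma> s 0 = (\<lambda>_. return borel s)"
      by (simp add: fun_eq_iff)
    then show ?thesis
      by (simp add: 0 space_prob_algebra prob_space_return)
  next
    case (Suc j)
    have "coerced_kernel alg \<pi> q astar \<gamma> s (Suc j) =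
        (\<lambda>\<omega>. coerced_step alg \<pi> q astar (\<gamma> (Suc j)) (\<omega> j))"
      by (simp add: fun_eq_iff)
    moreover have "(\<lambda>\<omega>. \<omega> j) \<in> PiM {0..<Suc j} (\<lambda>_. borel :: (real \<times> real) measure) \<rightarrow>\<^sub>M borel"
      by (rule measurable_component_singleton) simp
    ultimately show ?thesis
      unfolding Suc by (simp add: measurable_compose[OF _ coerced_step_measurable[OF assms]])
  qed
  show ?thesis
  proof (rule Ionescu_Tulcea.intro)
    fix i
    show "coerced_kernel alg \<pi> q astar \<gamma> s i \<in> PiM {0..<i} (\<lambda>_. borel) \<rightarrow>\<^sub>M subprob_algebra borel"
      by (rule measurable_prob_algebraD[OF K])
    fix \<omega> :: "nat \<Rightarrow> real \<times> real"
    assume "\<omega> \<in> space (PiM {0..<i} (\<lambda>_. borel :: (real \<times> real) measure))"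
    from measurable_space[OF K this]
    show "prob_space (coerced_kernel alg \<pi> q astar \<gamma> s i \<omega>)"
      by (simp add: space_prob_algebra)
  qed
qed

lemma chain_law_marginals:
  assumes "prob_density \<pi>" "prob_density q" "finite J"
  shows "distr (chain_law alg \<pi> q astar \<gamma> s) (PiM J (\<lambda>_. borel)) (\<lambda>\<omega>. restrict \<omega> J) =
    Ionescu_Tulcea.CI (coerced_kernel alg \<pi> q astar \<gamma> s) (\<lambda>_. borel) J"
  unfolding chain_law_def
  by (rule Ionescu_Tulcea.distr_lim[OF coerced_Ionescu_Tulcea[OF assms(1,2)] assms(3)])

lemma chain_law_space:
  assumes "prob_density \<pi>" "prob_density q"
  shows "sets (chain_law alg \<pi> q astar \<gamma> s) = sets (PiM UNIV (\<lambda>_. borel))"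
    and "space (chain_law alg \<pi> q astar \<gamma> s) = UNIV"
    and "prob_space (chain_law alg \<pi> q astar \<gamma> s)"
proof -
  interpret IT: Ionescu_Tulcea "coerced_kernel alg \<pi> q astar \<gamma> s" "\<lambda>_. borel"
    by (rule coerced_Ionescu_Tulcea[OF assms])
  show "sets (chain_law alg \<pi> q astar \<gamma> s) = sets (PiM UNIV (\<lambda>_. borel))"
    and sp: "space (chain_law alg \<pi> q astar \<gamma> s) = UNIV"
    unfolding chain_law_def by (simp_all add: space_PiM)
  have "prob_space (IT.CI {})" by (rule IT.PF.prob_space_P) auto
  then show "prob_space (chain_law alg \<pi> q astar \<gamma> s)"
    unfolding chain_law_marginals[OF assms finite.emptyI, symmetric]
    by (rule prob_space_distrD[rotated])
       (simp add: chain_law_def measurable_cong_sets[OF IT.PF.sets_lim refl])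
qed

end

theory Submission
  imports Defs
begin

text \<open>
  Let \<open>V = \<pi> powr (- 1 / 2)\<close>, let \<open>W\<close> be the weight of the statement and \<open>\<sigma> = exp \<theta>\<close>. The function
  \<open>L\<^sub>i(\<theta>, x) = W(\<theta>) / \<gamma>\<^sub>i + V(x)\<close> satisfies \<open>E (L\<^sub>i\<^sub>+\<^sub>1 | past) \<le> L\<^sub>i - 1\<close> outside of a set \<open>{W \<le> M} \<times> ball 0 R\<close>
  once \<open>i\<close> is large, and Foster's criterion applies. Dividing \<open>W\<close> by the stepsize puts both components on
  the same time scale; the price is the term \<open>(1 / \<gamma>\<^sub>i\<^sub>+\<^sub>1 - 1 / \<gamma>\<^sub>i) W(\<theta>)\<close>, which, together with the second
  order term of size \<open>\<gamma>\<^sub>i\<^sub>+\<^sub>1 W(\<theta>)\<close>, the hypothesis on the stepsizes allows the drift of \<open>W\<close> to absorb.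

  The mean acceptance probability is at least almost \<open>1 / 2\<close> for small \<open>\<sigma>\<close>, which settles \<open>\<theta> \<rightarrow> - \<infinity>\<close>. It is
  small when \<open>\<sigma>\<close> is much larger than the length of the level set \<open>{\<pi> \<ge> \<pi>(x)}\<close>, and then \<open>W\<close> decreases. If
  \<open>x\<close> is far out and \<open>\<sigma>\<close> is not that large, \<open>W\<close> may increase by a multiple of \<open>W(\<theta>)\<close>, but the drift
  of \<open>V\<close> is below any given multiple of \<open>- \<sigma>\<close>. That drift is computed by pairing the proposals
  \<open>x + z\<close> and \<open>x - z\<close>.
\<close>

section \<open>Drift of the Lyapunov function in the tails\<close>

text \<open>The obstacle is that the scale \<sigma> is unbounded and the drift of \<open>V\<close>
  is not uniform in it: on compact sets of x it is merely bounded above, and for small \<sigma> it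
  is only of order V (l' \<sigma>)^2, where l = ln \<pi>. Two consequences of (A7) are exploited: x
  l'(x) tends to minus infinity, and l is close to its tangent over distances where the tangent
  changes by at most 8. The first makes \<open>V\<close> grow at least cubically while |l'(x)| is at
  least 1/|x|, so \<open>V\<close> exceeds any multiple of the length of the level set and V l'^2 is
  unbounded. For \<sigma> bounded below and at most a given multiple of that length, this yields a
  drift below - K \<sigma>. Since \<open>W\<close> is at most 2 exp |\<theta>|, such a drift absorbs
  any multiple of \<open>W\<close> as long as \<theta> is bounded below.

  The choice of constants is not circular: the global upper bound for the drift of \<open>V\<close>
  and the small-scale acceptance fix a lower end for \<theta>; this fixes K, K fixes the ball for x,
  and the ball fixes the upper end for \<theta>.\<close>

definition lyap :: "(real \<Rightarrow> real) \<Rightarrow> real \<Rightarrow> real" where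
  "lyap l x = exp (- l x / 2)"

definition acc_ln :: "(real \<Rightarrow> real) \<Rightarrow> real \<Rightarrow> real \<Rightarrow> real" where
  "acc_ln l x y = min 1 (exp (l y - l x))"

definition lyap_incr :: "(real \<Rightarrow> real) \<Rightarrow> real \<Rightarrow> real \<Rightarrow> real" where
  "lyap_incr l x y = acc_ln l x y * (lyap l y - lyap l x)"

lemma lyap_pos [simp]: "0 < lyap l x" and lyap_nonneg [simp]: "0 \<le> lyap l x"
  by (simp_all add: lyap_def)

lemma acc_ln_nonneg [simp]: "0 \<le> acc_ln l x y" and acc_ln_le_1 [simp]: "acc_ln l x y \<le> 1"
  by (simp_all add: acc_ln_def)

text \<open>The minimum of 1 and a positive number is at most their geometric mean. Acceptance is
  thereby controlled by the integral of \<open>exp (l y / 2)\<close>, and \<open>lyap l x\<close> is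
  exactly the normalizing factor.\<close>

lemma acc_ln_le_exp_half: "acc_ln l x y \<le> exp ((l y - l x) / 2)"
proof (cases "l x \<le> l y")
  case False
  then show ?thesis by (auto simp: acc_ln_def min_le_iff_disj)
qed (auto simp: acc_ln_def min_le_iff_disj)

lemma incr_up: "l x \<le> l y \<Longrightarrow> lyap_incr l x y = lyap l x * (exp (- (l y - l x) / 2) - 1)"
  by (simp add: lyap_incr_def acc_ln_def lyap_def algebra_simps exp_add[symmetric] field_simps)

text \<open>With u = exp (- (l x - l y) / 2) the acceptance probability is u^2 and the ratio of the
  values of \<open>lyap\<close> is 1 / u, so the increment is u^2 (1 / u - 1) = u - u^2 in units of
  \<open>lyap l x\<close>.\<close>

lemma incr_down:
  assumes "l y \<le> l x"
  shows "lyap_incr l x y = lyap l x * (exp (- (l x - l y) / 2) - (exp (- (l x - l y) / 2))\<^sup>2)"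
proof -
  have "(exp (- (l x - l y) / 2))\<^sup>2 = exp (l y - l x)"
    by (simp add: power2_eq_square exp_add[symmetric] field_simps)
  moreover have "exp (l y - l x) * lyap l y = lyap l x * exp (- (l x - l y) / 2)"
    by (simp add: lyap_def exp_add[symmetric] field_simps)
  ultimately show ?thesis
    using assms by (simp add: lyap_incr_def acc_ln_def algebra_simps)
qed

lemma incr_le_exp_half: "lyap_incr l x y \<le> lyap l x * exp ((l y - l x) / 2)"
proof (cases "l x \<le> l y")
  case True
  then have "exp (- (l y - l x) / 2) \<le> 1" by simp
  then have "exp (- (l y - l x) / 2) - 1 \<le> exp ((l y - l x) / 2)"
    by (smt (verit) exp_ge_zero)
  then show ?thesis unfolding incr_up[of l x y, OF True]
    by (intro mult_left_mono) auto
next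
  case False
  then have d: "l y \<le> l x" by simp
  show ?thesis unfolding incr_down[of l y x, OF d]
    by (intro mult_left_mono) auto
qed

lemma incr_le_lyap: "lyap_incr l x y \<le> lyap l x"
proof (cases "l x \<le> l y")
  case True
  then have "exp (- (l y - l x) / 2) \<le> 1" by simp
  then have "exp (- (l y - l x) / 2) - 1 \<le> 1" by linarith
  then have "lyap l x * (exp (- (l y - l x) / 2) - 1) \<le> lyap l x * 1"
    by (rule mult_left_mono) simp
  then show ?thesis unfolding incr_up[of l x y, OF True] by simp
next
  case False
  then have "lyap l x * exp ((l y - l x) / 2) \<le> lyap l x * 1"
    by (intro mult_left_mono) auto
  then show ?thesis using incr_le_exp_half[of l x y] by linarith
qed

lemma incr_reflect [simp]: "lyap_incr (\<lambda>x. l (- x)) x y = lyap_incr l (- x) (- y)"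
  and acc_ln_reflect [simp]: "acc_ln (\<lambda>x. l (- x)) x y = acc_ln l (- x) (- y)"
  and lyap_reflect [simp]: "lyap (\<lambda>x. l (- x)) x = lyap l (- x)"
  by (simp_all add: lyap_incr_def acc_ln_def lyap_def)

text \<open>
  With \<open>u = exp (- s / 2)\<close>, equal changes \<open>\<plusminus> s\<close> of \<open>l\<close> on the two sides of \<open>x\<close> contribute
  \<open>(u - 1) + (u - u\<^sup>2) = - (1 - u)\<^sup>2\<close>; the curvature of \<open>l\<close> is a perturbation of this.
  Here \<open>(1 - u)\<^sup>2 \<ge> t\<^sup>2 / 144\<close> for \<open>t \<le> 8\<close>, of which a perturbation of at most \<open>t\<^sup>2 / 288\<close> leaves half.
\<close>
lemma pair_bound:
  assumes t: "0 \<le> t" "t \<le> 8"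
    and down: "\<bar>l y1 - l x + t\<bar> \<le> t\<^sup>2 / 288" and up: "\<bar>l y2 - l x - t\<bar> \<le> t\<^sup>2 / 288"
  shows "lyap_incr l x y1 + lyap_incr l x y2 \<le> - (lyap l x * (t\<^sup>2 / 288))"
proof -
  have tt: "t\<^sup>2 \<le> 8 * t" using t by (simp add: power2_eq_square mult_right_mono)
  define a b where "a = l x - l y1" and "b = l y2 - l x"
  have a: "t / 2 \<le> a" "\<bar>a - t\<bar> \<le> t\<^sup>2 / 288" and b: "t / 2 \<le> b" "\<bar>b - t\<bar> \<le> t\<^sup>2 / 288"
    using tt down up t(1) unfolding a_def b_def by linarith+
  have b0: "0 \<le> a" "0 \<le> b" using a(1) b(1) t by auto
  let ?u = "exp (- a / 2)" and ?v = "exp (- b / 2)"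
  have sum: "lyap_incr l x y1 + lyap_incr l x y2 = lyap l x * (?v - ?u - (1 - ?u)\<^sup>2)"
    using b0 by (subst incr_up, simp add: b_def, subst incr_down, simp add: a_def)
      (simp add: a_def b_def algebra_simps power2_eq_square)
  \<comment> \<open>Here \<open>a\<close> and \<open>b\<close> differ by at most t^2 / 144, and exp
    (- y / 2) is Lipschitz with constant 1 / 2 on the nonnegative half-line.\<close>
  have vu: "?v - ?u \<le> t\<^sup>2 / 288"
  proof (cases "b \<le> a")
    case True
    have "?v - ?u = ?v * (1 - exp (- ((a - b) / 2)))"
      by (simp add: algebra_simps exp_add[symmetric] diff_divide_distrib)
    also have "\<dots> \<le> 1 * ((a - b) / 2)"
    proof (rule mult_mono)
      show "1 - exp (- ((a - b) / 2)) \<le> (a - b) / 2"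
        using exp_ge_add_one_self[of "- ((a - b) / 2)"] by linarith
    qed (use b0 True in auto)
    also have "\<dots> \<le> t\<^sup>2 / 288" 
      using abs_ge_self[of "a - t"] abs_ge_minus_self[of "b - t"] a(2) b(2) by argo
    finally show ?thesis .
  next
    case False
    then have "?v \<le> ?u" by simp
    then show ?thesis by (smt (verit) zero_le_power2 divide_nonneg_pos)
  qed
  \<comment> \<open>From a >= t / 2, \<open>?u\<close> is at most 1 / (1 + t / 4). This is at most 1
    - t / 12 because (1 + t / 4) (1 - t / 12) - 1 = t (8 - t) / 48; the range t <= 8 and the
    constant 12 belong together.\<close>
  have "t / 12 \<le> 1 - ?u"
  proof -
    have "exp (t / 4) * ?u \<le> 1" using a by (simp add: exp_add[symmetric])
    moreover have "(1 + t / 4) * ?u \<le> exp (t / 4) * ?u"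
      using exp_ge_add_one_self[of "t / 4"] by (intro mult_right_mono) auto
    ultimately have "(1 + t / 4) * ?u \<le> 1" by linarith
    moreover have "(1 + t / 4) * (1 - t / 12) \<ge> 1"
    proof -
      have "(1 + t / 4) * (1 - t / 12) - 1 = t * (8 - t) / 48" by (simp add: field_simps)
      moreover have "0 \<le> t * (8 - t) / 48" using t by simp
      ultimately show ?thesis by linarith
    qed
    ultimately have "(1 + t / 4) * ?u \<le> (1 + t / 4) * (1 - t / 12)" by linarith
    then have "?u \<le> 1 - t / 12" using t by (simp add: mult_le_cancel_left)
    then show ?thesis by simp
  qed
  then have "(t / 12)\<^sup>2 \<le> (1 - ?u)\<^sup>2" using t by (intro power_mono) auto
  then have "t\<^sup>2 / 144 \<le> (1 - ?u)\<^sup>2" by (simp add: power_divide)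
  then have "?v - ?u - (1 - ?u)\<^sup>2 \<le> - (t\<^sup>2 / 288)" using vu by linarith
  then show ?thesis unfolding sum
    by (metis mult_left_mono lyap_pos less_imp_le mult_minus_right)
qed

text \<open>The exponents -2 on both sides give 2 exp (-2) - 1 <= - 1 / 3. This is weakened to - 1 /
  288 so that near and far pairs share one constant.\<close>

lemma pair_bound_far:
  assumes "l y1 \<le> l x - 4" "l x + 4 \<le> l y2"
  shows "lyap_incr l x y1 + lyap_incr l x y2 \<le> - (lyap l x / 288)"
proof -
  have e2: "exp (- (2::real)) \<le> 1 / 3"
    using exp_ge_add_one_self[of "2::real"] by (simp add: exp_minus field_simps)
  have "exp (- (l y2 - l x) / 2) \<le> exp (- 2)" using assms by simp
  moreover have "exp ((l y1 - l x) / 2) \<le> exp (- 2)" using assms by simp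
  ultimately have *: "exp ((l y1 - l x) / 2) + (exp (- (l y2 - l x) / 2) - 1) \<le> - (1 / 288)"
    using e2 by linarith
  have "lyap_incr l x y1 + lyap_incr l x y2 \<le>
      lyap l x * (exp ((l y1 - l x) / 2) + (exp (- (l y2 - l x) / 2) - 1))"
    using incr_le_exp_half[of l x y1] incr_up[of l x y2] assms by (simp add: distrib_left)
  also have "\<dots> \<le> lyap l x * (- (1 / 288))"
    by (intro mult_left_mono *) auto
  finally show ?thesis by simp
qed

text \<open>The form in which the assumptions on \<pi> enter. \<open>tail\<close> yields growth of
  \<open>lyap\<close> and integrability of \<open>exp (l y / 2)\<close>; \<open>curv\<close> has the
  window 8 and the tolerance 1 / 288 of \<open>pair_bound\<close>.\<close>

locale rwm_target =
  fixes l l' :: "real \<Rightarrow> real"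
  assumes deriv: "\<And>x. (l has_real_derivative l' x) (at x)"
    and cont_deriv: "continuous_on UNIV l'"
    and tail: "\<And>K. \<exists>R. \<forall>x. R \<le> \<bar>x\<bar> \<longrightarrow> x * l' x \<le> - K"
    and curv: "\<exists>R. \<forall>x w. R \<le> \<bar>x\<bar> \<longrightarrow> \<bar>w * l' x\<bar> \<le> 8 \<longrightarrow>
      \<bar>l (x + w) - l x - w * l' x\<bar> \<le> (w * l' x)\<^sup>2 / 288"
begin

lemma cont: "continuous_on UNIV l"
  by (meson DERIV_isCont continuous_at_imp_continuous_on deriv)

lemma meas [measurable]: "l \<in> borel_measurable borel" "l' \<in> borel_measurable borel"
  by (auto intro: borel_measurable_continuous_onI cont cont_deriv)

text \<open>Tail estimates can now be proved near plus infinity alone and transferred to the other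
  side.\<close>

lemma reflect: "rwm_target (\<lambda>x. l (- x)) (\<lambda>x. - l' (- x))"
proof
  show "((\<lambda>x. l (- x)) has_real_derivative - l' (- x)) (at x)" for x
    by (rule DERIV_mirror[THEN iffD1]) (use deriv in simp)
  show "continuous_on UNIV (\<lambda>x. - l' (- x))"
    by (intro continuous_intros continuous_on_compose2[OF cont_deriv]) auto
  show "\<exists>R. \<forall>x. R \<le> \<bar>x\<bar> \<longrightarrow> x * - l' (- x) \<le> - K" for K
  proof -
    obtain R where R: "\<And>x. R \<le> \<bar>x\<bar> \<Longrightarrow> x * l' x \<le> - K" using tail[of K] by blast
    have "x * - l' (- x) \<le> - K" if "R \<le> \<bar>x\<bar>" for x using R[of "- x"] that by simp
    then show ?thesis by blast
  qed
  obtain R where R: "\<And>x w. R \<le> \<bar>x\<bar> \<Longrightarrow> \<bar>w * l' x\<bar> \<le> 8 \<Longrightarrow>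
      \<bar>l (x + w) - l x - w * l' x\<bar> \<le> (w * l' x)\<^sup>2 / 288" using curv by blast
  have "\<bar>l (- (x + w)) - l (- x) - w * - l' (- x)\<bar> \<le> (w * - l' (- x))\<^sup>2 / 288"
    if "R \<le> \<bar>x\<bar>" "\<bar>w * - l' (- x)\<bar> \<le> 8" for x w
    using R[of "- x" "- w"] that by simp
  then show "\<exists>R. \<forall>x w. R \<le> \<bar>x\<bar> \<longrightarrow> \<bar>w * - l' (- x)\<bar> \<le> 8 \<longrightarrow>
      \<bar>l (- (x + w)) - l (- x) - w * - l' (- x)\<bar> \<le> (w * - l' (- x))\<^sup>2 / 288" by blast
qed

section \<open>Growth of the Lyapunov function and integrals over the tail\<close>

lemma antimono_right: "\<exists>R>0. \<forall>x y. R \<le> x \<longrightarrow> x \<le> y \<longrightarrow> l y \<le> l x"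
proof -
  obtain R where R: "\<And>x. R \<le> \<bar>x\<bar> \<Longrightarrow> x * l' x \<le> - 0" using tail[of 0] by blast
  have "l y \<le> l x" if "max 1 R \<le> x" "x \<le> y" for x y
  proof (rule DERIV_nonpos_imp_nonincreasing[OF that(2)])
    fix z assume "x \<le> z" "z \<le> y"
    then have "z * l' z \<le> 0" "0 < z" using R[of z] that by auto
    then have "l' z \<le> 0" by (simp add: mult_le_0_iff)
    then show "\<exists>d. (l has_real_derivative d) (at z) \<and> d \<le> 0" using deriv by blast
  qed
  then show ?thesis by (intro exI[of _ "max 1 R"]) auto
qed

text \<open>The function l x + 6 ln x is eventually nonincreasing, and exp (- l x / 2) halves the 6.
  A cube is enough for later: it beats x, and it beats x even after multiplication by a squared
  score of size 1 / x^2.\<close>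

lemma lyap_growth_right: "\<exists>c>0. \<exists>R>0. \<forall>x\<ge>R. c * x ^ 3 \<le> lyap l x"
proof -
  obtain R where R: "\<And>x. R \<le> \<bar>x\<bar> \<Longrightarrow> x * l' x \<le> - 6" using tail[of 6] by blast
  define R0 where "R0 = max 1 R"
  have mono: "l x + 6 * ln x \<le> l R0 + 6 * ln R0" if "R0 \<le> x" for x
  proof (rule DERIV_nonpos_imp_nonincreasing[OF that, where f = "\<lambda>x. l x + 6 * ln x"])
    fix z assume "R0 \<le> z" "z \<le> x"
    then have z: "0 < z" "z * l' z \<le> - 6" using R[of z] unfolding R0_def by auto
    have "((\<lambda>x. l x + 6 * ln x) has_real_derivative l' z + 6 * (1 / z)) (at z)"
      using z by (auto intro!: derivative_eq_intros deriv)
    moreover have "l' z + 6 * (1 / z) \<le> 0" using z by (simp add: field_simps)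
    ultimately show "\<exists>d. ((\<lambda>x. l x + 6 * ln x) has_real_derivative d) (at z) \<and> d \<le> 0" by blast
  qed
  define k where "k = l R0 + 6 * ln R0"
  have "exp (- k / 2) * x ^ 3 \<le> lyap l x" if x: "R0 \<le> x" for x
  proof -
    have x0: "0 < x" using x unfolding R0_def by linarith
    have "x ^ 3 = exp (3 * ln x)"
      using x0 by (metis exp_ln exp_of_nat_mult of_nat_numeral)
    then have "exp (- k / 2) * x ^ 3 = exp (- k / 2 + 3 * ln x)"
      unfolding exp_add by simp
    also have "\<dots> \<le> exp (- l x / 2)" using mono[OF x] unfolding k_def exp_le_cancel_iff by argo
    finally show ?thesis by (simp add: lyap_def)
  qed
  then show ?thesis unfolding R0_def by (intro exI[of _ "exp (- k / 2)"] conjI exI[of _ "max 1 R"]) auto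
qed

lemma lyap_unbounded_right: "\<exists>R>0. \<forall>x\<ge>R. K * x \<le> lyap l x \<and> K \<le> lyap l x * (l' x)\<^sup>2"
proof -
  obtain c R where c: "0 < c" "0 < R" and g: "\<And>x. R \<le> x \<Longrightarrow> c * x ^ 3 \<le> lyap l x"
    using lyap_growth_right by blast
  obtain R' where R': "\<And>x. R' \<le> \<bar>x\<bar> \<Longrightarrow> x * l' x \<le> - 1" using tail[of 1] by blast
  define S where "S = max (max 1 R) (max R' (\<bar>K\<bar> / c))"
  have "K * x \<le> lyap l x \<and> K \<le> lyap l x * (l' x)\<^sup>2" if x: "S \<le> x" for x
  proof -
    have x1: "1 \<le> x" "R \<le> x" "R' \<le> x" "\<bar>K\<bar> / c \<le> x" using x unfolding S_def by auto
    have Kx: "K \<le> c * x" using x1 c(1) by (cases "0 \<le> K") (auto simp: field_simps intro: order_trans[of _ 0])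
    have "K * x \<le> (c * x) * x ^ 2"
    proof (cases "0 \<le> K")
      case True
      have "K * x \<le> (c * x) * x" using Kx x1 by (intro mult_right_mono) auto
      also have "\<dots> \<le> (c * x) * x ^ 2"
        using x1 c(1) by (intro mult_left_mono) (auto simp: power2_eq_square)
      finally show ?thesis .
    next
      case False
      then have "K * x \<le> 0" using x1 by (simp add: mult_le_0_iff)
      also have "0 \<le> (c * x) * x ^ 2" using x1 c by simp
      finally show ?thesis .
    qed
    also have "\<dots> = c * x ^ 3" by (simp add: power2_eq_square power3_eq_cube)
    finally have 1: "K * x \<le> lyap l x" using g[OF x1(2)] by linarith
    have "1 \<le> \<bar>x * l' x\<bar>" using R'[of x] x1 by auto
    then have "1 ^ 2 \<le> \<bar>x * l' x\<bar> ^ 2" by (intro power_mono) auto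
    then have sq: "1 \<le> x ^ 2 * (l' x)\<^sup>2" by (simp add: power_mult_distrib)
    have "K \<le> (c * x) * 1" using Kx by simp
    also have "\<dots> \<le> (c * x) * (x ^ 2 * (l' x)\<^sup>2)" using sq c x1 by (intro mult_left_mono) auto
    also have "\<dots> = (c * x ^ 3) * (l' x)\<^sup>2" by (simp add: power2_eq_square power3_eq_cube)
    also have "\<dots> \<le> lyap l x * (l' x)\<^sup>2" using g[OF x1(2)] by (intro mult_right_mono) auto
    finally show ?thesis using 1 by simp
  qed
  moreover have "0 < S" unfolding S_def by linarith
  ultimately show ?thesis by blast
qed

text \<open>\<open>- e * y * exp (l y / 2)\<close> is a supersolution: its derivative dominates \<open>exp (l y / 2)\<close> in the tail.\<close>
lemma tail_integral_right:
  assumes e: "0 < e"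
  shows "\<exists>R>0. \<forall>x\<ge>R. (\<integral>\<^sup>+y. ennreal (exp (l y / 2)) * indicator {x..} y \<partial>lborel)
    \<le> ennreal (e * x * exp (l x / 2))"
proof -
  \<comment> \<open>The constant is such that y l'(y) <= - 2 (1 + 1 / e) makes - e (1 + y l'(y) / 2)
    at least 1, which is the factor of \<open>exp (l y / 2)\<close> in the derivative of
    \<open>F\<close>.\<close>
  obtain R where R: "\<And>x. R \<le> \<bar>x\<bar> \<Longrightarrow> x * l' x \<le> - (2 * (1 + 1 / e))"
    using tail by blast
  obtain c R' where c: "0 < c" "0 < R'" and g: "\<And>x. R' \<le> x \<Longrightarrow> c * x ^ 3 \<le> lyap l x"
    using lyap_growth_right by blast
  define F where "F y = - e * y * exp (l y / 2)" for y
  define f where "f y = - e * exp (l y / 2) * (1 + y * l' y / 2)" for y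
  have fm [measurable]: "f \<in> borel_measurable borel" unfolding f_def by measurable
  have F: "(F has_real_derivative f y) (at y)" for y
    unfolding F_def f_def
    by (auto intro!: derivative_eq_intros deriv simp: algebra_simps)
  have f: "exp (l y / 2) \<le> f y" if "max R R' \<le> y" for y
  proof -
    have "y * l' y \<le> - (2 * (1 + 1 / e))" using R[of y] that by auto
    then have "1 \<le> - e * (1 + y * l' y / 2)" using e by (simp add: field_simps)
    then have "exp (l y / 2) * 1 \<le> exp (l y / 2) * (- e * (1 + y * l' y / 2))"
      by (intro mult_left_mono) auto
    then show ?thesis unfolding f_def by (simp add: algebra_simps)
  qed
  have lim: "(F \<longlongrightarrow> 0) at_top"
  proof (rule Lim_null_comparison)
    show "\<forall>\<^sub>F y in at_top. norm (F y) \<le> (e / c) / y\<^sup>2"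
      using eventually_ge_at_top[of R']
    proof eventually_elim
      case (elim y)
      then have y: "0 < y" using c by linarith
      have "exp (l y / 2) = 1 / lyap l y" by (simp add: lyap_def exp_minus field_simps)
      also have "\<dots> \<le> 1 / (c * y ^ 3)" using g[OF elim] y c by (intro divide_left_mono) auto
      finally have "e * y * exp (l y / 2) \<le> e * y * (1 / (c * y ^ 3))"
        using e y by (intro mult_left_mono) auto
      also have "\<dots> = (e / c) / y\<^sup>2" using y c by (simp add: power2_eq_square power3_eq_cube)
      finally show ?case using y e by (simp add: F_def abs_mult)
    qed
    show "((\<lambda>y. (e / c) / y\<^sup>2) \<longlongrightarrow> 0) at_top"
      by (intro tendsto_divide_0[OF tendsto_const] filterlim_at_top_imp_at_infinity
          filterlim_pow_at_top filterlim_ident zero_less_numeral)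
  qed
  have "(\<integral>\<^sup>+y. ennreal (exp (l y / 2)) * indicator {x..} y \<partial>lborel) \<le> ennreal (e * x * exp (l x / 2))"
    if x: "max R R' \<le> x" for x
  proof -
    have "(\<integral>\<^sup>+y. ennreal (exp (l y / 2)) * indicator {x..} y \<partial>lborel) \<le>
        (\<integral>\<^sup>+y. ennreal (f y) * indicator {x..} y \<partial>lborel)"
      using f x by (intro nn_integral_mono) (auto split: split_indicator intro!: ennreal_leI)
    also have "\<dots> = ennreal (0 - F x)"
    proof (rule nn_integral_FTC_atLeast[OF fm F _ lim])
      show "0 \<le> f y" if "x \<le> y" for y
        using f[of y] that x by (smt (verit) exp_ge_zero)
    qed
    finally show ?thesis by (simp add: F_def)
  qed
  then show ?thesis using c by (intro exI[of _ "max R R'"]) auto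
qed

end

section \<open>Level sets in the tails\<close>

text \<open>
  \<open>L\<close> is the length of a level set \<open>{a..x}\<close> of \<open>l\<close>, up to a bounded change of level;
  \<open>\<psi>\<close> controls the contribution of proposals outside of it.
\<close>
definition tail_profile ::
  "(real \<Rightarrow> real) \<Rightarrow> (real \<Rightarrow> real) \<Rightarrow> real \<Rightarrow> real \<Rightarrow> real \<Rightarrow> real \<Rightarrow> (real \<Rightarrow> real) \<Rightarrow> bool" where
  "tail_profile l l' K e x L \<psi> \<longleftrightarrow>
     \<bar>x\<bar> \<le> L \<and> 16 \<le> \<bar>l' x\<bar> * L \<and> K * L \<le> lyap l x \<and> K \<le> lyap l x * (l' x)\<^sup>2 \<and>
     \<psi> \<in> borel_measurable borel \<and> (\<forall>y. 0 \<le> \<psi> y) \<and> (\<integral>\<^sup>+y. ennreal (\<psi> y) \<partial>lborel) \<le> ennreal (e * L) \<and>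
     (\<integral>\<^sup>+y. ennreal (acc_ln l x y) \<partial>lborel) \<le> ennreal ((1 + e) * L) \<and>
     (\<forall>z. lyap_incr l x (x + z) + lyap_incr l x (x - z) \<le>
       (if \<bar>z\<bar> \<le> L then - (lyap l x / 288 * min 1 ((l' x * z)\<^sup>2)) else lyap l x * (\<psi> (x + z) + \<psi> (x - z))))"

lemma nn_integral_lborel_uminus:
  assumes [measurable]: "f \<in> borel_measurable borel"
  shows "(\<integral>\<^sup>+y. f (- y :: real) \<partial>lborel) = (\<integral>\<^sup>+y. f y \<partial>lborel)"
  using nn_integral_real_affine[of f "- 1" 0] by simp

lemma tail_profile_reflect:
  assumes p: "tail_profile (\<lambda>x. l (- x)) (\<lambda>x. - l' (- x)) K e x L \<psi>"
    and [measurable]: "l \<in> borel_measurable borel"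
  shows "tail_profile l l' K e (- x) L (\<lambda>y. \<psi> (- y))"
proof -
  have [measurable]: "\<psi> \<in> borel_measurable borel" using p by (simp add: tail_profile_def)
  have m: "(\<lambda>y. acc_ln l (- x) y) \<in> borel_measurable borel" unfolding acc_ln_def by measurable
  have "(\<integral>\<^sup>+y. ennreal (\<psi> (- y)) \<partial>lborel) = (\<integral>\<^sup>+y. ennreal (\<psi> y) \<partial>lborel)"
    by (rule nn_integral_lborel_uminus[where f = "\<lambda>y. ennreal (\<psi> y)"]) measurable
  moreover have "(\<integral>\<^sup>+y. ennreal (acc_ln l (- x) (- y)) \<partial>lborel) = (\<integral>\<^sup>+y. ennreal (acc_ln l (- x) y) \<partial>lborel)"
    using m by (intro nn_integral_lborel_uminus[where f = "\<lambda>y. ennreal (acc_ln l (- x) y)"]) measurable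
  moreover have "lyap_incr l (- x) (- x + z) + lyap_incr l (- x) (- x - z) \<le>
       (if \<bar>z\<bar> \<le> L then - (lyap l (- x) / 288 * min 1 ((l' (- x) * z)\<^sup>2))
        else lyap l (- x) * (\<psi> (- (- x + z)) + \<psi> (- (- x - z))))" for z
  proof -
    have "lyap_incr l (- x) (- (x + - z)) + lyap_incr l (- x) (- (x - - z)) \<le>
       (if \<bar>- z\<bar> \<le> L then - (lyap l (- x) / 288 * min 1 ((- l' (- x) * - z)\<^sup>2))
        else lyap l (- x) * (\<psi> (x + - z) + \<psi> (x - - z)))"
      using p unfolding tail_profile_def incr_reflect lyap_reflect by blast
    moreover have "- (x + - z) = - x + z" "- (x - - z) = - x - z" "- (- x + z) = x + - z"
      "- (- x - z) = x - - z" "- l' (- x) * - z = l' (- x) * z" "\<bar>- z\<bar> = \<bar>z\<bar>" by simp_all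
    ultimately show ?thesis by metis
  qed
  ultimately show ?thesis
    using p unfolding tail_profile_def incr_reflect lyap_reflect acc_ln_reflect by simp
qed

lemma continuous_bounded_Icc:
  fixes f :: "real \<Rightarrow> real"
  assumes "continuous_on UNIV f"
  shows "\<exists>B>0. \<forall>y. a \<le> y \<longrightarrow> y \<le> b \<longrightarrow> \<bar>f y\<bar> \<le> B"
proof -
  have "compact (f ` {a..b})"
    by (intro compact_continuous_image continuous_on_subset[OF assms]) auto
  then obtain B where "0 < B" "\<And>y. y \<in> f ` {a..b} \<Longrightarrow> norm y \<le> B"
    using compact_imp_bounded bounded_pos by metis
  then show ?thesis by auto
qed

context rwm_target begin

text \<open>The two tails cost \<open>e * x\<close> and \<open>e * (- a)\<close>, which add up to
  \<open>e\<close> times the length of the level set. Both hypotheses are relative to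
  \<open>exp (l x / 2)\<close>, also the one for the tail beyond \<open>a\<close>, so the prefactor
  \<open>exp (- l x / 2)\<close> cancels.\<close>

lemma outside_integral:
  assumes right: "(\<integral>\<^sup>+y. ennreal (exp (l y / 2)) * indicator {x..} y \<partial>lborel) \<le> ennreal (e * x * exp (l x / 2))"
    and left: "(\<integral>\<^sup>+y. ennreal (exp (l (- y) / 2)) * indicator {- a..} y \<partial>lborel) \<le> ennreal (e * (- a) * exp (l x / 2))"
    and "0 \<le> e" "0 \<le> x" "a \<le> 0"
  shows "(\<integral>\<^sup>+y. ennreal (exp ((l y - l x) / 2)) * indicator (- {a..x}) y \<partial>lborel) \<le> ennreal (e * (x - a))"
proof -
  let ?c = "ennreal (exp (- l x / 2))"
  have *: "?c * ennreal (k * exp (l x / 2)) = ennreal k" if "0 \<le> k" for k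
    using that by (simp add: ennreal_mult[symmetric] exp_minus)
  have split: "ennreal (exp ((l y - l x) / 2)) * indicator (- {a..x}) y \<le>
      ?c * (ennreal (exp (l y / 2)) * indicator {x..} y) +
      ?c * (ennreal (exp (l (- (- y)) / 2)) * indicator {- a..} (- y))" for y
  proof -
    have "ennreal (exp ((l y - l x) / 2)) = ?c * ennreal (exp (l y / 2))"
      by (simp add: ennreal_mult[symmetric] exp_add[symmetric] diff_divide_distrib)
    then show ?thesis by (auto split: split_indicator)
  qed
  have "(\<integral>\<^sup>+y. ennreal (exp ((l y - l x) / 2)) * indicator (- {a..x}) y \<partial>lborel) \<le>
      (\<integral>\<^sup>+y. ?c * (ennreal (exp (l y / 2)) * indicator {x..} y) +
        ?c * (ennreal (exp (l (- (- y)) / 2)) * indicator {- a..} (- y)) \<partial>lborel)"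
    by (intro nn_integral_mono split)
  also have "\<dots> = ?c * (\<integral>\<^sup>+y. ennreal (exp (l y / 2)) * indicator {x..} y \<partial>lborel) +
      ?c * (\<integral>\<^sup>+y. ennreal (exp (l (- (- y)) / 2)) * indicator {- a..} (- y) \<partial>lborel)"
    by (subst nn_integral_add, measurable, subst nn_integral_cmult, measurable, subst nn_integral_cmult, measurable)
  also have "(\<integral>\<^sup>+y. ennreal (exp (l (- (- y)) / 2)) * indicator {- a..} (- y) \<partial>lborel) =
      (\<integral>\<^sup>+y. ennreal (exp (l (- y) / 2)) * indicator {- a..} y \<partial>lborel)"
    by (rule nn_integral_lborel_uminus[where f = "\<lambda>y. ennreal (exp (l (- y) / 2)) * indicator {- a..} y"])
      measurable
  also have "?c * (\<integral>\<^sup>+y. ennreal (exp (l y / 2)) * indicator {x..} y \<partial>lborel) + ?c * \<dots> \<le>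
      ?c * ennreal (e * x * exp (l x / 2)) + ?c * ennreal (e * (- a) * exp (l x / 2))"
    by (intro add_mono mult_left_mono right left) auto
  also have "\<dots> = ennreal (e * x) + ennreal (e * (- a))"
    using assms by (simp only: * mult_nonneg_nonneg neg_0_le_iff_le)
  also have "\<dots> = ennreal (e * x + e * (- a))"
    using assms by (intro ennreal_plus[symmetric]) (auto intro: mult_nonneg_nonpos)
  also have "e * x + e * (- a) = e * (x - a)" by (simp add: algebra_simps)
  finally show ?thesis .
qed

text \<open>The endpoint \<open>a\<close> is chosen at level \<open>l x + 4\<close> on the far side
  of the origin. Then every point from \<open>a\<close> up to distance
  \<open>8 / \<bar>l' x\<bar>\<close> before \<open>x\<close> lies at least 4 above
  \<open>l x\<close>: in both tails by monotonicity, in the middle because \<open>x\<close> is so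
  far out that \<open>l x\<close> is below the minimum there by more than 4.\<close>

lemma level_right:
  assumes e: "0 < e"
  shows "\<exists>R>0. \<forall>x\<ge>R. \<exists>a\<le>0. l' x < 0 \<and> 16 \<le> \<bar>l' x\<bar> * x \<and>
    (\<forall>y. a \<le> y \<longrightarrow> y \<le> x - 8 / \<bar>l' x\<bar> \<longrightarrow> l x + 4 \<le> l y) \<and>
    (\<forall>y. x + 8 / \<bar>l' x\<bar> \<le> y \<longrightarrow> l y \<le> l x - 4) \<and>
    (\<forall>z. \<bar>z\<bar> \<le> 8 / \<bar>l' x\<bar> \<longrightarrow> \<bar>l (x + z) - l x - z * l' x\<bar> \<le> (z * l' x)\<^sup>2 / 288) \<and>
    (\<integral>\<^sup>+y. ennreal (exp ((l y - l x) / 2)) * indicator (- {a..x}) y \<partial>lborel) \<le> ennreal (e * (x - a)) \<and>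
    K * (x - a) \<le> lyap l x \<and> K \<le> lyap l x * (l' x)\<^sup>2"
proof -
  interpret r: rwm_target "\<lambda>x. l (- x)" "\<lambda>x. - l' (- x)" by (rule reflect)
  obtain R1 where R1: "0 < R1" "\<And>x y. R1 \<le> x \<Longrightarrow> x \<le> y \<Longrightarrow> l y \<le> l x"
    using antimono_right by blast
  obtain R2 where R2: "0 < R2" "\<And>x y. R2 \<le> x \<Longrightarrow> x \<le> y \<Longrightarrow> l (- y) \<le> l (- x)"
    using r.antimono_right by blast
  \<comment> \<open>The length x - a is split into x and - a, each controlled by \<open>lyap\<close>
    at its own end; hence the factor 2. The 1 gives \<open>lyap\<close> at least the identity, which
    is used to locate \<open>a\<close>.\<close>
  define K1 where "K1 = max 1 (2 * \<bar>K\<bar>)"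
  obtain R3 where R3: "0 < R3" "\<And>x. R3 \<le> x \<Longrightarrow> K1 * x \<le> lyap l x" "\<And>x. R3 \<le> x \<Longrightarrow> K1 \<le> lyap l x * (l' x)\<^sup>2"
    using lyap_unbounded_right[of K1] by blast
  obtain R4 where R4: "0 < R4" "\<And>x. R4 \<le> x \<Longrightarrow> K1 * x \<le> lyap l (- x)"
    using r.lyap_unbounded_right[of K1] by auto
  obtain R5 where R5: "0 < R5" "\<And>x. R5 \<le> x \<Longrightarrow>
      (\<integral>\<^sup>+y. ennreal (exp (l y / 2)) * indicator {x..} y \<partial>lborel) \<le> ennreal (e * x * exp (l x / 2))"
    using tail_integral_right[OF e] by blast
  \<comment> \<open>The integral over the left tail comes out relative to
    \<open>exp (l a / 2)\<close>, which is exp 2 times \<open>exp (l x / 2)\<close>.\<close>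
  define e' where "e' = e * exp (- 2)"
  have "0 < e'" using e by (simp add: e'_def)
  then obtain R6 where R6: "0 < R6" "\<And>x. R6 \<le> x \<Longrightarrow>
      (\<integral>\<^sup>+y. ennreal (exp (l (- y) / 2)) * indicator {x..} y \<partial>lborel) \<le> ennreal (e' * x * exp (l (- x) / 2))"
    using r.tail_integral_right by blast
  obtain R7 where R7: "\<And>x w. R7 \<le> \<bar>x\<bar> \<Longrightarrow> \<bar>w * l' x\<bar> \<le> 8 \<Longrightarrow>
      \<bar>l (x + w) - l x - w * l' x\<bar> \<le> (w * l' x)\<^sup>2 / 288" using curv by blast
  obtain R8 where R8: "\<And>x. R8 \<le> \<bar>x\<bar> \<Longrightarrow> x * l' x \<le> - 16" using tail[of 16] by blast
  define T where "T = R1 + R2 + R3 + R4 + R5 + R6 + \<bar>R7\<bar> + \<bar>R8\<bar>"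
  have T: "R1 \<le> T" "R2 \<le> T" "R3 \<le> T" "R4 \<le> T" "R5 \<le> T" "R6 \<le> T" "R7 \<le> T" "R8 \<le> T"
    using R1(1) R2(1) R3(1) R4(1) R5(1) R6(1) unfolding T_def by linarith+
  have T0: "0 < T" using T R1 by linarith
  have "\<exists>z0\<in>{-T..T}. \<forall>y\<in>{-T..T}. l z0 \<le> l y"
    by (rule continuous_attains_inf[OF compact_Icc _ continuous_on_subset[OF cont subset_UNIV]])
      (use T0 in simp)
  then obtain z0 where z0: "\<And>y. - T \<le> y \<Longrightarrow> y \<le> T \<Longrightarrow> l z0 \<le> l y" by force
  \<comment> \<open>As \<open>x \<le> lyap l x\<close>, the exponential forces l x + 6 <= l z0, so
    that x lies well below the middle part.\<close>
  define R where "R = max (2 * T) (exp (3 - l z0 / 2))"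
  have "\<exists>a\<le>0. l' x < 0 \<and> 16 \<le> \<bar>l' x\<bar> * x \<and>
    (\<forall>y. a \<le> y \<longrightarrow> y \<le> x - 8 / \<bar>l' x\<bar> \<longrightarrow> l x + 4 \<le> l y) \<and>
    (\<forall>y. x + 8 / \<bar>l' x\<bar> \<le> y \<longrightarrow> l y \<le> l x - 4) \<and>
    (\<forall>z. \<bar>z\<bar> \<le> 8 / \<bar>l' x\<bar> \<longrightarrow> \<bar>l (x + z) - l x - z * l' x\<bar> \<le> (z * l' x)\<^sup>2 / 288) \<and>
    (\<integral>\<^sup>+y. ennreal (exp ((l y - l x) / 2)) * indicator (- {a..x}) y \<partial>lborel) \<le> ennreal (e * (x - a)) \<and>
    K * (x - a) \<le> lyap l x \<and> K \<le> lyap l x * (l' x)\<^sup>2" if x: "R \<le> x" for x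
  proof -
    have xT: "2 * T \<le> x" and xe: "exp (3 - l z0 / 2) \<le> x" using x by (auto simp: R_def)
    have x0: "0 < x" using xT T0 by linarith
    have g16: "x * l' x \<le> - 16" using R8[of x] xT T T0 by linarith
    then have neg: "l' x < 0" using x0 mult_nonneg_nonneg[of x "l' x"] by linarith
    have px: "R1 \<le> x" "R3 \<le> x" "R5 \<le> x" "R7 \<le> \<bar>x\<bar>" "R8 \<le> \<bar>x\<bar>" using xT T T0 by auto
    define g where "g = \<bar>l' x\<bar>"
    have g: "0 < g" "l' x = - g" "16 \<le> g * x" using neg g16 by (auto simp: g_def mult.commute)
    have half: "8 / g \<le> x / 2" using g by (simp add: field_simps)
    have taylor: "\<bar>l (x + z) - l x - z * l' x\<bar> \<le> (z * l' x)\<^sup>2 / 288" if "\<bar>z\<bar> \<le> 8 / g" for z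
      using R7[of x z] that xT T T0 g by (simp add: abs_mult field_simps)
    have lyx: "x \<le> lyap l x"
    proof -
      have "1 * x \<le> K1 * x" using x0 by (intro mult_right_mono) (auto simp: K1_def)
      then show ?thesis using R3(2)[of x] xT T T0 by linarith
    qed
    have lx: "l x + 4 < l z0"
    proof -
      have "exp (3 - l z0 / 2) \<le> exp (- l x / 2)" using order_trans[OF xe lyx] unfolding lyap_def .
      then show ?thesis unfolding exp_le_cancel_iff by argo
    qed
    \<comment> \<open>From N <= \<open>lyap l (- N)\<close> and the second entry of the maximum, l
      (- N) is at most l x + 4: a starting point for the intermediate value theorem.\<close>
    define N where "N = max T (exp (- (l x + 4) / 2))"
    have lN: "l (- N) \<le> l x + 4"
    proof -
      have "1 * N \<le> K1 * N" using T0 by (intro mult_right_mono) (auto simp: K1_def N_def)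
      also have "\<dots> \<le> lyap l (- N)" using R4(2)[of N] T by (simp add: N_def)
      finally have "N \<le> exp (- l (- N) / 2)" by (simp add: lyap_def)
      moreover have "exp (- (l x + 4) / 2) \<le> N" by (simp add: N_def)
      ultimately have "exp (- (l x + 4) / 2) \<le> exp (- l (- N) / 2)" by linarith
      then show ?thesis unfolding exp_le_cancel_iff by argo
    qed
    have "l x + 4 \<le> l (- T)" using z0[of "- T"] lx T0 by simp
    with lN obtain a where a: "- N \<le> a" "a \<le> - T" "l a = l x + 4"
      using IVT'[OF lN _ _ continuous_on_subset[OF cont subset_UNIV], of "- T"]
      by (auto simp: N_def)
    have up: "l x + 4 \<le> l y" if "a \<le> y" "y \<le> x - 8 / g" for y
    proof -
      consider "y \<le> - T" | "- T \<le> y" "y \<le> T" | "T \<le> y" by linarith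
      then show ?thesis
      proof cases
        case 1
        then show ?thesis using R2(2)[of "- y" "- a"] that a T by simp
      next
        case 2
        then show ?thesis using z0[of y] lx by simp
      next
        case 3
        \<comment> \<open>The tangent rises by 8 and is off by at most 64 / 288 < 1, so l rises by
          at least 7.\<close>
        have "\<bar>l (x + (- 8 / g)) - l x - (- 8 / g) * l' x\<bar> \<le> ((- 8 / g) * l' x)\<^sup>2 / 288"
          using g by (intro taylor) simp
        then have "\<bar>l (x - 8 / g) - l x - 8\<bar> \<le> 1" using g by simp
        then have "l x + 4 \<le> l (x - 8 / g)" by (simp only: abs_le_iff) argo
        moreover have "l (x - 8 / g) \<le> l y" using R1(2)[of y "x - 8 / g"] that 3 T by simp
        ultimately show ?thesis by simp
      qed
    qed
    have down: "l y \<le> l x - 4" if "x + 8 / g \<le> y" for y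
    proof -
      have "\<bar>l (x + 8 / g) - l x - (8 / g) * l' x\<bar> \<le> ((8 / g) * l' x)\<^sup>2 / 288"
        using g by (intro taylor) simp
      then have "\<bar>l (x + 8 / g) - l x + 8\<bar> \<le> 1" using g by simp
      then have "l (x + 8 / g) \<le> l x - 4" by (simp only: abs_le_iff) argo
      moreover have "l y \<le> l (x + 8 / g)"
      proof (rule R1(2)[OF _ that])
        show "R1 \<le> x + 8 / g" using px(1) g(1) by (simp add: add_increasing2)
      qed
      ultimately show ?thesis by simp
    qed
    have int: "(\<integral>\<^sup>+y. ennreal (exp ((l y - l x) / 2)) * indicator (- {a..x}) y \<partial>lborel) \<le> ennreal (e * (x - a))"
    proof (rule outside_integral)
      show "(\<integral>\<^sup>+y. ennreal (exp (l y / 2)) * indicator {x..} y \<partial>lborel) \<le> ennreal (e * x * exp (l x / 2))"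
        by (rule R5) (use px in simp)
      have eq: "e' * (- a) * exp (l (- (- a)) / 2) = e * (- a) * exp (l x / 2)"
        unfolding e'_def minus_minus a(3) by (simp add: add_divide_distrib exp_add exp_minus)
      show "(\<integral>\<^sup>+y. ennreal (exp (l (- y) / 2)) * indicator {- a..} y \<partial>lborel) \<le> ennreal (e * (- a) * exp (l x / 2))"
        unfolding eq[symmetric] by (rule R6(2)) (use a(2) T in linarith)
    qed (use x0 a(2) T0 e in linarith)+
    have lya: "lyap l a \<le> exp (- 2) * lyap l x"
      unfolding lyap_def exp_add[symmetric] a(3) exp_le_cancel_iff by argo
    have e2: "exp (- (2::real)) \<le> 1 / 3"
      using exp_ge_add_one_self[of "2::real"] by (simp add: exp_minus field_simps)
    have K1a: "K1 * (- a) \<le> lyap l a" using R4(2)[of "- a"] a(2) T(4) by simp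
    have "K * (x - a) \<le> lyap l x \<and> K \<le> lyap l x * (l' x)\<^sup>2"
    proof
      have "K * (x - a) \<le> K1 / 2 * (x - a)"
        using a T0 x0 by (intro mult_right_mono) (auto simp: K1_def)
      also have "\<dots> = (K1 * x + K1 * (- a)) / 2" by (simp add: algebra_simps)
      also have "\<dots> \<le> (lyap l x + lyap l x) / 2"
      proof -
        have "lyap l a \<le> 1 / 3 * lyap l x"
          using lya mult_right_mono[OF e2 lyap_nonneg[of l x]] by linarith
        also have "\<dots> \<le> lyap l x" by simp
        finally have "K1 * (- a) \<le> lyap l x" using K1a by (rule order_trans[rotated])
        then show ?thesis using R3(2)[OF px(2)] by (intro divide_right_mono add_mono) auto
      qed
      finally show "K * (x - a) \<le> lyap l x" by simp
      have "K \<le> K1" by (simp add: K1_def)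
      then show "K \<le> lyap l x * (l' x)\<^sup>2" using R3(3)[OF px(2)] by linarith
    qed
    moreover have "a \<le> 0" using a(2) T0 by simp
    ultimately show ?thesis
      using neg g(3) up down taylor int unfolding g_def by blast
  qed
  moreover have "0 < R" unfolding R_def using T0 by simp
  ultimately show ?thesis by blast
qed

text \<open>Take \<open>L = x - a\<close>. If |z| > L, both x + z and x - z leave
  \<open>{a..x}\<close>, where \<open>\<psi>\<close> dominates. If |z| <= L, the pair falls under
  \<open>pair_bound\<close> with t = g |z| up to |z| = 8 / g, and under
  \<open>pair_bound_far\<close> beyond. For the acceptance integral, the level set itself
  contributes at most its length.\<close>

lemma profile_right:
  assumes e: "0 < e"
  shows "\<exists>R>0. \<forall>x\<ge>R. \<exists>L \<psi>. tail_profile l l' K e x L \<psi>"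
proof -
  obtain R where R: "0 < R" "\<And>x. R \<le> x \<Longrightarrow> \<exists>a\<le>0. l' x < 0 \<and> 16 \<le> \<bar>l' x\<bar> * x \<and>
    (\<forall>y. a \<le> y \<longrightarrow> y \<le> x - 8 / \<bar>l' x\<bar> \<longrightarrow> l x + 4 \<le> l y) \<and>
    (\<forall>y. x + 8 / \<bar>l' x\<bar> \<le> y \<longrightarrow> l y \<le> l x - 4) \<and>
    (\<forall>z. \<bar>z\<bar> \<le> 8 / \<bar>l' x\<bar> \<longrightarrow> \<bar>l (x + z) - l x - z * l' x\<bar> \<le> (z * l' x)\<^sup>2 / 288) \<and>
    (\<integral>\<^sup>+y. ennreal (exp ((l y - l x) / 2)) * indicator (- {a..x}) y \<partial>lborel) \<le> ennreal (e * (x - a)) \<and>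
    K * (x - a) \<le> lyap l x \<and> K \<le> lyap l x * (l' x)\<^sup>2"
    using level_right[OF e, of K] by blast
  have "\<exists>L \<psi>. tail_profile l l' K e x L \<psi>" if x: "R \<le> x" for x
  proof -
    define g where "g = \<bar>l' x\<bar>"
    obtain a where a: "a \<le> 0" and neg: "l' x < 0" and g16: "16 \<le> g * x"
      and up: "\<And>y. a \<le> y \<Longrightarrow> y \<le> x - 8 / g \<Longrightarrow> l x + 4 \<le> l y"
      and down: "\<And>y. x + 8 / g \<le> y \<Longrightarrow> l y \<le> l x - 4"
      and taylor: "\<And>z. \<bar>z\<bar> \<le> 8 / g \<Longrightarrow> \<bar>l (x + z) - l x - z * l' x\<bar> \<le> (z * l' x)\<^sup>2 / 288"
      and int: "(\<integral>\<^sup>+y. ennreal (exp ((l y - l x) / 2)) * indicator (- {a..x}) y \<partial>lborel) \<le> ennreal (e * (x - a))"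
      and K: "K * (x - a) \<le> lyap l x" "K \<le> lyap l x * (l' x)\<^sup>2"
      using R(2)[OF x] unfolding g_def by blast
    have g: "0 < g" "l' x = - g" using neg by (auto simp: g_def)
    have x0: "0 < x" using x R(1) by linarith
    define L where "L = x - a"
    define \<psi> where "\<psi> y = exp ((l y - l x) / 2) * indicator (- {a..x}) y" for y
    have [measurable]: "\<psi> \<in> borel_measurable borel" unfolding \<psi>_def by measurable
    have \<psi>0: "0 \<le> \<psi> y" for y by (simp add: \<psi>_def)
    have \<psi>int: "(\<integral>\<^sup>+y. ennreal (\<psi> y) \<partial>lborel) \<le> ennreal (e * L)"
    proof -
      have "ennreal (\<psi> y) = ennreal (exp ((l y - l x) / 2)) * indicator (- {a..x}) y" for y
        by (simp add: \<psi>_def split: split_indicator)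
      then show ?thesis using int unfolding L_def by presburger
    qed
    have Lx: "x \<le> L" "\<bar>x\<bar> \<le> L" using a x0 by (auto simp: L_def)
    have gL: "16 \<le> \<bar>l' x\<bar> * L"
      using g16 mult_left_mono[OF Lx(1), of g] g(1) unfolding g_def by linarith
    have acc_int: "(\<integral>\<^sup>+y. ennreal (acc_ln l x y) \<partial>lborel) \<le> ennreal ((1 + e) * L)"
    proof -
      have "(\<integral>\<^sup>+y. ennreal (acc_ln l x y) \<partial>lborel) \<le> (\<integral>\<^sup>+y. indicator {a..x} y + ennreal (\<psi> y) \<partial>lborel)"
      proof (intro nn_integral_mono)
        fix y
        show "ennreal (acc_ln l x y) \<le> indicator {a..x} y + ennreal (\<psi> y)"
          using acc_ln_le_exp_half[of l x y] acc_ln_le_1[of l x y]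
          by (cases "y \<in> {a..x}") (auto simp: \<psi>_def intro: ennreal_leI)
      qed
      also have "\<dots> = ennreal L + (\<integral>\<^sup>+y. ennreal (\<psi> y) \<partial>lborel)"
        using a x0 by (subst nn_integral_add) (auto simp: L_def)
      also have "\<dots> \<le> ennreal L + ennreal (e * L)" by (intro add_left_mono \<psi>int)
      also have "\<dots> = ennreal (L + e * L)"
        using Lx x0 e by (intro ennreal_plus[symmetric]) simp_all
      also have "L + e * L = (1 + e) * L" by (simp add: distrib_right)
      finally show ?thesis .
    qed
    have near: "lyap_incr l x (x + z) + lyap_incr l x (x - z) \<le> - (lyap l x / 288 * min 1 ((l' x * z)\<^sup>2))"
      if z: "0 \<le> z" "z \<le> L" for z
    proof (cases "z \<le> 8 / g")
      case True
      have "lyap_incr l x (x + z) + lyap_incr l x (x - z) \<le> - (lyap l x * ((g * z)\<^sup>2 / 288))"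
      proof (rule pair_bound)
        show "0 \<le> g * z" using g z by simp
        show "g * z \<le> 8" using True g by (simp add: field_simps)
        show "\<bar>l (x + z) - l x + g * z\<bar> \<le> (g * z)\<^sup>2 / 288"
          using taylor[of z] z True g by (simp add: mult.commute)
        show "\<bar>l (x - z) - l x - g * z\<bar> \<le> (g * z)\<^sup>2 / 288"
          using taylor[of "- z"] z True g by (simp add: mult.commute)
      qed
      moreover have "lyap l x / 288 * min 1 ((l' x * z)\<^sup>2) \<le> lyap l x * ((g * z)\<^sup>2 / 288)"
        using mult_left_mono[of "min 1 ((l' x * z)\<^sup>2)" "(g * z)\<^sup>2" "lyap l x / 288"] g by simp
      ultimately show ?thesis by linarith
    next
      case False
      have "lyap_incr l x (x + z) + lyap_incr l x (x - z) \<le> - (lyap l x / 288)"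
        using False z by (intro pair_bound_far up down) (auto simp: L_def)
      moreover have "lyap l x / 288 * min 1 ((l' x * z)\<^sup>2) \<le> lyap l x / 288 * 1"
        by (intro mult_left_mono) auto
      ultimately show ?thesis by linarith
    qed
    have far: "lyap_incr l x (x + z) \<le> lyap l x * \<psi> (x + z)" if "L < \<bar>z\<bar>" for z
      using incr_le_exp_half[of l x "x + z"] that a x0 by (auto simp: \<psi>_def L_def indicator_def)
    have "lyap_incr l x (x + z) + lyap_incr l x (x - z) \<le>
       (if \<bar>z\<bar> \<le> L then - (lyap l x / 288 * min 1 ((l' x * z)\<^sup>2)) else lyap l x * (\<psi> (x + z) + \<psi> (x - z)))" for z
    proof (cases "\<bar>z\<bar> \<le> L")
      case True
      then show ?thesis
        using near[of z] near[of "- z"] by (cases "0 \<le> z") (auto simp: add.commute)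
    next
      case False
      then show ?thesis using far[of z] far[of "- z"] by (simp add: distrib_left)
    qed
    then have "tail_profile l l' K e x L \<psi>"
      unfolding tail_profile_def using Lx gL K \<psi>0 \<psi>int acc_int by (simp add: L_def)
    then show ?thesis by blast
  qed
  then show ?thesis using R(1) by blast
qed

lemma profile:
  assumes e: "0 < e"
  shows "\<exists>R>0. \<forall>x. R \<le> \<bar>x\<bar> \<longrightarrow> (\<exists>L \<psi>. tail_profile l l' K e x L \<psi>)"
proof -
  interpret r: rwm_target "\<lambda>x. l (- x)" "\<lambda>x. - l' (- x)" by (rule reflect)
  obtain R1 where R1: "0 < R1" "\<And>x. R1 \<le> x \<Longrightarrow> \<exists>L \<psi>. tail_profile l l' K e x L \<psi>"
    using profile_right[OF e] by blast
  obtain R2 where R2: "0 < R2" "\<And>x. R2 \<le> x \<Longrightarrow> \<exists>L \<psi>. tail_profile (\<lambda>x. l (- x)) (\<lambda>x. - l' (- x)) K e x L \<psi>"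
    using r.profile_right[OF e] by blast
  have "\<exists>L \<psi>. tail_profile l l' K e x L \<psi>" if x: "max R1 R2 \<le> \<bar>x\<bar>" for x
  proof (cases "0 \<le> x")
    case True
    then show ?thesis using R1(2)[of x] x by simp
  next
    case False
    then obtain L \<psi> where "tail_profile (\<lambda>x. l (- x)) (\<lambda>x. - l' (- x)) K e (- x) L \<psi>"
      using R2(2)[of "- x"] x by auto
    from tail_profile_reflect[OF this meas(1)] show ?thesis by auto
  qed
  then show ?thesis using R1(1) by (intro exI[of _ "max R1 R2"]) auto
qed

text \<open>Provides the finite constant by which mean acceptance decays like 1 / s, uniformly for x
  in a compact set.\<close>

lemma exp_half_integrable: "(\<integral>\<^sup>+y. ennreal (exp (l y / 2)) \<partial>lborel) < \<infinity>"
proof -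
  interpret r: rwm_target "\<lambda>x. l (- x)" "\<lambda>x. - l' (- x)" by (rule reflect)
  obtain R1 where R1: "0 < R1" "\<And>x. R1 \<le> x \<Longrightarrow>
      (\<integral>\<^sup>+y. ennreal (exp (l y / 2)) * indicator {x..} y \<partial>lborel) \<le> ennreal (1 * x * exp (l x / 2))"
    using tail_integral_right[of 1] by auto
  obtain R2 where R2: "0 < R2" "\<And>x. R2 \<le> x \<Longrightarrow>
      (\<integral>\<^sup>+y. ennreal (exp (l (- y) / 2)) * indicator {x..} y \<partial>lborel) \<le> ennreal (1 * x * exp (l (- x) / 2))"
    using r.tail_integral_right[of 1] by auto
  define T where "T = max R1 R2"
  obtain B where B: "\<And>y. - T \<le> y \<Longrightarrow> y \<le> T \<Longrightarrow> exp (l y / 2) \<le> B"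
  proof -
    have "continuous_on UNIV (\<lambda>y. exp (l y / 2))" by (intro continuous_intros cont) auto
    from continuous_bounded_Icc[OF this, of "- T" T] that show ?thesis by (meson abs_le_D1)
  qed
  have left: "(\<integral>\<^sup>+y. ennreal (exp (l (- (- y)) / 2)) * indicator {T..} (- y) \<partial>lborel) =
        (\<integral>\<^sup>+y. ennreal (exp (l (- y) / 2)) * indicator {T..} y \<partial>lborel)"
    by (rule nn_integral_lborel_uminus[where f = "\<lambda>y. ennreal (exp (l (- y) / 2)) * indicator {T..} y"]) measurable
  have "(\<integral>\<^sup>+y. ennreal (exp (l y / 2)) \<partial>lborel) \<le> (\<integral>\<^sup>+y. ennreal (exp (l y / 2)) * indicator {T..} y +
      (ennreal (exp (l (- (- y)) / 2)) * indicator {T..} (- y) + ennreal B * indicator {-T..T} y) \<partial>lborel)"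
    using B by (intro nn_integral_mono) (auto split: split_indicator intro!: ennreal_leI)
  also have "\<dots> = (\<integral>\<^sup>+y. ennreal (exp (l y / 2)) * indicator {T..} y \<partial>lborel) +
      ((\<integral>\<^sup>+y. ennreal (exp (l (- y) / 2)) * indicator {T..} y \<partial>lborel) +
        ennreal B * emeasure lborel {-T..T})"
    unfolding left[symmetric]
    by (subst nn_integral_add, measurable, subst nn_integral_add, measurable, subst nn_integral_cmult_indicator) auto
  also have "\<dots> \<le> ennreal (1 * T * exp (l T / 2)) + (ennreal (1 * T * exp (l (- T) / 2)) + ennreal B * emeasure lborel {-T..T})"
    by (intro add_mono R1(2) R2(2) order_refl) (auto simp: T_def)
  also have "\<dots> < \<infinity>"
    using R1(1) by (simp add: ennreal_mult_less_top T_def)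
  finally show ?thesis .
qed

end

section \<open>Mean acceptance probability and mean drift\<close>

lemma tail_profile_near:
  assumes "tail_profile l l' K e x L \<psi>" "\<bar>z\<bar> \<le> L"
  shows "lyap_incr l x (x + z) + lyap_incr l x (x - z) \<le> - (lyap l x / 288 * min 1 ((l' x * z)\<^sup>2))"
proof -
  from assms(1) have "\<forall>z. lyap_incr l x (x + z) + lyap_incr l x (x - z) \<le>
      (if \<bar>z\<bar> \<le> L then - (lyap l x / 288 * min 1 ((l' x * z)\<^sup>2)) else lyap l x * (\<psi> (x + z) + \<psi> (x - z)))"
    unfolding tail_profile_def by (elim conjE)
  from spec[OF this, of z] assms(2) show ?thesis by presburger
qed

lemma tail_profile_far:
  assumes "tail_profile l l' K e x L \<psi>" "\<not> \<bar>z\<bar> \<le> L"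
  shows "lyap_incr l x (x + z) + lyap_incr l x (x - z) \<le> lyap l x * (\<psi> (x + z) + \<psi> (x - z))"
proof -
  from assms(1) have "\<forall>z. lyap_incr l x (x + z) + lyap_incr l x (x - z) \<le>
      (if \<bar>z\<bar> \<le> L then - (lyap l x / 288 * min 1 ((l' x * z)\<^sup>2)) else lyap l x * (\<psi> (x + z) + \<psi> (x - z)))"
    unfolding tail_profile_def by (elim conjE)
  from spec[OF this, of z] assms(2) show ?thesis by presburger
qed

section \<open>Integrals against a bounded symmetric increment density\<close>

locale bounded_increment =
  fixes q :: "real \<Rightarrow> real" and ql qu :: real
  assumes q_meas [measurable]: "q \<in> borel_measurable borel"
    and q_nonneg: "\<And>u. 0 \<le> q u"
    and q_int: "(\<integral>\<^sup>+u. ennreal (q u) \<partial>lborel) = 1"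
    and q_sym: "\<And>u. q (- u) = q u"
    and q_support: "\<And>u. 1 < \<bar>u\<bar> \<Longrightarrow> q u = 0"
    and ql: "0 < ql" "\<And>u. \<bar>u\<bar> \<le> 1 \<Longrightarrow> ql \<le> q u"
    and qu: "0 < qu" "\<And>u. q u \<le> qu"
begin

lemma q_integrable [simp]: "integrable lborel q" and q_integral [simp]: "(\<integral>u. q u \<partial>lborel) = 1"
proof -
  show "integrable lborel q"
    by (rule integrableI_nonneg) (use q_nonneg q_int in auto)
  show "(\<integral>u. q u \<partial>lborel) = 1"
    by (subst integral_eq_nn_integral) (use q_nonneg q_int in auto)
qed

lemma q_times_bounded_integrable:
  assumes [measurable]: "f \<in> borel_measurable borel" and B: "\<And>u. \<bar>u\<bar> \<le> 1 \<Longrightarrow> \<bar>f u\<bar> \<le> B"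
  shows "integrable lborel (\<lambda>u. q u * f u)"
proof (rule Bochner_Integration.integrable_bound)
  show "integrable lborel (\<lambda>u. B * q u)" by simp
  have "\<bar>q u * f u\<bar> \<le> \<bar>B * q u\<bar>" for u
  proof (cases "\<bar>u\<bar> \<le> 1")
    case True
    have "q u * \<bar>f u\<bar> \<le> q u * \<bar>B\<bar>" using B[OF True] q_nonneg[of u] by (intro mult_left_mono) auto
    then show ?thesis using q_nonneg[of u] by (simp add: abs_mult mult.commute)
  qed (simp add: q_support)
  then show "AE u in lborel. norm (q u * f u) \<le> norm (B * q u)" by simp
qed measurable

lemma q_times_continuous_integrable:
  assumes f: "continuous_on UNIV f"
  shows "integrable lborel (\<lambda>u. q u * f u)"
proof -
  obtain B where "\<And>u. - 1 \<le> u \<Longrightarrow> u \<le> 1 \<Longrightarrow> \<bar>f u\<bar> \<le> B"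
    using continuous_bounded_Icc[OF f] by blast
  then show ?thesis
    by (intro q_times_bounded_integrable[where B = B] borel_measurable_continuous_onI[OF f]) auto
qed

lemma q_reflect_integral: "(\<integral>u. q u * f (- u) \<partial>lborel) = (\<integral>u. q u * f u \<partial>lborel)" for f :: "real \<Rightarrow> real"
  using lborel_integral_real_affine[of "- 1" "\<lambda>u. q u * f u" 0] by (simp add: q_sym)

lemma q_symmetrize:
  assumes f: "continuous_on UNIV f"
  shows "(\<integral>u. q u * f u \<partial>lborel) = (\<integral>u. q u * (f u + f (- u)) \<partial>lborel) / 2"
proof -
  have "continuous_on UNIV (\<lambda>u. f (- u))"
    by (intro continuous_on_compose2[OF f] continuous_intros) auto
  then have "(\<integral>u. q u * (f u + f (- u)) \<partial>lborel) = (\<integral>u. q u * f u \<partial>lborel) + (\<integral>u. q u * f (- u) \<partial>lborel)"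
    by (simp add: distrib_left q_times_continuous_integrable f)
  then show ?thesis unfolding q_reflect_integral by simp
qed

lemma q_integral_le:
  assumes m [measurable]: "f \<in> borel_measurable borel" and nn: "\<And>y. 0 \<le> f y"
    and I: "(\<integral>\<^sup>+y. ennreal (f y) \<partial>lborel) \<le> ennreal c" and c: "0 \<le> c" and s: "s \<noteq> 0"
  shows "integrable lborel (\<lambda>u. q u * f (x + s * u))" and "(\<integral>u. q u * f (x + s * u) \<partial>lborel) \<le> qu / \<bar>s\<bar> * c"
proof -
  have "(\<integral>\<^sup>+y. ennreal (f y) \<partial>lborel) = ennreal \<bar>s\<bar> * (\<integral>\<^sup>+u. ennreal (f (x + s * u)) \<partial>lborel)"
    by (rule nn_integral_real_affine) (use s in auto)
  then have *: "ennreal \<bar>s\<bar> * (\<integral>\<^sup>+u. ennreal (f (x + s * u)) \<partial>lborel) \<le> ennreal c" using I by simp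
  have "(\<integral>\<^sup>+u. ennreal (q u * f (x + s * u)) \<partial>lborel) \<le> (\<integral>\<^sup>+u. ennreal (qu / \<bar>s\<bar>) * (ennreal \<bar>s\<bar> * ennreal (f (x + s * u))) \<partial>lborel)"
  proof (intro nn_integral_mono)
    fix u
    have "q u * f (x + s * u) \<le> qu / \<bar>s\<bar> * (\<bar>s\<bar> * f (x + s * u))"
      using s qu(2)[of u] nn[of "x + s * u"] by (simp add: mult_right_mono)
    then show "ennreal (q u * f (x + s * u)) \<le> ennreal (qu / \<bar>s\<bar>) * (ennreal \<bar>s\<bar> * ennreal (f (x + s * u)))"
      using qu(1) nn by (simp add: ennreal_mult[symmetric] ennreal_leI)
  qed
  also have "\<dots> = ennreal (qu / \<bar>s\<bar>) * (ennreal \<bar>s\<bar> * (\<integral>\<^sup>+u. ennreal (f (x + s * u)) \<partial>lborel))"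
    by (subst nn_integral_cmult, measurable, subst nn_integral_cmult, measurable)
  also have "\<dots> \<le> ennreal (qu / \<bar>s\<bar>) * ennreal c" by (intro mult_left_mono *) auto
  also have "\<dots> = ennreal (qu / \<bar>s\<bar> * c)" using qu(1) c by (intro ennreal_mult[symmetric]) auto
  finally have le: "(\<integral>\<^sup>+u. ennreal (q u * f (x + s * u)) \<partial>lborel) \<le> ennreal (qu / \<bar>s\<bar> * c)" .
  show int: "integrable lborel (\<lambda>u. q u * f (x + s * u))"
  proof (rule integrableI_nonneg)
    show "(\<integral>\<^sup>+u. ennreal (q u * f (x + s * u)) \<partial>lborel) < \<infinity>"
      using le by (rule order.strict_trans1) simp
  qed (use nn q_nonneg in auto)
  show "(\<integral>u. q u * f (x + s * u) \<partial>lborel) \<le> qu / \<bar>s\<bar> * c"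
    using le qu(1) c nn q_nonneg by (intro integral_real_bounded) auto
qed

end

locale rwm = rwm_target l l' + bounded_increment q ql qu for l l' q ql qu
begin

definition acc_mean :: "real \<Rightarrow> real \<Rightarrow> real" where
  "acc_mean s x = (\<integral>u. q u * acc_ln l x (x + s * u) \<partial>lborel)"

definition drift :: "real \<Rightarrow> real \<Rightarrow> real" where
  "drift s x = (\<integral>u. q u * lyap_incr l x (x + s * u) \<partial>lborel)"

lemma cont_comp: "continuous_on UNIV (\<lambda>u. l (x + s * u))"
  by (intro continuous_on_compose2[OF cont] continuous_intros) auto

lemma cont_acc_ln: "continuous_on UNIV (\<lambda>u. acc_ln l x (x + s * u))"
  unfolding acc_ln_def by (intro continuous_intros cont_comp)

lemma cont_lyap: "continuous_on UNIV (lyap l)"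
  unfolding lyap_def by (intro continuous_intros cont) auto

lemma cont_lyap_comp: "continuous_on UNIV (\<lambda>u. lyap l (x + s * u))"
  by (intro continuous_on_compose2[OF cont_lyap] continuous_intros) auto

lemma cont_incr: "continuous_on UNIV (\<lambda>u. lyap_incr l x (x + s * u))"
  unfolding lyap_incr_def by (intro continuous_intros cont_acc_ln cont_lyap_comp)

lemma acc_mean_symmetric: "acc_mean s x = (\<integral>u. q u * (acc_ln l x (x + s * u) + acc_ln l x (x - s * u)) \<partial>lborel) / 2"
  unfolding acc_mean_def using q_symmetrize[OF cont_acc_ln, of x s] by simp

lemma drift_symmetric: "drift s x = (\<integral>u. q u * (lyap_incr l x (x + s * u) + lyap_incr l x (x - s * u)) \<partial>lborel) / 2"
  unfolding drift_def using q_symmetrize[OF cont_incr, of x s] by simp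

lemma drift_le_lyap: "drift s x \<le> lyap l x"
proof -
  have "drift s x \<le> (\<integral>u. lyap l x * q u \<partial>lborel)"
    unfolding drift_def
  proof (rule integral_mono)
    show "integrable lborel (\<lambda>u. q u * lyap_incr l x (x + s * u))"
      by (rule q_times_continuous_integrable[OF cont_incr])
    show "q u * lyap_incr l x (x + s * u) \<le> lyap l x * q u" for u
      using mult_left_mono[OF incr_le_lyap[of l x "x + s * u"] q_nonneg[of u]] by (simp add: mult.commute)
  qed simp
  then show ?thesis by simp
qed

lemma meas_acc_ln [measurable]: "(\<lambda>y. acc_ln l x y) \<in> borel_measurable borel"
  unfolding acc_ln_def by measurable

lemma acc_mean_le:
  assumes "(\<integral>\<^sup>+y. ennreal (acc_ln l x y) \<partial>lborel) \<le> ennreal c" "0 \<le> c" "0 < s"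
  shows "acc_mean s x \<le> qu / s * c"
  unfolding acc_mean_def using q_integral_le(2)[OF meas_acc_ln acc_ln_nonneg assms(1,2), of s x] assms(3) by simp

text \<open>Acceptance is at most \<open>lyap l x * exp (l y / 2)\<close>; the first factor is
  bounded for |x| <= R and the second is integrable in y.\<close>

lemma acc_mean_small_compact:
  assumes e: "0 < e"
  shows "\<exists>S>0. \<forall>s x. S \<le> s \<longrightarrow> \<bar>x\<bar> \<le> R \<longrightarrow> acc_mean s x \<le> e"
proof -
  obtain B where B: "0 < B" "\<And>x. - R \<le> x \<Longrightarrow> x \<le> R \<Longrightarrow> \<bar>lyap l x\<bar> \<le> B"
    using continuous_bounded_Icc[OF cont_lyap] by blast
  obtain I where I: "0 \<le> I" "(\<integral>\<^sup>+y. ennreal (exp (l y / 2)) \<partial>lborel) = ennreal I"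
    using exp_half_integrable by (metis ennreal_cases infinity_ennreal_def less_irrefl)
  define S where "S = max 1 (qu * (B * I) / e)"
  have "acc_mean s x \<le> e" if s: "S \<le> s" and x: "\<bar>x\<bar> \<le> R" for s x
  proof -
    have s0: "0 < s" using s by (simp add: S_def)
    have "(\<integral>\<^sup>+y. ennreal (acc_ln l x y) \<partial>lborel) \<le> (\<integral>\<^sup>+y. ennreal B * ennreal (exp (l y / 2)) \<partial>lborel)"
    proof (intro nn_integral_mono)
      fix y
      have "acc_ln l x y \<le> lyap l x * exp (l y / 2)"
        using acc_ln_le_exp_half[of l x y] by (simp add: lyap_def exp_add[symmetric] diff_divide_distrib)
      also have "\<dots> \<le> B * exp (l y / 2)" using B(2)[of x] x by (intro mult_right_mono) auto
      finally show "ennreal (acc_ln l x y) \<le> ennreal B * ennreal (exp (l y / 2))"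
        using B(1) by (simp add: ennreal_mult[symmetric] ennreal_leI)
    qed
    also have "\<dots> = ennreal (B * I)"
      using B(1) I by (subst nn_integral_cmult) (auto simp: ennreal_mult)
    finally have "acc_mean s x \<le> qu / s * (B * I)"
      using B(1) I(1) s0 by (intro acc_mean_le) auto
    also have "\<dots> \<le> e"
    proof -
      have "qu * (B * I) / e \<le> s" using s by (simp add: S_def)
      then show ?thesis using e s0 by (simp add: field_simps)
    qed
    finally show ?thesis .
  qed
  moreover have "0 < S" by (simp add: S_def)
  ultimately show ?thesis by blast
qed

text \<open>In the tails one of \<open>x \<plusminus> s * u\<close> is always accepted; elsewhere \<open>l\<close> is uniformly continuous.\<close>
lemma acc_mean_small_scale:
  assumes e: "0 < e"
  shows "\<exists>S>0. \<forall>s x. 0 < s \<longrightarrow> s \<le> S \<longrightarrow> 1 / 2 - e \<le> acc_mean s x"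
proof -
  interpret r: rwm_target "\<lambda>x. l (- x)" "\<lambda>x. - l' (- x)" by (rule reflect)
  obtain R1 where R1: "0 < R1" "\<And>x y. R1 \<le> x \<Longrightarrow> x \<le> y \<Longrightarrow> l y \<le> l x"
    using antimono_right by blast
  obtain R2 where R2: "0 < R2" "\<And>x y. R2 \<le> x \<Longrightarrow> x \<le> y \<Longrightarrow> l (- y) \<le> l (- x)"
    using r.antimono_right by blast
  define T where "T = max R1 R2"
  \<comment> \<open>Proposals move by at most 1. Hence from |x| <= T + 1 they stay in this interval,
    and from farther out they stay where \<open>l\<close> is monotone.\<close>
  have "uniformly_continuous_on {- (T + 2)..T + 2} l"
    by (intro compact_uniformly_continuous continuous_on_subset[OF cont]) auto
  then obtain d where d: "0 < d" "\<And>x y. x \<in> {- (T + 2)..T + 2} \<Longrightarrow> y \<in> {- (T + 2)..T + 2} \<Longrightarrow>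
      dist y x < d \<Longrightarrow> dist (l y) (l x) < e"
    using e unfolding uniformly_continuous_on_def by metis
  define S where "S = min 1 (d / 2)"
  have "1 / 2 - e \<le> acc_mean s x" if s: "0 < s" "s \<le> S" for s x
  proof -
    have *: "1 - 2 * e \<le> acc_ln l x (x + s * u) + acc_ln l x (x - s * u)" if u: "\<bar>u\<bar> \<le> 1" for u
    proof -
      have su: "\<bar>s * u\<bar> \<le> S" using s mult_mono[of s S "\<bar>u\<bar>" 1] u by (simp add: abs_mult)
      then have su1: "\<bar>s * u\<bar> \<le> 1" "\<bar>s * u\<bar> < d" using d(1) by (auto simp: S_def)
      consider "T + 1 \<le> x" | "x \<le> - (T + 1)" | "\<bar>x\<bar> \<le> T + 1" by linarith
      then show ?thesis
      proof cases
        case 1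
        have "l x \<le> l (x - \<bar>s * u\<bar>)" using 1 su1 by (intro R1(2)) (auto simp: T_def)
        then have "acc_ln l x (x - \<bar>s * u\<bar>) = 1" by (simp add: acc_ln_def)
        then have "acc_ln l x (x + s * u) = 1 \<or> acc_ln l x (x - s * u) = 1" by (cases "0 \<le> s * u") auto
        then show ?thesis using e acc_ln_nonneg[of l x "x + s * u"] acc_ln_nonneg[of l x "x - s * u"] by linarith
      next
        case 2
        have "l (- (- x)) \<le> l (- (- x - \<bar>s * u\<bar>))" using 2 su1 by (intro R2(2)) (auto simp: T_def)
        then have "l x \<le> l (x + \<bar>s * u\<bar>)" by (simp add: add.commute)
        then have "acc_ln l x (x + \<bar>s * u\<bar>) = 1" by (simp add: acc_ln_def)
        then have "acc_ln l x (x + s * u) = 1 \<or> acc_ln l x (x - s * u) = 1" by (cases "0 \<le> s * u") auto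
        then show ?thesis using e acc_ln_nonneg[of l x "x + s * u"] acc_ln_nonneg[of l x "x - s * u"] by linarith
      next
        case 3
        have "1 - e \<le> acc_ln l x (x + w)" if w: "\<bar>w\<bar> \<le> 1" "\<bar>w\<bar> < d" for w
        proof -
          have "dist (l (x + w)) (l x) < e" using 3 w by (intro d(2)) (auto simp: dist_real_def)
          then have "- e \<le> l (x + w) - l x" by (simp add: dist_real_def)
          then have "1 - e \<le> exp (l (x + w) - l x)"
            using exp_ge_add_one_self[of "l (x + w) - l x"] by linarith
          then show ?thesis using e by (simp add: acc_ln_def)
        qed
        from this[of "s * u"] this[of "- (s * u)"] su1 show ?thesis by simp
      qed
    qed
    have "(\<integral>u. (1 - 2 * e) * q u \<partial>lborel) \<le> (\<integral>u. q u * (acc_ln l x (x + s * u) + acc_ln l x (x - s * u)) \<partial>lborel)"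
    proof (rule integral_mono)
      show "integrable lborel (\<lambda>u. q u * (acc_ln l x (x + s * u) + acc_ln l x (x - s * u)))"
        using cont_acc_ln[of x s] cont_acc_ln[of x "- s"]
        by (intro q_times_continuous_integrable continuous_on_add) auto
      show "(1 - 2 * e) * q u \<le> q u * (acc_ln l x (x + s * u) + acc_ln l x (x - s * u))" for u
        using mult_left_mono[OF * q_nonneg, of u u] q_support[of u]
        by (cases "\<bar>u\<bar> \<le> 1") (auto simp: mult.commute)
    qed simp
    then show ?thesis unfolding acc_mean_symmetric by simp
  qed
  moreover have "0 < S" using d(1) by (simp add: S_def)
  ultimately show ?thesis by blast
qed

lemma cont_incr_sum: "continuous_on UNIV (\<lambda>u. lyap_incr l x (x + s * u) + lyap_incr l x (x - s * u))"
  using cont_incr[of x s] cont_incr[of x "- s"] by (intro continuous_on_add) auto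

lemma q_integral_interval_ge:
  assumes t: "0 < t" "t \<le> 1"
  shows "integrable lborel (\<lambda>u. q u * indicator {t / 2..t} u)" "ql * (t / 2) \<le> (\<integral>u. q u * indicator {t / 2..t} u \<partial>lborel)"
proof -
  show int: "integrable lborel (\<lambda>u. q u * indicator {t / 2..t} u)"
    by (intro q_times_bounded_integrable[where B = 1]) auto
  have "(\<integral>u. ql * indicator {t / 2..t} u \<partial>lborel) \<le> (\<integral>u. q u * indicator {t / 2..t} u \<partial>lborel)"
    using t ql(2) by (intro integral_mono int) (auto split: split_indicator)
  then show "ql * (t / 2) \<le> (\<integral>u. q u * indicator {t / 2..t} u \<partial>lborel)" using t by simp
qed

text \<open>No pair leaves the level set, so every pair contributes a nonpositive amount and only u
  in [1/2, 1] is kept. The constant 1152 is 288 times 2 for the length of that interval and 2 for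
  the symmetrization.\<close>

lemma drift_small_scale:
  assumes p: "tail_profile l l' K e x L \<psi>" and s: "0 < s" "s \<le> L"
  shows "drift s x \<le> - (ql / 1152 * lyap l x * min 1 ((l' x * (s / 2))\<^sup>2))"
proof -
  let ?c = "lyap l x / 288 * min 1 ((l' x * (s / 2))\<^sup>2)"
  have c0: "0 \<le> ?c" by simp
  have "(\<integral>u. q u * (lyap_incr l x (x + s * u) + lyap_incr l x (x - s * u)) \<partial>lborel) \<le>
      (\<integral>u. - ?c * (q u * indicator {1 / 2..1} u) \<partial>lborel)"
  proof (rule integral_mono)
    show "integrable lborel (\<lambda>u. q u * (lyap_incr l x (x + s * u) + lyap_incr l x (x - s * u)))"
      by (rule q_times_continuous_integrable[OF cont_incr_sum])
    show "integrable lborel (\<lambda>u. - ?c * (q u * indicator {1 / 2..1} u))"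
      using q_integral_interval_ge(1)[of 1] by (intro integrable_mult_right) simp
    fix u
    show "q u * (lyap_incr l x (x + s * u) + lyap_incr l x (x - s * u)) \<le> - ?c * (q u * indicator {1 / 2..1} u)"
    proof (cases "\<bar>u\<bar> \<le> 1")
      case True
      then have "\<bar>s * u\<bar> \<le> L" using s mult_left_mono[OF True, of s] by (simp only: abs_mult) linarith
      then have *: "lyap_incr l x (x + s * u) + lyap_incr l x (x - s * u) \<le> - (lyap l x / 288 * min 1 ((l' x * (s * u))\<^sup>2))"
        by (rule tail_profile_near[OF p])
      have "lyap_incr l x (x + s * u) + lyap_incr l x (x - s * u) \<le> - ?c * indicator {1 / 2..1} u"
      proof (cases "u \<in> {1 / 2..1}")
        case True
        then have "(s / 2)\<^sup>2 \<le> (s * u)\<^sup>2" using s by (intro power_mono) auto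
        then have "(l' x * (s / 2))\<^sup>2 \<le> (l' x * (s * u))\<^sup>2"
          unfolding power_mult_distrib[of "l' x"] by (intro mult_left_mono) auto
        then have "?c \<le> lyap l x / 288 * min 1 ((l' x * (s * u))\<^sup>2)"
          by (intro mult_left_mono) auto
        moreover have "indicator {1 / 2..1} u = (1 :: real)" using True by simp
        ultimately show ?thesis using * by (simp only: mult_1_right)
      next
        case False
        have "0 \<le> lyap l x / 288 * min 1 ((l' x * (s * u))\<^sup>2)" by simp
        then have "lyap_incr l x (x + s * u) + lyap_incr l x (x - s * u) \<le> 0" using * by linarith
        then show ?thesis using False by simp
      qed
      from mult_left_mono[OF this q_nonneg[of u]] show ?thesis by (simp add: mult_ac)
    qed (simp add: q_support)
  qed
  also have "\<dots> = - ?c * (\<integral>u. q u * indicator {1 / 2..1} u \<partial>lborel)" by simp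
  also have "\<dots> \<le> - ?c * (ql * (1 / 2))"
    using mult_left_mono[OF q_integral_interval_ge(2)[of 1] c0] by simp
  finally show ?thesis unfolding drift_symmetric by (simp add: field_simps)
qed

text \<open>Only s u in [L / 2, L] is kept, where |l' x s u| >= 8 and the minimum in the profile is
  1; this set of u has length proportional to L / s. The contribution of \<open>\<psi>\<close> has
  the same order V L / s, and the condition on \<open>e\<close> lets it consume just half of the
  gain.\<close>

lemma drift_large_scale:
  assumes p: "tail_profile l l' K e x L \<psi>" and s: "L < s" and L: "0 < L"
    and e: "0 \<le> e" "qu * e \<le> ql / 2304"
  shows "drift s x \<le> - (ql / 2304 * lyap l x * L / s)"
proof -
  have s0: "0 < s" using s L by linarith
  define t where "t = L / s"
  have t: "0 < t" "t \<le> 1" "s * t = L" using s L s0 by (auto simp: t_def)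
  let ?c = "lyap l x / 288"
  have m: "\<psi> \<in> borel_measurable borel" and nn: "\<And>y. 0 \<le> \<psi> y"
    and I: "(\<integral>\<^sup>+y. ennreal (\<psi> y) \<partial>lborel) \<le> ennreal (e * L)" and g: "16 \<le> \<bar>l' x\<bar> * L"
    using p unfolding tail_profile_def by blast+
  have eL: "0 \<le> e * L" using e L by simp
  note i1 = q_integral_le[OF m nn I eL, of s x] and i2 = q_integral_le[OF m nn I eL, of "- s" x]
  have int1: "integrable lborel (\<lambda>u. q u * \<psi> (x + s * u))" and int2: "integrable lborel (\<lambda>u. q u * \<psi> (x - s * u))"
    using i1(1) i2(1) s0 by auto
  have le1: "(\<integral>u. q u * \<psi> (x + s * u) \<partial>lborel) \<le> qu / s * (e * L)"
    and le2: "(\<integral>u. q u * \<psi> (x - s * u) \<partial>lborel) \<le> qu / s * (e * L)"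
    using i1(2) i2(2) s0 by auto
  have "(\<integral>u. q u * (lyap_incr l x (x + s * u) + lyap_incr l x (x - s * u)) \<partial>lborel) \<le>
      (\<integral>u. lyap l x * (q u * \<psi> (x + s * u) + q u * \<psi> (x - s * u)) - ?c * (q u * indicator {t / 2..t} u) \<partial>lborel)"
  proof (rule integral_mono)
    show "integrable lborel (\<lambda>u. q u * (lyap_incr l x (x + s * u) + lyap_incr l x (x - s * u)))"
      by (rule q_times_continuous_integrable[OF cont_incr_sum])
    show "integrable lborel (\<lambda>u. lyap l x * (q u * \<psi> (x + s * u) + q u * \<psi> (x - s * u)) - ?c * (q u * indicator {t / 2..t} u))"
      using q_integral_interval_ge(1)[OF t(1,2)]
      by (intro Bochner_Integration.integrable_diff integrable_mult_right Bochner_Integration.integrable_add int1 int2)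
    fix u
    have "lyap_incr l x (x + s * u) + lyap_incr l x (x - s * u) \<le>
        lyap l x * (\<psi> (x + s * u) + \<psi> (x - s * u)) - ?c * indicator {t / 2..t} u"
    proof (cases "\<bar>s * u\<bar> \<le> L")
      case True
      have *: "lyap_incr l x (x + s * u) + lyap_incr l x (x - s * u) \<le> - (?c * min 1 ((l' x * (s * u))\<^sup>2))"
        by (rule tail_profile_near[OF p True])
      have psi: "0 \<le> lyap l x * (\<psi> (x + s * u) + \<psi> (x - s * u))" using nn by simp
      show ?thesis
      proof (cases "u \<in> {t / 2..t}")
        case True
        have "L / 2 \<le> s * u" using True mult_left_mono[of "t / 2" u s] s0 t(3) by simp
        then have "\<bar>l' x\<bar> * (L / 2) \<le> \<bar>l' x\<bar> * (s * u)" by (intro mult_left_mono) auto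
        also have "\<dots> \<le> \<bar>l' x\<bar> * \<bar>s * u\<bar>" by (intro mult_left_mono) auto
        finally have "1 \<le> \<bar>l' x * (s * u)\<bar>" using g unfolding abs_mult[of "l' x"] by linarith
        then have "1 \<le> (l' x * (s * u))\<^sup>2" using power_mono[of 1 "\<bar>l' x * (s * u)\<bar>" 2] by simp
        then show ?thesis using * psi True by simp
      next
        case False
        have "0 \<le> ?c * min 1 ((l' x * (s * u))\<^sup>2)" by simp
        then have "lyap_incr l x (x + s * u) + lyap_incr l x (x - s * u) \<le> 0" using * by linarith
        then show ?thesis using False psi by simp
      qed
    next
      case False
      then have "u \<notin> {t / 2..t}" using t s0 mult_left_mono[of u t s] by (auto simp: abs_mult)
      then show ?thesis using tail_profile_far[OF p False] by simp
    qed
    from mult_left_mono[OF this q_nonneg[of u]]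
    show "q u * (lyap_incr l x (x + s * u) + lyap_incr l x (x - s * u)) \<le>
        lyap l x * (q u * \<psi> (x + s * u) + q u * \<psi> (x - s * u)) - ?c * (q u * indicator {t / 2..t} u)"
      by (simp add: algebra_simps)
  qed
  also have "\<dots> = lyap l x * ((\<integral>u. q u * \<psi> (x + s * u) \<partial>lborel) + (\<integral>u. q u * \<psi> (x - s * u) \<partial>lborel)) -
      ?c * (\<integral>u. q u * indicator {t / 2..t} u \<partial>lborel)"
    using q_integral_interval_ge(1)[OF t(1,2)] int1 int2
    by (subst Bochner_Integration.integral_diff) (auto intro!: integrable_mult_right Bochner_Integration.integrable_add)
  also have "\<dots> \<le> lyap l x * (qu / s * (e * L) + qu / s * (e * L)) - ?c * (ql * (t / 2))"
    by (intro diff_mono mult_left_mono add_mono le1 le2 q_integral_interval_ge(2) t) auto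
  also have "\<dots> = lyap l x * (L / s) * (2 * (qu * e) - ql / 576)"
    using s0 by (simp add: t_def field_simps)
  also have "\<dots> \<le> lyap l x * (L / s) * (- (ql / 1152))"
    using e s0 L by (intro mult_left_mono) auto
  finally show ?thesis unfolding drift_symmetric by (simp add: field_simps)
qed

text \<open>Three regimes of s relative to the length L of the level set. Up to L, either V or V (l'
  s)^2 provides the drift, the latter dominating K s because K s >= 1. Between L and a multiple of
  L, the drift of order - V L / s is still enough. Beyond, most proposals leave the level set and
  are rejected.\<close>

lemma drift_tail:
  assumes K: "1 \<le> K" and eps: "0 < eps"
  shows "\<exists>R>0. \<forall>x. R \<le> \<bar>x\<bar> \<longrightarrow> (\<forall>s>0. drift s x \<le> 0) \<and>
    (\<forall>s\<ge>1 / K. drift s x \<le> - K * s \<or> K \<le> s \<and> acc_mean s x \<le> eps)"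
proof -
  \<comment> \<open>The ratio s / L above which mean acceptance, at most 2 qu L / s, is below
    \<open>eps\<close>.\<close>
  define K1 where "K1 = max K (2 * qu / eps)"
  define e where "e = min 1 (ql / (2304 * qu))"
  \<comment> \<open>The square of \<open>K1\<close> pays for the middle regime, where K s^2 has to
    be below a multiple of V L although s may reach K1 L. The 4608 is 1152 times 4, from (s /
    2)^2.\<close>
  define K2 where "K2 = 4608 * K * K1\<^sup>2 / ql"
  have e: "0 < e" "e \<le> 1" "qu * e \<le> ql / 2304"
  proof -
    show "0 < e" using ql qu by (simp add: e_def)
    show "e \<le> 1" by (simp add: e_def)
    have "qu * e \<le> qu * (ql / (2304 * qu))" using qu by (intro mult_left_mono) (auto simp: e_def)
    then show "qu * e \<le> ql / 2304" using qu by simp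
  qed
  have K1: "1 \<le> K1" "K \<le> K1" "2 * qu / eps \<le> K1" using K by (auto simp: K1_def)
  have K1sq: "1 \<le> K1\<^sup>2" using K1 by simp
  have qlK2: "ql * K2 = 4608 * K * K1\<^sup>2" using ql by (simp add: K2_def)
  obtain R where R: "0 < R" "\<And>x. R \<le> \<bar>x\<bar> \<Longrightarrow> \<exists>L \<psi>. tail_profile l l' K2 e x L \<psi>"
    using profile[OF e(1)] by blast
  have "(\<forall>s>0. drift s x \<le> 0) \<and> (\<forall>s\<ge>1 / K. drift s x \<le> - K * s \<or> K \<le> s \<and> acc_mean s x \<le> eps)"
    if x: "max R K \<le> \<bar>x\<bar>" for x
  proof -
    obtain L \<psi> where p: "tail_profile l l' K2 e x L \<psi>" using R(2)[of x] x by auto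
    then have L: "\<bar>x\<bar> \<le> L" "K2 * L \<le> lyap l x" "K2 \<le> lyap l x * (l' x)\<^sup>2"
      and I: "(\<integral>\<^sup>+y. ennreal (acc_ln l x y) \<partial>lborel) \<le> ennreal ((1 + e) * L)"
      unfolding tail_profile_def by blast+
    have L0: "0 < L" "K \<le> L" using L(1) x K by auto
    have ly1: "4608 * K * K1\<^sup>2 * L \<le> ql * lyap l x" and ly2: "4608 * K * K1\<^sup>2 \<le> ql * (lyap l x * (l' x)\<^sup>2)"
      unfolding qlK2[symmetric] using mult_left_mono[OF L(2), of ql] mult_left_mono[OF L(3), of ql] ql(1)
      by (simp_all only: mult.assoc less_imp_le)
    note small = drift_small_scale[OF p] and large = drift_large_scale[OF p _ L0(1) less_imp_le[OF e(1)] e(3)]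
    have "drift s x \<le> 0" if s: "0 < s" for s
    proof (cases "s \<le> L")
      case True
      have "0 \<le> ql / 1152 * lyap l x * min 1 ((l' x * (s / 2))\<^sup>2)" using ql by simp
      then show ?thesis using small[OF s True] by linarith
    next
      case False
      have "0 \<le> ql / 2304 * lyap l x * L / s" using ql L0 s by simp
      then show ?thesis using large[of s] False by linarith
    qed
    moreover have "drift s x \<le> - K * s \<or> K \<le> s \<and> acc_mean s x \<le> eps" if s: "1 / K \<le> s" for s
    proof -
      have s0: "0 < s" and Ks: "1 \<le> K * s"
        using s K by (auto simp: field_simps intro: less_le_trans[of 0 "1 / K"])
      consider "s \<le> L" | "L < s" "s \<le> K1 * L" | "K1 * L < s" by linarith
      then show ?thesis
      proof cases
        case 1
        have "K * s \<le> ql / 1152 * lyap l x * min 1 ((l' x * (s / 2))\<^sup>2)"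
        proof (cases "1 \<le> (l' x * (s / 2))\<^sup>2")
          case True
          have "1152 * (K * s) \<le> 4608 * (K * 1 * L)" using 1 K s0 by (simp add: mult_mono)
          also have "\<dots> \<le> 4608 * (K * K1\<^sup>2 * L)" using K K1sq L0 by (intro mult_left_mono mult_right_mono) auto
          also have "\<dots> \<le> ql * lyap l x" using ly1 by simp
          finally show ?thesis using True by simp
        next
          case False
          have "4608 * (K * s) \<le> 4608 * (K * s) * (K * s)" using Ks K s0 by simp
          also have "\<dots> \<le> 4608 * K * K1\<^sup>2 * s\<^sup>2"
          proof -
            have "K * (K * s\<^sup>2) \<le> K * (K1\<^sup>2 * s\<^sup>2)"
              using K K1 K1sq by (intro mult_left_mono mult_right_mono) (auto simp: power2_eq_square intro: order_trans[OF K1(2)])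
            then show ?thesis by (simp add: power2_eq_square mult_ac)
          qed
          also have "\<dots> \<le> ql * (lyap l x * (l' x)\<^sup>2) * s\<^sup>2" by (intro mult_right_mono ly2) auto
          finally show ?thesis using False by (simp add: power_mult_distrib power_divide field_simps)
        qed
        then show ?thesis using small[OF s0 1] by linarith
      next
        case 2
        have "K * s * s \<le> K * (K1 * L) * (K1 * L)"
          using 2 K K1 L0 s0 by (intro mult_mono) auto
        also have "\<dots> = (K * K1\<^sup>2 * L) * L" by (simp add: power2_eq_square)
        also have "\<dots> \<le> (ql / 2304 * lyap l x) * L"
        proof (rule mult_right_mono)
          have "0 \<le> K * K1\<^sup>2 * L" using K L0 by simp
          then show "K * K1\<^sup>2 * L \<le> ql / 2304 * lyap l x" using ly1 by simp
        qed (use L0 in simp)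
        finally have "K * s \<le> ql / 2304 * lyap l x * L / s" using s0 by (simp add: field_simps)
        then show ?thesis using large[OF 2(1)] by linarith
      next
        case 3
        have "L \<le> K1 * L" using K1 L0 by simp
        have "acc_mean s x \<le> qu / s * ((1 + e) * L)"
          using e L0 s0 by (intro acc_mean_le[OF I]) auto
        also have "\<dots> \<le> qu / s * (2 * L)"
          using e L0 s0 qu(1) by (intro mult_left_mono mult_right_mono) auto
        also have "\<dots> \<le> eps"
        proof -
          have "2 * qu * L \<le> (K1 * eps) * L" using K1(3) eps L0 by (intro mult_right_mono) (auto simp: field_simps)
          also have "\<dots> = eps * (K1 * L)" by simp
          also have "\<dots> \<le> eps * s" using 3 eps by (intro mult_left_mono) auto
          finally show ?thesis using s0 by (simp add: field_simps)
        qed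
        finally have "acc_mean s x \<le> eps" .
        moreover have "K \<le> s" using 3 \<open>L \<le> K1 * L\<close> L0(2) by linarith
        ultimately show ?thesis by simp
      qed
    qed
    ultimately show ?thesis by blast
  qed
  then show ?thesis using R(1) by (intro exI[of _ "max R K"]) auto
qed

lemma drift_bounded: "\<exists>B>0. \<forall>s>0. \<forall>x. drift s x \<le> B"
proof -
  obtain R where R: "\<And>x s. R \<le> \<bar>x\<bar> \<Longrightarrow> 0 < s \<Longrightarrow> drift s x \<le> 0"
    using drift_tail[of 1 1] by auto
  obtain B where B: "0 < B" "\<And>x. - R \<le> x \<Longrightarrow> x \<le> R \<Longrightarrow> \<bar>lyap l x\<bar> \<le> B"
    using continuous_bounded_Icc[OF cont_lyap] by blast
  have "drift s x \<le> B" if "0 < s" for s x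
  proof (cases "R \<le> \<bar>x\<bar>")
    case True
    then show ?thesis using R[OF True that] B(1) by linarith
  next
    case False
    then show ?thesis using drift_le_lyap[of s x] B(2)[of x] by linarith
  qed
  then show ?thesis using B(1) by blast
qed

end

section \<open>Drift of the weight of the adaptation parameter\<close>

text \<open>\<open>g0\<close> and \<open>g\<close> are consecutive stepsizes and \<open>a\<close> is
  the realized acceptance probability. It alone determines the new parameter; whether the move is
  accepted does not enter.\<close>

definition weight_step :: "coerced_alg \<Rightarrow> real \<Rightarrow> real \<Rightarrow> real \<Rightarrow> real \<Rightarrow> real \<Rightarrow> real" where
  "weight_step alg astar g0 g \<theta> a = weight alg (\<theta> + g * gain alg \<theta> * (a - astar)) / g - weight alg \<theta> / g0"

lemma exp_le_quadratic:
  fixes t :: real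
  assumes "\<bar>t\<bar> \<le> 1"
  shows "exp t \<le> 1 + t + t\<^sup>2"
proof (cases "0 \<le> t")
  case True
  then show ?thesis using exp_bound[of t] assms by simp
next
  case False
  have "(1 - t) * exp t \<le> exp (- t) * exp t"
    using exp_ge_add_one_self[of "- t"] by (intro mult_right_mono) auto
  then have "(1 - t) * exp t \<le> 1" by (simp add: exp_add[symmetric])
  moreover have "1 \<le> (1 - t) * (1 + t + t\<^sup>2)"
  proof -
    have "(1 - t) * (1 + t + t\<^sup>2) = 1 - t * t\<^sup>2" by (simp add: algebra_simps power2_eq_square)
    moreover have "t * t\<^sup>2 \<le> 0" using False by (simp add: mult_nonpos_nonneg)
    ultimately show ?thesis by linarith
  qed
  ultimately have "(1 - t) * exp t \<le> (1 - t) * (1 + t + t\<^sup>2)" by linarith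
  then show ?thesis using False by (simp add: mult_le_cancel_left)
qed

lemma weight_ge_1: "1 \<le> weight alg \<theta>"
  by (cases alg) auto

text \<open>Makes the weight comparable with \<sigma> once \<theta> is bounded below.\<close>

lemma weight_le_exp: "weight alg \<theta> \<le> 2 * exp \<bar>\<theta>\<bar>"
proof (cases alg)
  case Fast
  have "1 + \<bar>\<theta>\<bar> + \<bar>\<theta>\<bar>\<^sup>2 / 2 \<le> exp \<bar>\<theta>\<bar>" by (rule exp_lower_Taylor_quadratic) simp
  then show ?thesis using Fast abs_ge_zero[of \<theta>] by simp
qed simp

lemma weight_mono: "\<bar>\<theta>\<bar> \<le> \<bar>\<theta>'\<bar> \<Longrightarrow> weight alg \<theta> \<le> weight alg \<theta>'"
  by (cases alg) (auto simp: abs_le_square_iff)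

lemma weight_unbounded: "\<exists>m>0. \<forall>\<theta>. m \<le> \<bar>\<theta>\<bar> \<longrightarrow> B \<le> weight alg \<theta>"
proof -
  have "B \<le> weight alg \<theta>" if t: "max 1 \<bar>B\<bar> \<le> \<bar>\<theta>\<bar>" for \<theta>
  proof (cases alg)
    case Standard
    then show ?thesis using exp_ge_add_one_self[of "\<bar>\<theta>\<bar>"] t abs_ge_self[of B]
      unfolding Standard weight.simps by linarith
  next
    case Fast
    have "\<bar>\<theta>\<bar> * 1 \<le> \<bar>\<theta>\<bar> * \<bar>\<theta>\<bar>" using t by (intro mult_left_mono) auto
    then have "\<bar>B\<bar> \<le> \<bar>\<theta>\<bar>\<^sup>2" using t by (simp only: power2_eq_square)
    then show ?thesis unfolding Fast weight.simps using abs_ge_self[of B] by linarith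
  qed
  then show ?thesis by (intro exI[of _ "max 1 \<bar>B\<bar>"]) auto
qed

lemma weight_step_Standard:
  assumes "0 < g" "0 < g0"
  shows "weight_step Standard astar g0 g \<theta> a =
    (exp \<bar>\<theta> + g * (a - astar)\<bar> - exp \<bar>\<theta>\<bar>) / g + exp \<bar>\<theta>\<bar> * (1 / g - 1 / g0)"
  using assms by (simp add: weight_step_def field_simps)

lemma weight_step_Fast:
  assumes "0 < g" "0 < g0"
  shows "weight_step Fast astar g0 g \<theta> a = (1 + \<theta>\<^sup>2) * (1 / g - 1 / g0) +
    2 * \<theta> * (\<bar>\<theta>\<bar> + 1) * (a - astar) + g * (\<bar>\<theta>\<bar> + 1)\<^sup>2 * (a - astar)\<^sup>2"
  using assms by (simp add: weight_step_def field_simps power2_eq_square)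

text \<open>The limit of - W'(\<theta>) \<open>gain alg \<theta>\<close> / W(\<theta>) at minus
  infinity. It has to be sharp: it multiplies 1 / 2 - a, which takes both signs, so it cannot simply
  be enlarged.\<close>

definition left_slope :: "coerced_alg \<Rightarrow> real" where
  "left_slope alg = (case alg of Standard \<Rightarrow> 1 | Fast \<Rightarrow> 2)"

context
  fixes astar \<delta> g0 g a :: real
  assumes astar: "0 < astar" "astar < 1 / 2" and g: "0 < g" "g \<le> 1" and g0: "0 < g0"
    and a: "0 \<le> a" "a \<le> 1" and d: "0 < \<delta>"
    and gap: "(1 / g - 1 / g0) + g \<le> min astar (1 / 2 - astar) - \<delta>"
begin

lemma sq_le_1: "(a - astar)\<^sup>2 \<le> 1"
  using astar a by (auto simp: abs_square_le_1)

lemma gap_le_1: "1 / g - 1 / g0 \<le> 1" and gap': "1 / g - 1 / g0 + g \<le> astar - \<delta>" "1 / g - 1 / g0 + g \<le> 1 / 2 - astar - \<delta>"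
  using gap g d astar by auto

text \<open>For \<open>Fast\<close>, 7 is 1 from the stepsize difference, 4 from the first order and
  2 from the second order term, using (|\<theta>| + 1)^2 <= 2 (1 + \<theta>^2). This crude bound
  serves where the drift of \<open>lyap\<close> dominates.\<close>

lemma weight_step_le: "weight_step alg astar g0 g \<theta> a \<le> 7 * weight alg \<theta>"
proof (cases alg)
  case Standard
  have h: "\<bar>g * (a - astar)\<bar> \<le> g * 1"
    unfolding abs_mult using g a astar by (intro mult_mono) auto
  have "exp \<bar>\<theta> + g * (a - astar)\<bar> \<le> exp (\<bar>\<theta>\<bar> + g)" using h by simp
  also have "\<dots> = exp \<bar>\<theta>\<bar> * exp g" by (simp add: exp_add)
  also have "\<dots> \<le> exp \<bar>\<theta>\<bar> * (1 + g + g\<^sup>2)" using exp_le_quadratic[of g] g by (intro mult_left_mono) auto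
  finally have "(exp \<bar>\<theta> + g * (a - astar)\<bar> - exp \<bar>\<theta>\<bar>) / g \<le> (exp \<bar>\<theta>\<bar> * (1 + g + g\<^sup>2) - exp \<bar>\<theta>\<bar>) / g"
    using g by (intro divide_right_mono) auto
  also have "\<dots> = exp \<bar>\<theta>\<bar> * (1 + g)" using g by (simp add: field_simps power2_eq_square)
  also have "\<dots> \<le> exp \<bar>\<theta>\<bar> * 2" using g by (intro mult_left_mono) auto
  finally show ?thesis
    using mult_left_mono[OF gap_le_1, of "exp \<bar>\<theta>\<bar>"] exp_ge_zero[of "\<bar>\<theta>\<bar>"]
    unfolding Standard weight_step_Standard[OF g(1) g0] weight.simps by linarith
next
  case Fast
  have "0 \<le> (\<bar>\<theta>\<bar> - 1)\<^sup>2" by simp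
  then have G: "(\<bar>\<theta>\<bar> + 1)\<^sup>2 \<le> 2 * (1 + \<theta>\<^sup>2)" by (simp add: power2_eq_square algebra_simps)
  have "\<theta> * (\<bar>\<theta>\<bar> + 1) * (a - astar) \<le> \<bar>\<theta> * (\<bar>\<theta>\<bar> + 1) * (a - astar)\<bar>" by simp
  also have "\<dots> = \<bar>\<theta>\<bar> * (\<bar>\<theta>\<bar> + 1) * \<bar>a - astar\<bar>" by (simp add: abs_mult)
  also have "\<dots> \<le> (\<bar>\<theta>\<bar> + 1) * (\<bar>\<theta>\<bar> + 1) * 1" using a astar by (intro mult_mono) auto
  finally have 1: "2 * \<theta> * (\<bar>\<theta>\<bar> + 1) * (a - astar) \<le> 2 * (\<bar>\<theta>\<bar> + 1)\<^sup>2" by (simp add: power2_eq_square)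
  have 2: "g * (\<bar>\<theta>\<bar> + 1)\<^sup>2 * (a - astar)\<^sup>2 \<le> 1 * (\<bar>\<theta>\<bar> + 1)\<^sup>2 * 1"
    using g sq_le_1 by (intro mult_mono) auto
  have 3: "(1 + \<theta>\<^sup>2) * (1 / g - 1 / g0) \<le> (1 + \<theta>\<^sup>2) * 1" by (intro mult_left_mono gap_le_1) auto
  show ?thesis unfolding Fast weight_step_Fast[OF g(1) g0] weight.simps using 1 2 3 G by simp
qed

text \<open>The second order term carries the coefficient 1, which is what the summand
  \<open>g\<close> of the stepsize condition pays for.\<close>

lemma exp_step:
  assumes "\<bar>h\<bar> \<le> 1"
  shows "(exp (t + g * h) - exp t) / g \<le> exp t * (h + g)"
proof -
  have gh: "\<bar>g * h\<bar> \<le> 1 * 1" unfolding abs_mult using g assms by (intro mult_mono) auto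
  have "h\<^sup>2 \<le> 1" using assms by (simp add: abs_square_le_1)
  then have "g\<^sup>2 * h\<^sup>2 \<le> g\<^sup>2 * 1" by (intro mult_left_mono) auto
  then have "exp (g * h) \<le> 1 + g * h + g\<^sup>2"
    using exp_le_quadratic[of "g * h"] gh by (simp add: power_mult_distrib)
  then have "exp t * exp (g * h) \<le> exp t * (1 + g * h + g\<^sup>2)" by (intro mult_left_mono) auto
  then have "(exp (t + g * h) - exp t) / g \<le> (exp t * (1 + g * h + g\<^sup>2) - exp t) / g"
    using g by (intro divide_right_mono) (auto simp: exp_add)
  also have "\<dots> = exp t * (h + g)" using g by (simp add: field_simps power2_eq_square)
  finally show ?thesis .
qed

text \<open>Intended for large scales, where \<open>a\<close> is small in mean; so its coefficient
  may be the generous 4. The lower bound on \<open>\<theta>\<close> turns the lower order terms of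
  \<open>Fast\<close> into a fraction of \<delta> times the weight.\<close>

lemma weight_step_right:
  assumes "1 \<le> \<theta>" "8 \<le> \<delta> * \<theta>"
  shows "weight_step alg astar g0 g \<theta> a \<le> weight alg \<theta> * (- \<delta> / 2 + 4 * a)"
proof (cases alg)
  case Standard
  have "\<bar>g * (a - astar)\<bar> \<le> 1 * 1"
    unfolding abs_mult using g a astar by (intro mult_mono) auto
  then have "\<bar>\<theta> + g * (a - astar)\<bar> = \<theta> + g * (a - astar)" using assms by auto
  then have "weight_step Standard astar g0 g \<theta> a \<le> exp \<theta> * ((a - astar) + g) + exp \<theta> * (1 / g - 1 / g0)"
    unfolding weight_step_Standard[OF g(1) g0] using exp_step[of "a - astar" \<theta>] a astar assms by simp
  also have "\<dots> = exp \<theta> * (1 / g - 1 / g0 + g - astar + a)" by (simp add: algebra_simps)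
  also have "\<dots> \<le> exp \<theta> * (- \<delta> / 2 + 4 * a)" using gap' a d by (intro mult_left_mono) auto
  finally show ?thesis using Standard assms by simp
next
  case Fast
  let ?W = "1 + \<theta>\<^sup>2"
  have "8 * \<theta> \<le> \<delta> * \<theta> * \<theta>" using assms by (intro mult_right_mono) auto
  also have "\<dots> \<le> \<delta> * ?W" using d by (simp add: power2_eq_square algebra_simps)
  finally have small: "\<theta> \<le> \<delta> / 8 * ?W" by simp
  have up: "2 * \<theta> * (\<theta> + 1) * a \<le> 4 * ?W * a"
  proof (intro mult_right_mono a)
    have "4 * ?W - 2 * \<theta> * (\<theta> + 1) = (\<theta> - 1)\<^sup>2 + \<theta>\<^sup>2 + 3" by (simp add: power2_eq_square algebra_simps)
    then show "2 * \<theta> * (\<theta> + 1) \<le> 4 * ?W"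
      using zero_le_power2[of "\<theta> - 1"] zero_le_power2[of \<theta>] by linarith
  qed
  \<comment> \<open>One of the two units of slope of \<open>Fast\<close> is given away:
    \<open>astar * ?W\<close> is what the gap condition balances.\<close>
  have lo: "- (2 * \<theta> * (\<theta> + 1) * astar) \<le> - (astar * ?W)"
  proof -
    have "?W \<le> 2 * \<theta> * (\<theta> + 1)" using assms mult_mono[of 1 \<theta> 1 \<theta>] by (simp add: power2_eq_square algebra_simps)
    then have "astar * ?W \<le> astar * (2 * \<theta> * (\<theta> + 1))" using astar by (intro mult_left_mono) auto
    then show ?thesis by (simp add: mult_ac)
  qed
  have sq: "g * (\<theta> + 1)\<^sup>2 * (a - astar)\<^sup>2 \<le> g * ?W + 2 * \<theta>"
  proof -
    have "g * (\<theta> + 1)\<^sup>2 * (a - astar)\<^sup>2 \<le> g * (\<theta> + 1)\<^sup>2 * 1"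
      using g sq_le_1 by (intro mult_left_mono) auto
    also have "\<dots> = g * ?W + g * (2 * \<theta>)" by (simp add: power2_eq_square algebra_simps)
    also have "g * (2 * \<theta>) \<le> 1 * (2 * \<theta>)" using g assms by (intro mult_right_mono) auto
    finally show ?thesis by simp
  qed
  have "weight_step Fast astar g0 g \<theta> a = ?W * (1 / g - 1 / g0) + (2 * \<theta> * (\<theta> + 1) * a - 2 * \<theta> * (\<theta> + 1) * astar) +
      g * (\<theta> + 1)\<^sup>2 * (a - astar)\<^sup>2"
    unfolding weight_step_Fast[OF g(1) g0] using assms by (simp add: right_diff_distrib)
  also have "\<dots> \<le> ?W * (1 / g - 1 / g0) + (4 * ?W * a - astar * ?W) + (g * ?W + 2 * (\<delta> / 8 * ?W))"
    using up lo sq small by linarith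
  also have "\<dots> = ?W * ((1 / g - 1 / g0 + g) - astar + \<delta> / 4 + 4 * a)" by (simp add: algebra_simps)
  also have "\<dots> \<le> ?W * (- \<delta> / 2 + 4 * a)" using gap' d by (intro mult_left_mono) auto
  finally show ?thesis using Fast by simp
qed

text \<open>Writes astar - a as (1 / 2 - a) - (1 / 2 - astar). The first part has mean at most a
  small error at small scales, and the second is balanced against the stepsize terms. For
  \<open>Fast\<close>, the lower order terms amount to 3 r, and 16 <= \<delta> r makes this at most
  3 \<delta> / 16 times the weight.\<close>

lemma weight_step_left:
  assumes "\<theta> \<le> - 1" "16 \<le> \<delta> * (- \<theta>)"
  shows "weight_step alg astar g0 g \<theta> a \<le> weight alg \<theta> * (- \<delta> / 2 + left_slope alg * (1 / 2 - a))"
proof (cases alg)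
  case Standard
  have "\<bar>g * (a - astar)\<bar> \<le> 1 * 1"
    unfolding abs_mult using g a astar by (intro mult_mono) auto
  then have "\<bar>\<theta> + g * (a - astar)\<bar> = - \<theta> + g * (astar - a)" using assms by (auto simp: algebra_simps)
  then have "weight_step Standard astar g0 g \<theta> a \<le> exp (- \<theta>) * ((astar - a) + g) + exp (- \<theta>) * (1 / g - 1 / g0)"
    unfolding weight_step_Standard[OF g(1) g0] using exp_step[of "astar - a" "- \<theta>"] a astar assms by simp
  also have "\<dots> = exp (- \<theta>) * (1 / g - 1 / g0 + g + astar - a)" by (simp add: algebra_simps)
  also have "\<dots> \<le> exp (- \<theta>) * (- \<delta> / 2 + 1 * (1 / 2 - a))" using gap' d by (intro mult_left_mono) auto
  finally show ?thesis using Standard assms by (simp add: left_slope_def)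
next
  case Fast
  define r where "r = - \<theta>"
  let ?W = "1 + r\<^sup>2"
  have r: "1 \<le> r" "16 \<le> \<delta> * r" "\<bar>\<theta>\<bar> = r" "\<theta> = - r" using assms by (auto simp: r_def)
  have "16 * r \<le> \<delta> * r * r" using r by (intro mult_right_mono) auto
  also have "\<dots> \<le> \<delta> * ?W" using d by (simp add: power2_eq_square algebra_simps)
  finally have small: "r \<le> \<delta> / 16 * ?W" by simp
  have rG: "2 * r * (r + 1) = 2 * ?W + 2 * (r - 1)" by (simp add: power2_eq_square algebra_simps)
  have up: "2 * r * (r + 1) * (1 / 2 - a) \<le> 2 * ?W * (1 / 2 - a) + r"
  proof -
    have "2 * (r - 1) * (1 / 2 - a) \<le> 2 * (r - 1) * (1 / 2)" using r a by (intro mult_left_mono) auto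
    also have "\<dots> \<le> r" by simp
    finally show ?thesis unfolding rG distrib_right by simp
  qed
  have lo: "- (2 * r * (r + 1) * (1 / 2 - astar)) \<le> - (?W * (1 / 2 - astar))"
  proof -
    have "?W \<le> 2 * r * (r + 1)" unfolding rG using r(1) zero_le_power2[of r] by argo
    then have "?W * (1 / 2 - astar) \<le> 2 * r * (r + 1) * (1 / 2 - astar)" using astar by (intro mult_right_mono) auto
    then show ?thesis by simp
  qed
  have sq: "g * (r + 1)\<^sup>2 * (a - astar)\<^sup>2 \<le> g * ?W + 2 * r"
  proof -
    have "g * (r + 1)\<^sup>2 * (a - astar)\<^sup>2 \<le> g * (r + 1)\<^sup>2 * 1"
      using g sq_le_1 by (intro mult_left_mono) auto
    also have "\<dots> = g * ?W + g * (2 * r)" by (simp add: power2_eq_square algebra_simps)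
    also have "g * (2 * r) \<le> 1 * (2 * r)" using g r by (intro mult_right_mono) auto
    finally show ?thesis by simp
  qed
  have "weight_step Fast astar g0 g \<theta> a = ?W * (1 / g - 1 / g0) +
      (2 * r * (r + 1) * (1 / 2 - a) - 2 * r * (r + 1) * (1 / 2 - astar)) + g * (r + 1)\<^sup>2 * (a - astar)\<^sup>2"
    unfolding weight_step_Fast[OF g(1) g0] r(3) unfolding r(4) by (simp add: algebra_simps)
  also have "\<dots> \<le> ?W * (1 / g - 1 / g0) + ((2 * ?W * (1 / 2 - a) + \<delta> / 16 * ?W) - ?W * (1 / 2 - astar)) +
      (g * ?W + 2 * (\<delta> / 16 * ?W))"
    using up lo sq small by linarith
  also have "\<dots> = ?W * ((1 / g - 1 / g0 + g) - (1 / 2 - astar) + 3 * (\<delta> / 16) + 2 * (1 / 2 - a))"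
  proof -
    have "?W * x + ((2 * ?W * y + k * ?W) - ?W * z) + (g * ?W + 2 * (k * ?W)) =
        ?W * ((x + g) - z + 3 * k + 2 * y)" for x y z k :: real by (simp add: algebra_simps)
    then show ?thesis .
  qed
  also have "\<dots> \<le> ?W * (- \<delta> / 2 + 2 * (1 / 2 - a))" using gap' d by (intro mult_left_mono) auto
  finally show ?thesis using Fast r by (simp add: left_slope_def)
qed

end

section \<open>The stepsize condition with a uniform margin\<close>

lemma stepsize_gap:
  fixes \<gamma> :: "nat \<Rightarrow> real"
  assumes pos: "\<forall>i\<ge>1. 0 < \<gamma> i" and b: "b \<le> 1"
    and lim: "limsup (\<lambda>i. ereal (inverse (\<gamma> (i + 1)) - inverse (\<gamma> i))) + limsup (\<lambda>i. ereal (\<gamma> i)) < ereal b"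
  shows "\<exists>\<delta>>0. \<exists>i0\<ge>1. \<forall>i\<ge>i0. \<gamma> (i + 1) \<le> 1 \<and>
    (1 / \<gamma> (i + 1) - 1 / \<gamma> i) + \<gamma> (i + 1) \<le> b - \<delta>"
proof -
  define A where "A = limsup (\<lambda>i. ereal (inverse (\<gamma> (i + 1)) - inverse (\<gamma> i)))"
  define B where "B = limsup (\<lambda>i. ereal (\<gamma> i))"
  have AB: "A + B < ereal b" using lim by (simp add: A_def B_def)
  \<comment> \<open>If 1 / \<gamma> eventually decreased by a fixed amount at every step, it would
    become negative. With both limits superior nonnegative, their sum below b forces both to be
    finite.\<close>
  have A0: "0 \<le> A"
  proof (rule ccontr)
    assume "\<not> 0 \<le> A"
    then obtain c where c: "A < ereal c" "c < 0"
      by (metis ereal_dense2 ereal_less(1) less_ereal.simps(1) not_le zero_ereal_def)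
    then have "\<forall>\<^sub>F i in sequentially. ereal (inverse (\<gamma> (i + 1)) - inverse (\<gamma> i)) < ereal c"
      unfolding A_def by (intro Limsup_lessD)
    then obtain N where N: "\<And>i. N \<le> i \<Longrightarrow> inverse (\<gamma> (i + 1)) - inverse (\<gamma> i) < c"
      by (auto simp: eventually_sequentially)
    have dec: "inverse (\<gamma> (N + n)) \<le> inverse (\<gamma> N) + c * n" for n
    proof (induction n)
      case (Suc n)
      then show ?case using N[of "N + n"] by (simp add: algebra_simps)
    qed simp
    obtain n :: nat where n: "\<bar>inverse (\<gamma> N)\<bar> / (- c) < n" using reals_Archimedean2 by blast
    then have "inverse (\<gamma> N) + c * n < 0" using c by (simp add: field_simps abs_if split: if_splits)
    moreover have "0 \<le> \<bar>inverse (\<gamma> N)\<bar> / (- c)" using c by (intro divide_nonneg_pos) auto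
    \<comment> \<open>\<open>\<gamma> 0\<close> is unconstrained, so positivity is invoked at an
      index at least 1.\<close>
    then have "1 \<le> n" using n by (cases n) auto
    then have "0 < inverse (\<gamma> (N + n))" using pos by simp
    ultimately show False using dec[of n] by linarith
  qed
  have B0: "0 \<le> B"
    unfolding B_def using pos
    by (intro le_Limsup) (auto simp: eventually_sequentially intro!: exI[of _ 1] less_imp_le)
  obtain a' b' where ab: "A = ereal a'" "B = ereal b'"
    using AB A0 B0 by (cases A; cases B) auto
  \<comment> \<open>One third of the slack for each limit superior, one third as the margin.\<close>
  define \<delta> where "\<delta> = (b - (a' + b')) / 3"
  have d: "0 < \<delta>" "0 \<le> a'" "0 \<le> b'" using AB A0 B0 unfolding ab \<delta>_def by auto
  have "\<forall>\<^sub>F i in sequentially. ereal (inverse (\<gamma> (i + 1)) - inverse (\<gamma> i)) < ereal (a' + \<delta>)"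
    using d ab unfolding A_def by (intro Limsup_lessD) auto
  moreover have "\<forall>\<^sub>F i in sequentially. ereal (\<gamma> i) < ereal (b' + \<delta>)"
    using d ab unfolding B_def by (intro Limsup_lessD) auto
  ultimately obtain N where N: "\<And>i. N \<le> i \<Longrightarrow> inverse (\<gamma> (i + 1)) - inverse (\<gamma> i) < a' + \<delta>"
      "\<And>i. N \<le> i \<Longrightarrow> \<gamma> i < b' + \<delta>"
    unfolding eventually_sequentially by (metis (no_types, lifting) less_ereal.simps(1) nat_le_linear order_trans)
  have "\<gamma> (i + 1) \<le> 1 \<and> (1 / \<gamma> (i + 1) - 1 / \<gamma> i) + \<gamma> (i + 1) \<le> b - \<delta>" if "max N 1 \<le> i" for i
  proof -
    have "a' + b' = b - 3 * \<delta>" unfolding \<delta>_def by argo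
    moreover have "inverse (\<gamma> (i + 1)) - inverse (\<gamma> i) < a' + \<delta>" "\<gamma> (i + 1) < b' + \<delta>"
      using N(1)[of i] N(2)[of "i + 1"] that by auto
    ultimately show ?thesis using d b unfolding inverse_eq_divide by linarith
  qed
  then show ?thesis using d(1) by (intro exI[of _ \<delta>] conjI exI[of _ "max N 1"]) auto
qed

section \<open>A Foster criterion for inhomogeneous Markov chains\<close>

context Ionescu_Tulcea begin

lemma nn_integral_lim:
  assumes [measurable]: "f \<in> borel_measurable (PiM {0..<n} M)"
  shows "(\<integral>\<^sup>+\<omega>. f (restrict \<omega> {0..<n}) \<partial>PF.lim) = (\<integral>\<^sup>+\<omega>. f \<omega> \<partial>C 0 n (\<lambda>_. undefined))"
proof -
  have up: "up_to {0..<n} = n"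
    unfolding up_to_def by (rule Least_equality) (auto simp: not_le[symmetric])
  have "(\<integral>\<^sup>+\<omega>. f (restrict \<omega> {0..<n}) \<partial>PF.lim) = (\<integral>\<^sup>+\<omega>. f \<omega> \<partial>distr PF.lim (PiM {0..<n} M) (\<lambda>\<omega>. restrict \<omega> {0..<n}))"
  proof (rule nn_integral_distr[symmetric])
    show "(\<lambda>\<omega>. restrict \<omega> {0..<n}) \<in> PF.lim \<rightarrow>\<^sub>M PiM {0..<n} M"
      unfolding measurable_cong_sets[OF PF.sets_lim refl] by (rule measurable_restrict_subset) simp
  qed measurable
  also have "\<dots> = (\<integral>\<^sup>+\<omega>. f \<omega> \<partial>CI {0..<n})" by (simp add: distr_lim)
  also have "\<dots> = (\<integral>\<^sup>+\<omega>. f (restrict \<omega> {0..<n}) \<partial>C 0 n (\<lambda>_. undefined))"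
    unfolding CI_def up
    by (rule nn_integral_distr)
      (auto simp: measurable_cong_sets[OF sets_C[of _ 0 n, simplified] refl] space_PiM intro!: measurable_restrict)
  also have "\<dots> = (\<integral>\<^sup>+\<omega>. f \<omega> \<partial>C 0 n (\<lambda>_. undefined))"
    by (intro nn_integral_cong) (simp add: space_C space_PiM PiE_def extensional_restrict)
  finally show ?thesis .
qed

text \<open>Integrates out the last coordinate: the law of the first \<open>Suc n\<close>
  coordinates is that of the first n, extended by \<open>eP n\<close>.\<close>

lemma nn_integral_lim_step:
  assumes f [measurable]: "f \<in> borel_measurable (PiM {0..<Suc n} M)"
    and g [measurable]: "g \<in> borel_measurable (PiM {0..<n} M)"
    and fg: "\<And>\<omega>. \<omega> \<in> space (PiM {0..<n} M) \<Longrightarrow> (\<integral>\<^sup>+y. f (fun_upd \<omega> n y) \<partial>P n \<omega>) = g \<omega>"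
  shows "(\<integral>\<^sup>+\<omega>. f (restrict \<omega> {0..<Suc n}) \<partial>PF.lim) = (\<integral>\<^sup>+\<omega>. g (restrict \<omega> {0..<n}) \<partial>PF.lim)"
proof -
  have u: "(\<lambda>_. undefined) \<in> space (PiM {0..<0} M)" by (simp add: space_PiM)
  have "(\<integral>\<^sup>+\<omega>. f (restrict \<omega> {0..<Suc n}) \<partial>PF.lim) = (\<integral>\<^sup>+\<omega>. f \<omega> \<partial>(C 0 n (\<lambda>_. undefined) \<bind> eP n))"
    unfolding nn_integral_lim[OF f] by simp
  also have "\<dots> = (\<integral>\<^sup>+\<omega>. \<integral>\<^sup>+\<omega>'. f \<omega>' \<partial>eP n \<omega> \<partial>C 0 n (\<lambda>_. undefined))"
    by (rule nn_integral_bind[where B = "PiM {0..<Suc n} M"])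
      (auto simp: measurable_cong_sets[OF sets_C[OF u, of n, simplified] refl])
  also have "\<dots> = (\<integral>\<^sup>+\<omega>. g \<omega> \<partial>C 0 n (\<lambda>_. undefined))"
    using space_C[OF u, of n] by (intro nn_integral_cong) (simp add: nn_integral_eP fg)
  finally show ?thesis unfolding nn_integral_lim[OF g] .
qed

end

text \<open>\<open>Q n\<close> moves time n to time \<open>Suc n\<close>; the initial law
  \<open>K 0\<close> is left free.\<close>

locale markov_chain_law = Ionescu_Tulcea K "\<lambda>_. N"
  for K :: "nat \<Rightarrow> (nat \<Rightarrow> 'a) \<Rightarrow> 'a measure" and N :: "'a measure" +
  fixes Q :: "nat \<Rightarrow> 'a \<Rightarrow> 'a measure"
  assumes markov: "\<And>n \<omega>. K (Suc n) \<omega> = Q n (\<omega> n)"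
    and Q_meas [measurable]: "\<And>n. Q n \<in> N \<rightarrow>\<^sub>M subprob_algebra N"
begin

lemma measurable_coordinate [measurable]: "(\<lambda>\<omega>. \<omega> i) \<in> PF.lim \<rightarrow>\<^sub>M N"
  unfolding measurable_cong_sets[OF PF.sets_lim refl] by (rule measurable_component_singleton) simp

lemma prob_space_lim: "prob_space PF.lim"
proof -
  have "prob_space (CI {})" by (rule PF.prob_space_P) auto
  then show ?thesis
    unfolding distr_lim[OF finite.emptyI, symmetric]
    by (rule prob_space_distrD[rotated]) (simp add: measurable_cong_sets[OF PF.sets_lim refl])
qed

text \<open>The Markov property tested against a nonnegative function of the past; \<open>h\<close>
  will be the indicator of having avoided a set so far.\<close>

lemma nn_integral_markov:
  assumes h [measurable]: "h \<in> borel_measurable (PiM {0..<Suc n} (\<lambda>_. N))" and F [measurable]: "F \<in> borel_measurable N"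
  shows "(\<integral>\<^sup>+\<omega>. h (restrict \<omega> {0..<Suc n}) * F (\<omega> (Suc n)) \<partial>PF.lim) =
    (\<integral>\<^sup>+\<omega>. h (restrict \<omega> {0..<Suc n}) * (\<integral>\<^sup>+y. F y \<partial>Q n (\<omega> n)) \<partial>PF.lim)"
proof -
  let ?f = "\<lambda>\<omega>. h (restrict \<omega> {0..<Suc n}) * F (\<omega> (Suc n))"
  let ?g = "\<lambda>\<omega>. h \<omega> * (\<integral>\<^sup>+y. F y \<partial>Q n (\<omega> n))"
  have r: "(\<lambda>\<omega>. restrict \<omega> {0..<Suc n}) \<in> PiM {0..<Suc (Suc n)} (\<lambda>_. N) \<rightarrow>\<^sub>M PiM {0..<Suc n} (\<lambda>_. N)"
    by (rule measurable_restrict_subset) auto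
  have c: "(\<lambda>\<omega>. \<omega> (Suc n)) \<in> PiM {0..<Suc (Suc n)} (\<lambda>_. N) \<rightarrow>\<^sub>M N"
    and c': "(\<lambda>\<omega>. \<omega> n) \<in> PiM {0..<Suc n} (\<lambda>_. N) \<rightarrow>\<^sub>M N"
    by (rule measurable_component_singleton; simp)+
  have f: "?f \<in> borel_measurable (PiM {0..<Suc (Suc n)} (\<lambda>_. N))"
    using measurable_compose[OF r h] measurable_compose[OF c F] by measurable
  have qF: "(\<lambda>x. \<integral>\<^sup>+y. F y \<partial>Q n x) \<in> borel_measurable N" by measurable
  have g: "?g \<in> borel_measurable (PiM {0..<Suc n} (\<lambda>_. N))"
    using h measurable_compose[OF c' qF] by measurable
  have "(\<integral>\<^sup>+\<omega>. ?f (restrict \<omega> {0..<Suc (Suc n)}) \<partial>PF.lim) = (\<integral>\<^sup>+\<omega>. ?g (restrict \<omega> {0..<Suc n}) \<partial>PF.lim)"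
  proof (rule nn_integral_lim_step[OF f g])
    fix \<omega> assume w: "\<omega> \<in> space (PiM {0..<Suc n} (\<lambda>_. N))"
    then have wn: "\<omega> n \<in> space N" by (auto simp: space_PiM)
    have "restrict (fun_upd \<omega> (Suc n) y) {0..<Suc n} = \<omega>" for y
      using w by (auto simp: space_PiM PiE_def extensional_def fun_eq_iff)
    then show "(\<integral>\<^sup>+y. ?f (fun_upd \<omega> (Suc n) y) \<partial>K (Suc n) \<omega>) = ?g \<omega>"
      using measurable_space[OF Q_meas wn]
      by (simp add: markov nn_integral_cmult space_subprob_algebra cong: measurable_cong_sets)
  qed
  then show ?thesis
    by (simp add: Int_absorb1 restrict_restrict min_absorb1 cong: restrict_cong)
qed

text \<open>
  Foster's criterion on the event \<open>E n\<close> of no visit to \<open>A\<close> during \<open>k, \<dots>, n\<close>: the drift gives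
  \<open>\<Sum>\<^sub>n P (E n) \<le> r\<close>. Restricting to \<open>L k (\<omega> k) \<le> r\<close> avoids any integrability of \<open>L\<close>.
\<close>
lemma no_visit_null:
  assumes A [measurable]: "A \<in> sets N" and L [measurable]: "\<And>n. L n \<in> borel_measurable N"
    and drift: "\<And>n y. k \<le> n \<Longrightarrow> y \<in> space N \<Longrightarrow> y \<notin> A \<Longrightarrow> (\<integral>\<^sup>+z. L (Suc n) z \<partial>Q n y) + 1 \<le> L n y"
  shows "AE \<omega> in PF.lim. L k (\<omega> k) \<le> ennreal r \<longrightarrow> (\<exists>i\<ge>k. \<omega> i \<in> A)"
proof -
  interpret P: prob_space PF.lim by (rule prob_space_lim)
  define B where "B n \<omega> \<longleftrightarrow> L k (\<omega> k) \<le> ennreal r \<and> (\<forall>i\<in>{k..n}. \<omega> i \<notin> A)" for n and \<omega> :: "nat \<Rightarrow> 'a"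
  define E where "E n = {\<omega> \<in> space PF.lim. B n \<omega>}" for n
  define h where "h n \<omega> = (if B n \<omega> then 1 else 0 :: ennreal)" for n \<omega>
  have E_sets [measurable]: "E n \<in> sets PF.lim" for n unfolding E_def B_def by measurable
  have h_meas: "h n \<in> borel_measurable (PiM {0..<Suc n} (\<lambda>_. N))" if "k \<le> n" for n
  proof -
    have c: "(\<lambda>\<omega>. \<omega> i) \<in> PiM {0..<Suc n} (\<lambda>_. N) \<rightarrow>\<^sub>M N" if "i \<le> n" for i
      by (rule measurable_component_singleton) (use that in simp)
    have "{\<omega> \<in> space (PiM {0..<Suc n} (\<lambda>_. N)). \<omega> i \<notin> A} \<in> sets (PiM {0..<Suc n} (\<lambda>_. N))" if "i \<in> {k..n}" for i
    proof -
      have [measurable]: "(\<lambda>\<omega>. \<omega> i) \<in> PiM {0..<Suc n} (\<lambda>_. N) \<rightarrow>\<^sub>M N" using c that by simp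
      show ?thesis by measurable
    qed
    then have "{\<omega> \<in> space (PiM {0..<Suc n} (\<lambda>_. N)). \<forall>i\<in>{k..n}. \<omega> i \<notin> A} \<in> sets (PiM {0..<Suc n} (\<lambda>_. N))"
      by (intro sets.sets_Collect_finite_All) auto
    moreover have "{\<omega> \<in> space (PiM {0..<Suc n} (\<lambda>_. N)). L k (\<omega> k) \<le> ennreal r} \<in> sets (PiM {0..<Suc n} (\<lambda>_. N))"
      using measurable_compose[OF c[OF that] L] by measurable
    ultimately have "{\<omega> \<in> space (PiM {0..<Suc n} (\<lambda>_. N)). B n \<omega>} \<in> sets (PiM {0..<Suc n} (\<lambda>_. N))"
      unfolding B_def by (intro sets.sets_Collect_conj)
    then show ?thesis unfolding h_def by (intro measurable_If) auto
  qed
  have h_restrict: "h n (restrict \<omega> {0..<Suc n}) = h n \<omega>" if "k \<le> n" for n \<omega>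
    using that by (simp add: h_def B_def)
  have hE: "(\<integral>\<^sup>+\<omega>. h n \<omega> \<partial>PF.lim) = emeasure PF.lim (E n)" for n
  proof -
    have "(\<integral>\<^sup>+\<omega>. h n \<omega> \<partial>PF.lim) = (\<integral>\<^sup>+\<omega>. indicator (E n) \<omega> \<partial>PF.lim)"
      by (intro nn_integral_cong) (simp add: h_def E_def indicator_def)
    also have "\<dots> = emeasure PF.lim (E n)" by (rule nn_integral_indicator[OF E_sets])
    finally show ?thesis .
  qed
  have hm [measurable]: "h n \<in> borel_measurable PF.lim" for n
    unfolding h_def B_def by measurable
  define u where "u n = (\<integral>\<^sup>+\<omega>. h n \<omega> * L n (\<omega> n) \<partial>PF.lim)" for n
  have step: "u (Suc n) + emeasure PF.lim (E n) \<le> u n" if n: "k \<le> n" for n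
  proof -
    \<comment> \<open>The events decrease, so \<open>h (Suc n)\<close> is replaced by
      \<open>h n\<close>, which depends on coordinates up to \<open>n\<close> only and allows
      conditioning.\<close>
    have "u (Suc n) \<le> (\<integral>\<^sup>+\<omega>. h n \<omega> * L (Suc n) (\<omega> (Suc n)) \<partial>PF.lim)"
      unfolding u_def using n
      by (intro nn_integral_mono mult_right_mono) (auto simp: h_def B_def)
    also have "\<dots> = (\<integral>\<^sup>+\<omega>. h n \<omega> * (\<integral>\<^sup>+y. L (Suc n) y \<partial>Q n (\<omega> n)) \<partial>PF.lim)"
      using nn_integral_markov[OF h_meas[OF n] L[of "Suc n"]] unfolding h_restrict[OF n] .
    finally have "u (Suc n) + emeasure PF.lim (E n) \<le>
        (\<integral>\<^sup>+\<omega>. h n \<omega> * (\<integral>\<^sup>+y. L (Suc n) y \<partial>Q n (\<omega> n)) \<partial>PF.lim) + (\<integral>\<^sup>+\<omega>. h n \<omega> \<partial>PF.lim)"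
      unfolding hE by (intro add_mono) auto
    also have "\<dots> = (\<integral>\<^sup>+\<omega>. h n \<omega> * (\<integral>\<^sup>+y. L (Suc n) y \<partial>Q n (\<omega> n)) + h n \<omega> \<partial>PF.lim)"
      by (rule nn_integral_add[symmetric]) measurable
    also have "\<dots> \<le> u n"
      unfolding u_def
    proof (intro nn_integral_mono)
      fix \<omega> assume "\<omega> \<in> space PF.lim"
      then have "\<omega> n \<in> space N" using measurable_space[OF measurable_coordinate] by blast
      then show "h n \<omega> * (\<integral>\<^sup>+y. L (Suc n) y \<partial>Q n (\<omega> n)) + h n \<omega> \<le> h n \<omega> * L n (\<omega> n)"
        using drift[OF n, of "\<omega> n"] n by (auto simp: h_def B_def)
    qed
    finally show ?thesis .
  qed
  have sum: "u (k + m) + (\<Sum>j<m. emeasure PF.lim (E (k + j))) \<le> ennreal r" for m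
  proof (induction m)
    case 0
    have "u k \<le> (\<integral>\<^sup>+\<omega>. ennreal r \<partial>PF.lim)"
      unfolding u_def by (intro nn_integral_mono) (auto simp: h_def B_def)
    then show ?case by (simp only: nn_integral_const P.emeasure_space_1) simp
  next
    case (Suc m)
    have "u (k + Suc m) + (\<Sum>j<Suc m. emeasure PF.lim (E (k + j))) =
        (u (Suc (k + m)) + emeasure PF.lim (E (k + m))) + (\<Sum>j<m. emeasure PF.lim (E (k + j)))"
      by (simp add: ac_simps)
    also have "\<dots> \<le> u (k + m) + (\<Sum>j<m. emeasure PF.lim (E (k + j)))"
      by (intro add_right_mono step) simp
    finally show ?case using Suc by (rule order_trans)
  qed
  define Einf where "Einf = (\<Inter>n. E n)"
  have [measurable]: "Einf \<in> sets PF.lim" unfolding Einf_def by measurable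
  have bound: "of_nat m * P.prob Einf \<le> max 0 r" for m
  proof -
    have "ennreal (of_nat m * P.prob Einf) = (\<Sum>j<m. emeasure PF.lim Einf)"
      by (simp add: P.emeasure_eq_measure ennreal_mult ennreal_of_nat_eq_real_of_nat)
    also have "\<dots> \<le> (\<Sum>j<m. emeasure PF.lim (E (k + j)))"
      by (intro sum_mono emeasure_mono E_sets) (auto simp: Einf_def)
    also have "\<dots> \<le> u (k + m) + (\<Sum>j<m. emeasure PF.lim (E (k + j)))" by simp
    also have "\<dots> \<le> ennreal r" by (rule sum)
    finally show ?thesis by (cases "0 \<le> r") (auto simp: ennreal_neg)
  qed
  have "P.prob Einf = 0"
  proof (rule ccontr)
    assume "P.prob Einf \<noteq> 0"
    then have pos: "0 < P.prob Einf" using measure_nonneg[of PF.lim Einf] by linarith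
    then obtain m where "max 0 r < of_nat m * P.prob Einf" using reals_Archimedean3 by blast
    then show False using bound[of m] by linarith
  qed
  then have "Einf \<in> null_sets PF.lim" 
    using \<open>Einf \<in> sets PF.lim\<close> by (intro null_setsI) (simp_all only: P.emeasure_eq_measure ennreal_0)
  then have "AE \<omega> in PF.lim. \<omega> \<notin> Einf" by (rule AE_not_in)
  with AE_space show ?thesis
    by eventually_elim (auto simp: Einf_def E_def B_def)
qed

text \<open>Since \<open>L\<close> is finite, each trajectory satisfies the restriction of
  \<open>no_visit_null\<close> for some natural r, so countably many null sets cover the
  exceptions.\<close>

lemma drift_imp_infinitely_often:
  assumes A [measurable]: "A \<in> sets N" and L [measurable]: "\<And>n. L n \<in> borel_measurable N"
    and fin: "\<And>n y. L n y < \<infinity>"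
    and drift: "\<And>n y. n0 \<le> n \<Longrightarrow> y \<in> space N \<Longrightarrow> y \<notin> A \<Longrightarrow> (\<integral>\<^sup>+z. L (Suc n) z \<partial>Q n y) + 1 \<le> L n y"
  shows "AE \<omega> in PF.lim. \<forall>k. \<exists>i\<ge>k. \<omega> i \<in> A"
proof -
  have "AE \<omega> in PF.lim. \<forall>k r :: nat. L (n0 + k) (\<omega> (n0 + k)) \<le> ennreal r \<longrightarrow> (\<exists>i\<ge>n0 + k. \<omega> i \<in> A)"
    unfolding AE_all_countable by (intro allI no_visit_null drift A L) auto
  then show ?thesis
  proof eventually_elim
    case (elim \<omega>)
    show ?case
    proof
      fix k
      obtain r :: nat where "L (n0 + k) (\<omega> (n0 + k)) \<le> ennreal r"
        using fin[of "n0 + k" "\<omega> (n0 + k)"]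
        by (cases "L (n0 + k) (\<omega> (n0 + k))") (use real_arch_simple in \<open>auto intro: ennreal_leI\<close>)
      then obtain i where "n0 + k \<le> i" "\<omega> i \<in> A" using elim by blast
      then show "\<exists>i\<ge>k. \<omega> i \<in> A" by (intro exI[of _ i]) auto
    qed
  qed
qed

end

section \<open>The joint drift\<close>

lemma limit_SUP_lessD:
  fixes f :: "real \<Rightarrow> real \<Rightarrow> ereal"
  assumes "((\<lambda>R. SUP x\<in>- ball 0 R. F x :: ereal) \<longlongrightarrow> L) at_top" "L < c"
  shows "\<exists>R. \<forall>x. R \<le> \<bar>x :: real\<bar> \<longrightarrow> F x < c"
proof -
  have "\<forall>\<^sub>F R in at_top. (SUP x\<in>- ball 0 R. F x) < c"
    using assms by (rule order_tendstoD(2))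
  then obtain R :: real where R: "(SUP x\<in>- ball 0 R. F x) < c"
    by (metis eventually_at_top_linorder order_refl)
  have "F x < c" if "R \<le> \<bar>x\<bar>" for x
  proof -
    have "F x \<le> (SUP x\<in>- ball 0 R. F x)" using that by (intro SUP_upper) (simp add: dist_real_def)
    then show ?thesis using R by (rule order.strict_trans1)
  qed
  then show ?thesis by blast
qed

text \<open>The mean value inequality is applied twice, to \<open>l'\<close> and to l y - y l'(x),
  at the price of a factor 2 against Taylor's formula.\<close>

lemma taylor_quadratic_bound:
  fixes l l' l'' :: "real \<Rightarrow> real"
  assumes l: "\<And>y. (l has_real_derivative l' y) (at y)" and l': "\<And>y. (l' has_real_derivative l'' y) (at y)"
    and B: "\<And>t. \<bar>t\<bar> \<le> \<bar>w\<bar> \<Longrightarrow> \<bar>l'' (x + t)\<bar> \<le> B"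
  shows "\<bar>l (x + w) - l x - w * l' x\<bar> \<le> B * w\<^sup>2"
proof -
  have "0 \<le> B" using B[of 0] by simp
  let ?S = "cball x \<bar>w\<bar>"
  have BS: "\<bar>l'' y\<bar> \<le> B" if "y \<in> ?S" for y
    using B[of "y - x"] that by (simp add: dist_real_def abs_minus_commute)
  have slope: "\<bar>l' y - l' x\<bar> \<le> B * \<bar>w\<bar>" if y: "y \<in> ?S" for y
  proof -
    have "norm (l' y - l' x) \<le> B * norm (y - x)"
      by (rule field_differentiable_bound[of ?S l' l''])
        (use y BS in \<open>auto intro: has_field_derivative_at_within l'\<close>)
    also have "\<dots> \<le> B * \<bar>w\<bar>"
      using y \<open>0 \<le> B\<close> by (intro mult_left_mono) (auto simp: dist_real_def)
    finally show ?thesis by simp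
  qed
  have "norm ((l (x + w) - (x + w) * l' x) - (l x - x * l' x)) \<le> (B * \<bar>w\<bar>) * norm ((x + w) - x)"
  proof (rule field_differentiable_bound[of ?S _ "\<lambda>y. l' y - l' x"])
    show "((\<lambda>y. l y - y * l' x) has_real_derivative l' y - l' x) (at y within ?S)" for y
      by (rule has_field_derivative_at_within) (auto intro!: derivative_eq_intros l)
  qed (use slope in \<open>auto simp: dist_real_def\<close>)
  then show ?thesis by (simp add: algebra_simps power2_eq_square)
qed

lemma regularity_imp_rwm_target:
  assumes "smooth_target \<pi>" "tail_decay \<pi>"
  shows "rwm_target (\<lambda>x. ln (\<pi> x)) (score \<pi>)"
proof -
  let ?l = "\<lambda>x. ln (\<pi> x)" and ?s = "score \<pi>"
  have l: "(?l has_real_derivative ?s y) (at y)" for y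
    using assms(1) unfolding smooth_target_def score_def
    by (simp add: DERIV_deriv_iff_real_differentiable)
  have s: "(?s has_real_derivative dscore \<pi> y) (at y)" for y
    using assms(1) unfolding smooth_target_def dscore_def
    by (simp add: DERIV_deriv_iff_real_differentiable)
  have tail: "\<exists>R. \<forall>x. R \<le> \<bar>x\<bar> \<longrightarrow> x * ?s x \<le> - K" for K
  proof -
    obtain p L where p: "0 < p" "p < 1" and L: "L < (0::ereal)"
      and lim: "((\<lambda>R. SUP x\<in>- ball 0 R. ereal (sgn x * ?s x / \<bar>x\<bar> powr (p - 1))) \<longlongrightarrow> L) at_top"
      using assms(2) unfolding tail_decay_def by auto
    obtain c where c: "L < ereal c" "ereal c < 0" using ereal_dense2[OF L] by blast
    obtain R where R: "\<And>x. R \<le> \<bar>x\<bar> \<Longrightarrow> ereal (sgn x * ?s x / \<bar>x\<bar> powr (p - 1)) < ereal c"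
      using limit_SUP_lessD[OF lim c(1)] by blast
    \<comment> \<open>For |x| beyond this, c |x|^p <= - |K|, where c < 0.\<close>
    define T where "T = max (max 1 R) ((\<bar>K\<bar> / (- c)) powr (1 / p))"
    have "x * ?s x \<le> - K" if x: "T \<le> \<bar>x\<bar>" for x
    proof -
      have x1: "1 \<le> \<bar>x\<bar>" "R \<le> \<bar>x\<bar>" "(\<bar>K\<bar> / (- c)) powr (1 / p) \<le> \<bar>x\<bar>" using x by (auto simp: T_def)
      have "sgn x * ?s x < c * \<bar>x\<bar> powr (p - 1)" using R[OF x1(2)] x1(1) by (auto simp: field_simps)
      then have "\<bar>x\<bar> * (sgn x * ?s x) \<le> \<bar>x\<bar> * (c * \<bar>x\<bar> powr (p - 1))" by (intro mult_left_mono) auto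
      also have "\<bar>x\<bar> * (sgn x * ?s x) = x * ?s x" by (simp add: mult.assoc[symmetric] abs_mult_sgn mult.commute)
      also have "\<bar>x\<bar> * (c * \<bar>x\<bar> powr (p - 1)) = c * \<bar>x\<bar> powr p"
        using x1(1) by (simp add: powr_diff)
      also have "\<dots> \<le> - K"
      proof -
        have "((\<bar>K\<bar> / (- c)) powr (1 / p)) powr p \<le> \<bar>x\<bar> powr p" using x1(3) p by (intro powr_mono2) auto
        then have "\<bar>K\<bar> / (- c) \<le> \<bar>x\<bar> powr p" using p c by (simp add: powr_powr)
        then have "\<bar>K\<bar> \<le> - c * \<bar>x\<bar> powr p" using c by (simp add: field_simps)
        then show ?thesis using abs_ge_self[of K] by linarith
      qed
      finally show ?thesis .
    qed
    then show ?thesis by blast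
  qed
  show ?thesis
  proof
    show "continuous_on UNIV ?s"
      by (meson DERIV_isCont continuous_at_imp_continuous_on s)
    show "\<exists>R. \<forall>x w. R \<le> \<bar>x\<bar> \<longrightarrow> \<bar>w * ?s x\<bar> \<le> 8 \<longrightarrow>
        \<bar>?l (x + w) - ?l x - w * ?s x\<bar> \<le> (w * ?s x)\<^sup>2 / 288"
    proof -
      have lim: "((\<lambda>R. SUP x\<in>- ball 0 R. SUP t\<in>{t. \<bar>t\<bar> \<le> radius \<pi> 8 x}.
            ereal (\<bar>dscore \<pi> (x + t)\<bar> / \<bar>?s x\<bar>\<^sup>2)) \<longlongrightarrow> 0) at_top"
        using assms(1) unfolding smooth_target_def by simp
      have "(0::ereal) < ereal (1 / 288)" by simp
      then obtain R where R: "\<And>x. R \<le> \<bar>x\<bar> \<Longrightarrow>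
          (SUP t\<in>{t. \<bar>t\<bar> \<le> radius \<pi> 8 x}. ereal (\<bar>dscore \<pi> (x + t)\<bar> / \<bar>?s x\<bar>\<^sup>2)) < ereal (1 / 288)"
        using limit_SUP_lessD[OF lim] by blast
      \<comment> \<open>Division by zero gives zero, so the curvature limit is informative only
        where the score does not vanish.\<close>
      obtain R' where R': "\<And>x. R' \<le> \<bar>x\<bar> \<Longrightarrow> x * ?s x \<le> - 1" using tail[of 1] by blast
      have "\<bar>?l (x + w) - ?l x - w * ?s x\<bar> \<le> (w * ?s x)\<^sup>2 / 288"
        if x: "max R R' \<le> \<bar>x\<bar>" and w: "\<bar>w * ?s x\<bar> \<le> 8" for x w
      proof -
        have s0: "0 < \<bar>?s x\<bar>" using R'[of x] x by auto
        have bound: "\<bar>dscore \<pi> (x + t)\<bar> \<le> (?s x)\<^sup>2 / 288" if t: "\<bar>t\<bar> \<le> \<bar>w\<bar>" for t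
        proof -
          have "\<bar>t\<bar> \<le> radius \<pi> 8 x"
          proof -
            have "\<bar>t\<bar> * \<bar>?s x\<bar> \<le> \<bar>w\<bar> * \<bar>?s x\<bar>" using t by (intro mult_right_mono) auto
            then have "\<bar>t\<bar> * \<bar>?s x\<bar> \<le> 8" using w by (simp only: abs_mult)
            then show ?thesis unfolding radius_def using s0 by (simp add: pos_le_divide_eq)
          qed
          then have "ereal (\<bar>dscore \<pi> (x + t)\<bar> / \<bar>?s x\<bar>\<^sup>2) \<le>
              (SUP t\<in>{t. \<bar>t\<bar> \<le> radius \<pi> 8 x}. ereal (\<bar>dscore \<pi> (x + t)\<bar> / \<bar>?s x\<bar>\<^sup>2))"
            by (intro SUP_upper) simp
          also have "\<dots> < ereal (1 / 288)" using R[of x] x by simp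
          finally have "\<bar>dscore \<pi> (x + t)\<bar> / \<bar>?s x\<bar>\<^sup>2 < 1 / 288" by simp
          then show ?thesis using s0 by (simp add: field_simps)
        qed
        have "\<bar>?l (x + w) - ?l x - w * ?s x\<bar> \<le> (?s x)\<^sup>2 / 288 * w\<^sup>2"
          by (rule taylor_quadratic_bound[OF l s bound])
        then show ?thesis by (simp add: power_mult_distrib mult.commute)
      qed
      then show ?thesis by blast
    qed
  qed (use l tail in auto)
qed

lemma compact_increment_imp_bounded:
  assumes "compact_increment q"
  shows "\<exists>ql qu. bounded_increment q ql qu"
proof -
  obtain ql qu where q: "0 < ql" "\<And>z. z \<in> {-1..1} \<Longrightarrow> ql \<le> q z" "\<And>z. z \<in> {-1..1} \<Longrightarrow> q z \<le> qu"
    using assms unfolding compact_increment_def by blast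
  have supp: "q u = 0" if "1 < \<bar>u\<bar>" for u
  proof (rule ccontr)
    assume "q u \<noteq> 0"
    then have "u \<in> closure {z. q z \<noteq> 0}" by (intro subsetD[OF closure_subset]) simp
    moreover have "closure {z. q z \<noteq> 0} = {-1..1}" using assms unfolding compact_increment_def by blast
    ultimately show False using that by auto
  qed
  have qu: "0 < qu" using q(1) q(2,3)[of 0] by simp
  have pd: "prob_density q" and sym: "\<And>u. q (- u) = q u"
    using assms unfolding compact_increment_def by blast+
  have "bounded_increment q ql qu"
  proof
    show "q \<in> borel_measurable borel" "(\<integral>\<^sup>+u. ennreal (q u) \<partial>lborel) = 1" "\<And>u. 0 \<le> q u"
      using pd unfolding prob_density_def by blast+
    show "ql \<le> q u" if "\<bar>u\<bar> \<le> 1" for u using q(2)[of u] that by (simp add: abs_le_iff)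
    show "q u \<le> qu" for u using q(3)[of u] supp[of u] qu by (cases "\<bar>u\<bar> \<le> 1") (auto simp: abs_le_iff)
    show "0 < ql" by (fact q(1))
    show "0 < qu" by (fact qu)
    show "\<And>u. q (- u) = q u" by (fact sym)
    show "\<And>u. 1 < \<bar>u\<bar> \<Longrightarrow> q u = 0" by (fact supp)
  qed
  then show ?thesis by blast
qed

context rwm begin

text \<open>Each alternative combines one of the three bounds on \<open>weight_step\<close>,
  averaged over the proposal, with the drift of \<open>lyap\<close>, in the form that
  \<open>coerced_step_drift\<close> consumes.\<close>

lemma joint_drift:
  assumes d: "0 < \<delta>"
  shows "\<exists>m>0. \<exists>R>0. \<forall>\<theta> x. m \<le> \<bar>\<theta>\<bar> \<or> R \<le> \<bar>x\<bar> \<longrightarrow>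
    7 * weight alg \<theta> + drift (exp \<theta>) x \<le> - 1 \<or>
    1 \<le> \<theta> \<and> 8 \<le> \<delta> * \<theta> \<and>
      weight alg \<theta> * (- \<delta> / 2 + 4 * acc_mean (exp \<theta>) x) + drift (exp \<theta>) x \<le> - 1 \<or>
    \<theta> \<le> - 1 \<and> 16 \<le> \<delta> * (- \<theta>) \<and>
      weight alg \<theta> * (- \<delta> / 2 + left_slope alg * (1 / 2 - acc_mean (exp \<theta>) x)) + drift (exp \<theta>) x \<le> - 1"
proof -
  obtain B where B: "0 < B" "\<And>s x. 0 < s \<Longrightarrow> drift s x \<le> B" using drift_bounded by blast
  obtain S1 where S1: "0 < S1" "\<And>s x. 0 < s \<Longrightarrow> s \<le> S1 \<Longrightarrow> 1 / 2 - \<delta> / 8 \<le> acc_mean s x"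
    using acc_mean_small_scale[of "\<delta> / 8"] d by auto
  obtain m0 where m0: "0 < m0" "\<And>\<theta>. m0 \<le> \<bar>\<theta>\<bar> \<Longrightarrow> 4 * (B + 1) / \<delta> \<le> weight alg \<theta>"
    using weight_unbounded by blast
  \<comment> \<open>16 / \<delta> serves the side conditions of the left and right bounds;
    \<open>m0\<close> makes \<delta> / 4 times the weight at least B + 1; - ln S1 makes the scale at
    most \<open>S1\<close> when \<theta> <= - m1.\<close>
  define m1 where "m1 = max (max 1 (16 / \<delta>)) (max m0 (- ln S1))"
  have m1: "1 \<le> m1" "16 / \<delta> \<le> m1" "m0 \<le> m1" "- ln S1 \<le> m1" by (auto simp: m1_def)
  have far: "weight alg \<theta> * (- \<delta> / 2 + e) + drift (exp \<theta>) x \<le> - 1"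
    if "m1 \<le> \<bar>\<theta>\<bar>" "e \<le> \<delta> / 4" for \<theta> x e
  proof -
    have W: "4 * (B + 1) / \<delta> \<le> weight alg \<theta>" using m0(2) m1(3) that(1) by simp
    have "weight alg \<theta> * (- \<delta> / 2 + e) \<le> weight alg \<theta> * (- (\<delta> / 4))"
      using that weight_ge_1[of alg \<theta>] by (intro mult_left_mono) auto
    also have "\<dots> \<le> 4 * (B + 1) / \<delta> * (- (\<delta> / 4))"
      using W d by (intro mult_right_mono_neg) auto
    also have "\<dots> = - (B + 1)" using d by (simp add: field_simps)
    finally show ?thesis using B(2)[of "exp \<theta>" x] by simp
  qed
  \<comment> \<open>For \<theta> >= - m1, exp |\<theta>| <= exp (2 m1) exp \<theta>, which handles 7
    W, and exp m1 exp \<theta> >= 1 supplies the final - 1. That K >= exp m1 puts exp \<theta> above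
    1 / K, and turns K <= exp \<theta> into \<theta> >= m1.\<close>
  define K where "K = max (exp m1) (14 * exp (2 * m1) + exp m1)"
  have K: "exp m1 \<le> K" "14 * exp (2 * m1) + exp m1 \<le> K" by (simp_all add: K_def)
  have K1: "1 \<le> K" using K(1) m1(1) by (smt (verit) one_le_exp_iff)
  obtain R where R: "0 < R" "\<And>x s. R \<le> \<bar>x\<bar> \<Longrightarrow> 1 / K \<le> s \<Longrightarrow>
      drift s x \<le> - K * s \<or> K \<le> s \<and> acc_mean s x \<le> \<delta> / 16"
    using drift_tail[OF K1, of "\<delta> / 16"] d by auto
  obtain S2 where S2: "0 < S2" "\<And>s x. S2 \<le> s \<Longrightarrow> \<bar>x\<bar> \<le> R \<Longrightarrow> acc_mean s x \<le> \<delta> / 16"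
    using acc_mean_small_compact[of "\<delta> / 16" R] d by auto
  define m where "m = max m1 (ln S2)"
  have right: "1 \<le> \<theta> \<and> 8 \<le> \<delta> * \<theta> \<and>
      weight alg \<theta> * (- \<delta> / 2 + 4 * acc_mean (exp \<theta>) x) + drift (exp \<theta>) x \<le> - 1"
    if "m1 \<le> \<theta>" "acc_mean (exp \<theta>) x \<le> \<delta> / 16" for \<theta> x
  proof (intro conjI far)
    show "1 \<le> \<theta>" using that m1 by linarith
    have "16 / \<delta> \<le> \<theta>" using that m1 by linarith
    then show "8 \<le> \<delta> * \<theta>" using d by (simp add: field_simps)
  qed (use that in auto)
  have "7 * weight alg \<theta> + drift (exp \<theta>) x \<le> - 1 \<or>
    1 \<le> \<theta> \<and> 8 \<le> \<delta> * \<theta> \<and>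
      weight alg \<theta> * (- \<delta> / 2 + 4 * acc_mean (exp \<theta>) x) + drift (exp \<theta>) x \<le> - 1 \<or>
    \<theta> \<le> - 1 \<and> 16 \<le> \<delta> * (- \<theta>) \<and>
      weight alg \<theta> * (- \<delta> / 2 + left_slope alg * (1 / 2 - acc_mean (exp \<theta>) x)) + drift (exp \<theta>) x \<le> - 1"
    if out: "m \<le> \<bar>\<theta>\<bar> \<or> R \<le> \<bar>x\<bar>" for \<theta> x
  proof -
    consider "\<theta> \<le> - m1" | "- m1 \<le> \<theta>" "R \<le> \<bar>x\<bar>" | "- m1 < \<theta>" "\<bar>x\<bar> \<le> R" "m \<le> \<bar>\<theta>\<bar>"
      using out by linarith
    then show ?thesis
    proof cases
      case 1
      have "exp \<theta> \<le> S1" using 1 m1(4) S1(1) by (simp add: ln_ge_iff[symmetric])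
      then have a: "1 / 2 - acc_mean (exp \<theta>) x \<le> \<delta> / 8" using S1(2)[of "exp \<theta>" x] by simp
      have "left_slope alg * (1 / 2 - acc_mean (exp \<theta>) x) \<le> left_slope alg * (\<delta> / 8)"
        using a by (intro mult_left_mono) (auto simp: left_slope_def split: coerced_alg.split)
      also have "\<dots> \<le> 2 * (\<delta> / 8)"
        using d by (intro mult_right_mono) (auto simp: left_slope_def split: coerced_alg.split)
      finally have "weight alg \<theta> * (- \<delta> / 2 + left_slope alg * (1 / 2 - acc_mean (exp \<theta>) x)) + drift (exp \<theta>) x \<le> - 1"
        using 1 by (intro far) auto
      moreover have "16 / \<delta> \<le> - \<theta>" using 1 m1 by linarith
      then have "16 \<le> \<delta> * (- \<theta>)" using d by (simp add: field_simps)
      ultimately show ?thesis using 1 m1(1) by auto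
    next
      case 2
      have em: "exp (- m1) \<le> exp \<theta>" using 2(1) by simp
      have "1 / K \<le> 1 / exp m1" using K(1) K1 by (intro divide_left_mono) auto
      also have "\<dots> \<le> exp \<theta>" using em by (simp add: exp_minus field_simps)
      finally consider "drift (exp \<theta>) x \<le> - K * exp \<theta>" | "K \<le> exp \<theta>" "acc_mean (exp \<theta>) x \<le> \<delta> / 16"
        using R(2)[OF 2(2), of "exp \<theta>"] by blast
      then show ?thesis
      proof cases
        case 1
        have "weight alg \<theta> \<le> 2 * exp \<bar>\<theta>\<bar>" by (rule weight_le_exp)
        also have "exp \<bar>\<theta>\<bar> \<le> exp (2 * m1 + \<theta>)" using 2(1) m1(1) by (cases "0 \<le> \<theta>") auto
        finally have "7 * weight alg \<theta> \<le> 14 * exp (2 * m1) * exp \<theta>"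
          unfolding exp_add by linarith
        moreover have "1 \<le> exp m1 * exp \<theta>" using 2(1) by (simp add: exp_add[symmetric])
        moreover have "(14 * exp (2 * m1) + exp m1) * exp \<theta> \<le> K * exp \<theta>"
          by (intro mult_right_mono K) simp
        ultimately have "7 * weight alg \<theta> + drift (exp \<theta>) x \<le> - 1"
          using 1 unfolding distrib_right mult_minus_left by linarith
        then show ?thesis by blast
      next
        case 2
        have "exp m1 \<le> exp \<theta>" using 2(1) K(1) by linarith
        then show ?thesis using right[of \<theta> x] 2(2) by simp
      qed
    next
      case 3
      have t: "m \<le> \<theta>" using 3 by (auto simp: m_def)
      have "exp (ln S2) \<le> exp \<theta>" using t by (simp add: m_def)
      then have "S2 \<le> exp \<theta>" using S2(1) by simp
      then show ?thesis using right[of \<theta> x] S2(2)[OF _ 3(2)] t by (simp add: m_def)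
    qed
  qed
  moreover have "0 < m" using m1 by (simp add: m_def)
  ultimately show ?thesis using R(1) by blast
qed

end

section \<open>Expectations under one step of the algorithm\<close>

lemma weight_measurable [measurable]: "weight alg \<in> borel_measurable borel"
proof (cases alg)
  case Standard
  then have "weight alg = (\<lambda>\<theta>. exp \<bar>\<theta>\<bar>)" by (simp add: fun_eq_iff)
  then show ?thesis by simp
next
  case Fast
  then have "weight alg = (\<lambda>\<theta>. 1 + \<bar>\<theta>\<bar>\<^sup>2)" by (simp add: fun_eq_iff)
  then show ?thesis by simp
qed

lemma nn_integral_scaled:
  assumes q [measurable]: "q \<in> borel_measurable borel" and q0: "\<And>z. 0 \<le> q z"
    and f [measurable]: "f \<in> borel_measurable borel"
  shows "(\<integral>\<^sup>+z. ennreal (scaled q \<theta> z) * f z \<partial>lborel) = (\<integral>\<^sup>+u. ennreal (q u) * f (exp \<theta> * u) \<partial>lborel)"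
proof -
  have "(\<integral>\<^sup>+z. ennreal (scaled q \<theta> z) * f z \<partial>lborel) =
      ennreal \<bar>exp \<theta>\<bar> * (\<integral>\<^sup>+u. ennreal (scaled q \<theta> (0 + exp \<theta> * u)) * f (0 + exp \<theta> * u) \<partial>lborel)"
    by (rule nn_integral_real_affine) (auto simp: scaled_def)
  also have "\<dots> = (\<integral>\<^sup>+u. ennreal (exp \<theta>) * (ennreal (scaled q \<theta> (exp \<theta> * u)) * f (exp \<theta> * u)) \<partial>lborel)"
    by (subst nn_integral_cmult) (auto simp: scaled_def)
  also have "\<dots> = (\<integral>\<^sup>+u. ennreal (q u) * f (exp \<theta> * u) \<partial>lborel)"
  proof (intro nn_integral_cong)
    fix u
    have "exp (- \<theta>) * (exp \<theta> * u) = u" by (simp add: exp_minus field_simps)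
    then have "exp \<theta> * scaled q \<theta> (exp \<theta> * u) = q u" by (simp add: scaled_def exp_minus field_simps)
    then show "ennreal (exp \<theta>) * (ennreal (scaled q \<theta> (exp \<theta> * u)) * f (exp \<theta> * u)) = ennreal (q u) * f (exp \<theta> * u)"
      by (simp add: mult.assoc[symmetric] ennreal_mult'[symmetric])
  qed
  finally show ?thesis .
qed

lemma nn_integral_coerced_step:
  assumes \<pi>: "prob_density \<pi>" and q: "prob_density q" and f [measurable]: "f \<in> borel_measurable borel"
  shows "(\<integral>\<^sup>+s. f s \<partial>coerced_step alg \<pi> q astar g (\<theta>, x)) =
    (\<integral>\<^sup>+u. ennreal (q u) *
      (f (\<theta> + g * gain alg \<theta> * (acc \<pi> x (x + exp \<theta> * u) - astar), x + exp \<theta> * u) * ennreal (acc \<pi> x (x + exp \<theta> * u)) +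
       f (\<theta> + g * gain alg \<theta> * (acc \<pi> x (x + exp \<theta> * u) - astar), x) * ennreal (1 - acc \<pi> x (x + exp \<theta> * u))) \<partial>lborel)"
proof -
  have [measurable]: "\<pi> \<in> borel_measurable borel" "q \<in> borel_measurable borel"
    and p0: "\<And>x. 0 \<le> \<pi> x" and q0: "\<And>x. 0 \<le> q x"
    using \<pi> q by (auto simp: prob_density_def)
  have acc01: "0 \<le> acc \<pi> x y" "acc \<pi> x y \<le> 1" for x y using p0 by (auto simp: acc_def)
  have [measurable]: "(\<lambda>z. acc \<pi> x (x + z)) \<in> borel_measurable borel" unfolding acc_def by measurable
  define T where "T z b = (\<theta> + g * gain alg \<theta> * (acc \<pi> x (x + z) - astar), if b then x + z else x)" for z b
  define F where "F z = f (T z True) * ennreal (acc \<pi> x (x + z)) + f (T z False) * ennreal (1 - acc \<pi> x (x + z))" for z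
  have Tm: "(\<lambda>z. T z b) \<in> borel_measurable borel" for b
    unfolding T_def borel_prod[symmetric] by measurable
  have Fm: "F \<in> borel_measurable borel"
    using measurable_compose[OF Tm f] unfolding F_def by measurable
  have "(\<lambda>z. distr (measure_pmf (bernoulli_pmf (acc \<pi> x (x + z)))) borel (\<lambda>b. T z b)) \<in> borel \<rightarrow>\<^sub>M prob_algebra borel"
    by (rule bernoulli_distr_measurable) (use Tm acc01 in auto)
  then have K: "(\<lambda>z. distr (measure_pmf (bernoulli_pmf (acc \<pi> x (x + z)))) borel (\<lambda>b. T z b))
      \<in> density lborel (\<lambda>z. ennreal (scaled q \<theta> z)) \<rightarrow>\<^sub>M subprob_algebra borel"
    by (simp add: measurable_prob_algebraD)
  have "(\<integral>\<^sup>+s. f s \<partial>coerced_step alg \<pi> q astar g (\<theta>, x)) =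
      (\<integral>\<^sup>+z. \<integral>\<^sup>+s. f s \<partial>distr (measure_pmf (bernoulli_pmf (acc \<pi> x (x + z)))) borel (\<lambda>b. T z b)
        \<partial>density lborel (\<lambda>z. ennreal (scaled q \<theta> z)))"
    unfolding coerced_step_def prod.case T_def[symmetric] by (rule nn_integral_bind[OF f K])
  also have "\<dots> = (\<integral>\<^sup>+z. F z \<partial>density lborel (\<lambda>z. ennreal (scaled q \<theta> z)))"
    using acc01 by (intro nn_integral_cong) (simp add: nn_integral_distr F_def)
  also have "\<dots> = (\<integral>\<^sup>+z. ennreal (scaled q \<theta> z) * F z \<partial>lborel)"
    using Fm by (subst nn_integral_density) (auto simp: scaled_def)
  also have "\<dots> = (\<integral>\<^sup>+u. ennreal (q u) * F (exp \<theta> * u) \<partial>lborel)"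
    using q0 Fm by (intro nn_integral_scaled) auto
  finally show ?thesis by (simp add: F_def T_def)
qed

context rwm begin

text \<open>The bound on the weight is affine in the acceptance probability, so its mean involves
  only \<open>acc_mean\<close>; this is why all three bounds on \<open>weight_step\<close> have that
  form.\<close>

lemma coerced_step_drift:
  assumes \<pi>: "prob_density \<pi>" and q: "prob_density q"
    and accl: "\<And>x y. acc \<pi> x y = acc_ln l x y"
    and g: "0 < g" "0 < g0"
    and step: "\<And>a. 0 \<le> a \<Longrightarrow> a \<le> 1 \<Longrightarrow> weight_step alg astar g0 g \<theta> a \<le> c0 + c1 * a"
    and neg: "c0 + c1 * acc_mean (exp \<theta>) x + drift (exp \<theta>) x \<le> - 1"
  shows "(\<integral>\<^sup>+s. ennreal (weight alg (fst s) / g + lyap l (snd s)) \<partial>coerced_step alg \<pi> q astar g (\<theta>, x)) + 1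
    \<le> ennreal (weight alg \<theta> / g0 + lyap l x)"
proof -
  let ?a = "\<lambda>u. acc_ln l x (x + exp \<theta> * u)"
  let ?i = "\<lambda>u. lyap_incr l x (x + exp \<theta> * u)"
  define c where "c = weight alg \<theta> / g0 + lyap l x + c0"
  define I where "I u = q u * (c + c1 * ?a u + ?i u)" for u
  have w0: "0 \<le> weight alg t" for t using weight_ge_1[of alg t] by linarith
  have fm: "(\<lambda>s. ennreal (weight alg (fst s) / g + lyap l (snd s))) \<in> borel_measurable borel"
    unfolding borel_prod[symmetric] lyap_def by measurable
  have Iint: "integrable lborel I"
    unfolding I_def by (intro q_times_continuous_integrable continuous_intros cont_acc_ln cont_incr)
  have val: "(\<integral>u. I u \<partial>lborel) = c + c1 * acc_mean (exp \<theta>) x + drift (exp \<theta>) x"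
  proof -
    have 1: "integrable lborel (\<lambda>u. q u * ?a u)" "integrable lborel (\<lambda>u. q u * ?i u)"
      by (intro q_times_continuous_integrable cont_acc_ln cont_incr)+
    have "(\<integral>u. I u \<partial>lborel) = (\<integral>u. c * q u + c1 * (q u * ?a u) + q u * ?i u \<partial>lborel)"
      unfolding I_def by (simp add: algebra_simps)
    also have "\<dots> = c + c1 * acc_mean (exp \<theta>) x + drift (exp \<theta>) x"
      unfolding acc_mean_def drift_def using 1 by simp
    finally show ?thesis .
  qed
  have pt: "0 \<le> I u \<and> ennreal (q u) *
      (ennreal (weight alg (\<theta> + g * gain alg \<theta> * (?a u - astar)) / g + lyap l (x + exp \<theta> * u)) * ennreal (?a u) +
       ennreal (weight alg (\<theta> + g * gain alg \<theta> * (?a u - astar)) / g + lyap l x) * ennreal (1 - ?a u)) \<le> ennreal (I u)" for u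
  proof -
    define w where "w = weight alg (\<theta> + g * gain alg \<theta> * (?a u - astar)) / g"
    have w: "0 \<le> w" using w0 g by (simp add: w_def)
    have le: "w \<le> weight alg \<theta> / g0 + c0 + c1 * ?a u"
      using step[of "?a u"] by (simp add: weight_step_def w_def)
    \<comment> \<open>Both outcomes lead to the same parameter, so the weight factors out and only
      \<open>lyap\<close> sees the accept-reject step.\<close>
    have eq: "(w + lyap l (x + exp \<theta> * u)) * ?a u + (w + lyap l x) * (1 - ?a u) = w + lyap l x + ?i u"
      by (simp add: lyap_incr_def algebra_simps)
    have pos: "0 \<le> (w + lyap l (x + exp \<theta> * u)) * ?a u + (w + lyap l x) * (1 - ?a u)"
      using w by (intro add_nonneg_nonneg mult_nonneg_nonneg) auto
    have "q u * (w + lyap l x + ?i u) \<le> I u"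
      unfolding I_def c_def using le q_nonneg[of u] by (intro mult_left_mono) auto
    moreover have "0 \<le> q u * (w + lyap l x + ?i u)" using pos q_nonneg[of u] unfolding eq by simp
    moreover have "ennreal (q u) * (ennreal (w + lyap l (x + exp \<theta> * u)) * ennreal (?a u) + ennreal (w + lyap l x) * ennreal (1 - ?a u)) =
        ennreal (q u * ((w + lyap l (x + exp \<theta> * u)) * ?a u + (w + lyap l x) * (1 - ?a u)))"
      using w q_nonneg[of u] by (simp add: ennreal_mult[symmetric] ennreal_plus[symmetric] add_nonneg_nonneg del: ennreal_plus)
    ultimately show ?thesis unfolding w_def[symmetric] eq by (auto intro: ennreal_leI)
  qed
  have "(\<integral>\<^sup>+s. ennreal (weight alg (fst s) / g + lyap l (snd s)) \<partial>coerced_step alg \<pi> q astar g (\<theta>, x)) \<le>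
      (\<integral>\<^sup>+u. ennreal (I u) \<partial>lborel)"
    unfolding nn_integral_coerced_step[OF \<pi> q fm] accl fst_conv snd_conv
    by (intro nn_integral_mono) (use pt in blast)
  also have "\<dots> = ennreal (\<integral>u. I u \<partial>lborel)"
    using Iint pt by (intro nn_integral_eq_integral) auto
  finally have le: "(\<integral>\<^sup>+s. ennreal (weight alg (fst s) / g + lyap l (snd s)) \<partial>coerced_step alg \<pi> q astar g (\<theta>, x))
      \<le> ennreal (\<integral>u. I u \<partial>lborel)" .
  have I0: "0 \<le> (\<integral>u. I u \<partial>lborel)" using pt by (intro integral_nonneg_AE) auto
  have "(\<integral>\<^sup>+s. ennreal (weight alg (fst s) / g + lyap l (snd s)) \<partial>coerced_step alg \<pi> q astar g (\<theta>, x)) + 1 \<le>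
      ennreal (\<integral>u. I u \<partial>lborel) + ennreal 1" using le by (simp add: add_right_mono)
  also have "\<dots> = ennreal ((\<integral>u. I u \<partial>lborel) + 1)" using I0 by (intro ennreal_plus[symmetric]) auto
  also have "\<dots> \<le> ennreal (weight alg \<theta> / g0 + lyap l x)"
    unfolding val c_def using neg by (intro ennreal_leI) linarith
  finally show ?thesis .
qed

end

theorem theorem6:
  fixes \<pi> q :: "real \<Rightarrow> real" and \<gamma> :: "nat \<Rightarrow> real" and astar :: real and alg :: coerced_alg
  assumes "astar \<in> {0<..<1/2}"
    and "regularity_assms \<pi> q"
    and "\<forall>i\<ge>1. 0 < \<gamma> i"
    and "limsup (\<lambda>i. ereal (inverse (\<gamma> (i + 1)) - inverse (\<gamma> i))) + limsup (\<lambda>i. ereal (\<gamma> i))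
           < ereal (min astar (1/2 - astar))"
  shows "\<exists>M>0. \<exists>R>0. \<forall>\<theta> x.
    emeasure (chain_law alg \<pi> q astar \<gamma> (\<theta>, x))
      (\<Inter>k. \<Union>i\<in>{k..}. {\<omega> \<in> space (chain_law alg \<pi> q astar \<gamma> (\<theta>, x)).
         \<omega> i \<in> level_set alg M \<times> ball 0 R}) = 1"
proof -
  have reg: "smooth_target \<pi>" "tail_decay \<pi>" "compact_increment q"
    using assms(2) by (simp_all add: regularity_assms_def)
  have pd: "prob_density \<pi>" "prob_density q"
    using reg by (simp_all add: smooth_target_def compact_increment_def)
  have pos: "0 < \<pi> x" for x
  proof -
    obtain c where "0 < c" "\<forall>y\<in>{x}. c \<le> \<pi> y"
      using reg(1) unfolding smooth_target_def by (meson compact_sing)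
    then show ?thesis by simp
  qed
  define l where "l x = ln (\<pi> x)" for x
  have accl: "acc \<pi> x y = acc_ln l x y" for x y
    using pos by (simp add: acc_def acc_ln_def l_def exp_diff)
  obtain ql qu where q: "bounded_increment q ql qu"
    using compact_increment_imp_bounded[OF reg(3)] by blast
  have target: "rwm_target l (score \<pi>)"
    using regularity_imp_rwm_target[OF reg(1,2)] unfolding l_def[abs_def] .
  interpret rwm l "score \<pi>" q ql qu
    using target q by (rule rwm.intro)
  have astar: "0 < astar" "astar < 1 / 2" using assms(1) by auto
  have "min astar (1 / 2 - astar) \<le> 1" using astar by simp
  from stepsize_gap[OF assms(3) this assms(4)]
  obtain \<delta> i0 where d: "0 < \<delta>" "1 \<le> i0"
    and gap: "\<And>i. i0 \<le> i \<Longrightarrow> \<gamma> (i + 1) \<le> 1"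
      "\<And>i. i0 \<le> i \<Longrightarrow> (1 / \<gamma> (i + 1) - 1 / \<gamma> i) + \<gamma> (i + 1) \<le> min astar (1 / 2 - astar) - \<delta>"
    by blast
  obtain m R where m: "0 < m" and R: "0 < R" and out: "\<And>\<theta> x. m \<le> \<bar>\<theta>\<bar> \<or> R \<le> \<bar>x\<bar> \<Longrightarrow>
    7 * weight alg \<theta> + drift (exp \<theta>) x \<le> - 1 \<or>
    1 \<le> \<theta> \<and> 8 \<le> \<delta> * \<theta> \<and>
      weight alg \<theta> * (- \<delta> / 2 + 4 * acc_mean (exp \<theta>) x) + drift (exp \<theta>) x \<le> - 1 \<or>
    \<theta> \<le> - 1 \<and> 16 \<le> \<delta> * (- \<theta>) \<and>
      weight alg \<theta> * (- \<delta> / 2 + left_slope alg * (1 / 2 - acc_mean (exp \<theta>) x)) + drift (exp \<theta>) x \<le> - 1"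
    using joint_drift[OF d(1), of alg] by blast
  define M where "M = weight alg m"
  define A where "A = level_set alg M \<times> ball (0 :: real) R"
  have A_sets: "A \<in> sets borel"
  proof -
    have "level_set alg M \<in> sets borel" unfolding level_set_def by measurable
    then show ?thesis unfolding A_def borel_prod[symmetric] by (intro pair_measureI) auto
  qed
  \<comment> \<open>\<open>\<gamma> 0\<close> may have any sign; \<open>ennreal\<close> still makes
    \<open>Lf 0\<close> finite, and the drift is claimed only from \<open>i0 \<ge> 1\<close>
    on.\<close>
  define Lf where "Lf n s = ennreal (weight alg (fst s) / \<gamma> n + lyap l (snd s))" for n s
  have Lf_meas: "Lf n \<in> borel_measurable borel" for n
    unfolding Lf_def borel_prod[symmetric] lyap_def by measurable
  have step: "(\<integral>\<^sup>+z. Lf (Suc n) z \<partial>coerced_step alg \<pi> q astar (\<gamma> (Suc n)) y) + 1 \<le> Lf n y"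
    if n: "i0 \<le> n" and y: "y \<notin> A" for n y
  proof -
    obtain \<theta> x where yx: "y = (\<theta>, x)" by (cases y)
    have g: "0 < \<gamma> (Suc n)" "\<gamma> (Suc n) \<le> 1" "0 < \<gamma> n"
      and gp: "(1 / \<gamma> (Suc n) - 1 / \<gamma> n) + \<gamma> (Suc n) \<le> min astar (1 / 2 - astar) - \<delta>"
      using gap[OF n] assms(3) d(2) n by auto
    have "m \<le> \<bar>\<theta>\<bar> \<or> R \<le> \<bar>x\<bar>"
    proof (rule ccontr)
      assume "\<not> (m \<le> \<bar>\<theta>\<bar> \<or> R \<le> \<bar>x\<bar>)"
      then show False using y weight_mono[of \<theta> m alg] m by (auto simp: A_def yx level_set_def M_def)
    qed
    then consider
      (all) "7 * weight alg \<theta> + drift (exp \<theta>) x \<le> - 1" |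
      (right) "1 \<le> \<theta>" "8 \<le> \<delta> * \<theta>"
        "weight alg \<theta> * (- \<delta> / 2 + 4 * acc_mean (exp \<theta>) x) + drift (exp \<theta>) x \<le> - 1" |
      (left) "\<theta> \<le> - 1" "16 \<le> \<delta> * (- \<theta>)"
        "weight alg \<theta> * (- \<delta> / 2 + left_slope alg * (1 / 2 - acc_mean (exp \<theta>) x)) + drift (exp \<theta>) x \<le> - 1"
      using out[of \<theta> x] by blast
    then show ?thesis
      unfolding yx Lf_def fst_conv snd_conv
    proof cases
      case all
      show "(\<integral>\<^sup>+s. ennreal (weight alg (fst s) / \<gamma> (Suc n) + lyap l (snd s))
          \<partial>coerced_step alg \<pi> q astar (\<gamma> (Suc n)) (\<theta>, x)) + 1 \<le> ennreal (weight alg \<theta> / \<gamma> n + lyap l x)"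
        by (rule coerced_step_drift[where ?c0.0 = "7 * weight alg \<theta>" and ?c1.0 = 0, OF pd accl g(1,3)])
          (use weight_step_le[OF astar g(1,2,3) _ _ d(1) gp] all in auto)
    next
      case right
      show "(\<integral>\<^sup>+s. ennreal (weight alg (fst s) / \<gamma> (Suc n) + lyap l (snd s))
          \<partial>coerced_step alg \<pi> q astar (\<gamma> (Suc n)) (\<theta>, x)) + 1 \<le> ennreal (weight alg \<theta> / \<gamma> n + lyap l x)"
        by (rule coerced_step_drift[where ?c0.0 = "weight alg \<theta> * (- \<delta> / 2)" and ?c1.0 = "weight alg \<theta> * 4", OF pd accl g(1,3)])
          (use weight_step_right[OF astar g(1,2,3) _ _ d(1) gp right(1,2)] right(3) in \<open>simp_all only: distrib_left mult.assoc\<close>)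
    next
      case left
      show "(\<integral>\<^sup>+s. ennreal (weight alg (fst s) / \<gamma> (Suc n) + lyap l (snd s))
          \<partial>coerced_step alg \<pi> q astar (\<gamma> (Suc n)) (\<theta>, x)) + 1 \<le> ennreal (weight alg \<theta> / \<gamma> n + lyap l x)"
      \<comment> \<open>The constant 1 / 2 inside the bound is moved to \<open>c0\<close>, leaving a
        negative coefficient of \<open>a\<close>.\<close>
      proof (rule coerced_step_drift[where ?c0.0 = "weight alg \<theta> * (- \<delta> / 2 + left_slope alg / 2)"
            and ?c1.0 = "- (weight alg \<theta> * left_slope alg)", OF pd accl g(1,3)])
        have eq: "weight alg \<theta> * (- \<delta> / 2 + left_slope alg / 2) + - (weight alg \<theta> * left_slope alg) * a =
            weight alg \<theta> * (- \<delta> / 2 + left_slope alg * (1 / 2 - a))" for a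
          by (simp add: algebra_simps)
        show "weight_step alg astar (\<gamma> n) (\<gamma> (Suc n)) \<theta> a \<le>
            weight alg \<theta> * (- \<delta> / 2 + left_slope alg / 2) + - (weight alg \<theta> * left_slope alg) * a"
          if "0 \<le> a" "a \<le> 1" for a
          unfolding eq by (rule weight_step_left[OF astar g that d(1) gp left(1,2)])
        show "weight alg \<theta> * (- \<delta> / 2 + left_slope alg / 2) +
            - (weight alg \<theta> * left_slope alg) * acc_mean (exp \<theta>) x + drift (exp \<theta>) x \<le> - 1"
          unfolding eq by (rule left(3))
      qed
    qed
  qed
  have "emeasure (chain_law alg \<pi> q astar \<gamma> (\<theta>, x))
      (\<Inter>k. \<Union>i\<in>{k..}. {\<omega> \<in> space (chain_law alg \<pi> q astar \<gamma> (\<theta>, x)). \<omega> i \<in> A}) = 1" for \<theta> x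
  proof -
    let ?P = "chain_law alg \<pi> q astar \<gamma> (\<theta>, x)"
    interpret P: prob_space ?P by (rule chain_law_space(3)[OF pd])
    interpret IT: Ionescu_Tulcea "coerced_kernel alg \<pi> q astar \<gamma> (\<theta>, x)" "\<lambda>_. borel"
      by (rule coerced_Ionescu_Tulcea[OF pd])
    interpret chain: markov_chain_law "coerced_kernel alg \<pi> q astar \<gamma> (\<theta>, x)" borel
        "\<lambda>n. coerced_step alg \<pi> q astar (\<gamma> (Suc n))"
      by unfold_locales (simp_all add: measurable_prob_algebraD coerced_step_measurable[OF pd])
    have ae: "AE \<omega> in ?P. \<forall>k. \<exists>i\<ge>k. \<omega> i \<in> A"
      unfolding chain_law_def
      by (rule chain.drift_imp_infinitely_often[where L = Lf, OF A_sets Lf_meas _ step])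
        (simp_all add: Lf_def)
    have coord: "(\<lambda>\<omega>. \<omega> i) \<in> ?P \<rightarrow>\<^sub>M borel" for i
      unfolding chain_law_def by (rule chain.measurable_coordinate)
    have visit: "{\<omega> \<in> space ?P. \<omega> i \<in> A} \<in> sets ?P" for i
      using measurable_sets[OF coord A_sets, of i] by (simp add: vimage_def Int_def conj_commute)
    show ?thesis
    proof (rule P.emeasure_eq_1_AE)
      show "(\<Inter>k. \<Union>i\<in>{k..}. {\<omega> \<in> space ?P. \<omega> i \<in> A}) \<in> sets ?P"
        using visit sets.top[of ?P] chain_law_space(2)[OF pd, of alg astar \<gamma> "(\<theta>, x)"]
        by (intro sets.countable_INT'' sets.countable_UN') auto
      show "AE \<omega> in ?P. \<omega> \<in> (\<Inter>k. \<Union>i\<in>{k..}. {\<omega> \<in> space ?P. \<omega> i \<in> A})"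
        using ae
      proof eventually_elim
        case (elim \<omega>)
        then show ?case using chain_law_space(2)[OF pd, of alg astar \<gamma> "(\<theta>, x)"] by fastforce
      qed
    qed
  qed
  moreover have "0 < M" using weight_ge_1[of alg m] by (simp add: M_def)
  ultimately show ?thesis using R unfolding A_def by blast
qed

end
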